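(* Let $R$ be a commutative ring, $\alpha,z,\zeta\in R^\times$ with $\zeta^{-1}-\zeta=z$, and $n\ge2$. The category $\mathbf{MOY}_{\alpha,\zeta}$ is a rigid braided and untwisted monoidal category with the braidings $\sigma^+,\sigma^-:\uparrow^1\otimes\uparrow^1\to\uparrow^1\otimes\uparrow^1$ defined by $$\sigma^+=\alpha^{-1}\left(\zeta^{-1}\,\mathrm{id}_{\uparrow^1\uparrow^1}+S\right),\qquad\sigma^-=\alpha\left(\zeta\,\mathrm{id}_{\uparrow^1\uparrow^1}+S\right).$$
   Context: All categories are enriched in $R$-modules. Diagrams are read bottom to top, up to plane isotopy; $\circ$ is stacking (left factor on top), $\otimes$ juxtaposition. $\mathbf{TrPD}$: objects are finite sequences of $\uparrow^1,\downarrow^1$; morphisms are $R$-linear combinations of oriented plane trivalent graphs with edges labelled in $\{1,2\}$, boundary edges labelled 1, such that at each vertex the sum of incoming labels equals the sum of outgoing labels (two incoming and one outgoing edge, or vice versa). It is a balanced rigid monoidal category; morphisms are generated by identities, caps $\overrightarrow{ev}:\uparrow^1\downarrow^1\to\emptyset$, $\overleftarrow{ev}:\downarrow^1\uparrow^1\to\emptyset$, cups $\overrightarrow{coev}:\emptyset\to\uparrow^1\downarrow^1$, $\overleftarrow{coev}:\emptyset\to\downarrow^1\uparrow^1$, the graph $S:\uparrow^1\uparrow^1\to\uparrow^1\uparrow^1$ (two 1-edges merge into a 2-edge which splits into two 1-edges) and its dual $S^\vee$ (reversed orientations). Write $\mathrm{id}=\mathrm{id}_{\uparrow^1}$, $\mathrm{id}^\vee=\mathrm{id}_{\downarrow^1}$.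 Put $[k]_{\alpha,\zeta}=\dfrac{\alpha^{-1}(-\zeta)^{k-n}-\alpha(-\zeta)^{n-k}}{\zeta-\zeta^{-1}}\in R$. $\mathbf{MOY}_{\alpha,\zeta}$ is the quotient of $\mathbf{TrPD}$ by the tensor ideal generated by the following relations and their duals (same diagrams with all orientations reversed): (1) the circle labelled 1 equals $[n]_{\alpha,\zeta}\,\emptyset$; (2) $S\circ S=-(\zeta+\zeta^{-1})S$; (3) $(\overleftarrow{ev}\otimes\mathrm{id})\circ(\mathrm{id}^\vee\otimes S)\circ(\overleftarrow{coev}\otimes\mathrm{id})=[n-1]_{\alpha,\zeta}\,\mathrm{id}$; (4) $(\mathrm{id}\otimes\overrightarrow{ev}\otimes\mathrm{id}^\vee)\circ(S\otimes S^\vee)\circ(\mathrm{id}\otimes\overrightarrow{coev}\otimes\mathrm{id}^\vee)=\overrightarrow{coev}\circ\overrightarrow{ev}+[n-2]_{\alpha,\zeta}\,\mathrm{id}\otimes\mathrm{id}^\vee$; (5) $(S\otimes\mathrm{id})(\mathrm{id}\otimes S)(S\otimes\mathrm{id})+\mathrm{id}\otimes S=(\mathrm{id}\otimes S)(S\otimes\mathrm{id})(\mathrm{id}\otimes S)+S\otimes\mathrm{id}$. A balanced rigid monoidal category monoidally generated by $\uparrow^1$ and its dual is said to be rigid braided untwisted with braidings $\sigma^\pm$ if (R1) $(\overleftarrow{ev}\otimes\mathrm{id})\circ(\mathrm{id}^\vee\otimes\sigma^\pm)\circ(\overleftarrow{coev}\otimes\mathrm{id})=\mathrm{id}$; (R2a)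 $\sigma^+\circ\sigma^-=\sigma^-\circ\sigma^+=\mathrm{id}_{\uparrow^1\uparrow^1}$; (R2b) $(\mathrm{id}\otimes\overrightarrow{ev}\otimes\mathrm{id}^\vee)\circ(\sigma^+\otimes(\sigma^-)^\vee)\circ(\mathrm{id}\otimes\overrightarrow{coev}\otimes\mathrm{id}^\vee)=\overrightarrow{coev}\circ\overrightarrow{ev}$; (R3) $(\sigma^+\otimes\mathrm{id})(\mathrm{id}\otimes\sigma^+)(\sigma^+\otimes\mathrm{id})=(\mathrm{id}\otimes\sigma^+)(\sigma^+\otimes\mathrm{id})(\mathrm{id}\otimes\sigma^+)$; together with the variants of these obtained by exchanging $\sigma^+$ and $\sigma^-$ or reversing orientations of the strands or of the plane (i.e. all oriented Reidemeister moves). *)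

theory Defs
  imports "HOL-Algebra.Module"
begin

section \<open>Strict monoidal categories enriched in modules, with duals\<close>

text \<open>
  \<open>Hom C a b\<close> is a module; of the record type for modules only the additive and the scalar
  structure is used, the multiplicative fields carry no meaning.
  \<open>Ev C a\<close> goes from \<open>a \<cdot> Dual C a\<close> to the unit, \<open>Coev C a\<close> from the unit to \<open>a \<cdot> Dual C a\<close>.
  As double duals are required to be strict below, \<open>Ev C (Dual C a)\<close> and \<open>Coev C (Dual C a)\<close>
  are the evaluation and coevaluation for the duality on the other side.
\<close>

record ('o, 'm, 'r) lin_cat =
  Obj :: "'o set"
  Hom :: "'o \<Rightarrow> 'o \<Rightarrow> ('r, 'm) module"
  Id :: "'o \<Rightarrow> 'm"
  Comp :: "'m \<Rightarrow> 'm \<Rightarrow> 'm"  (infixl \<open>\<bullet>\<index>\<close> 55)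
  Unit :: "'o"
  TensObj :: "'o \<Rightarrow> 'o \<Rightarrow> 'o"  (infixl \<open>\<cdot>\<index>\<close> 75)
  TensMor :: "'m \<Rightarrow> 'm \<Rightarrow> 'm"  (infixl \<open>\<parallel>\<index>\<close> 60)
  Dual :: "'o \<Rightarrow> 'o"
  Ev :: "'o \<Rightarrow> 'm"
  Coev :: "'o \<Rightarrow> 'm"

locale linear_monoidal_category =
  fixes R :: "('r, 's) ring_scheme"
    and C :: "('o, 'm, 'r) lin_cat" (structure)
  assumes base_ring: "cring R"
    and hom_module: "\<lbrakk>a \<in> Obj C; b \<in> Obj C\<rbrakk> \<Longrightarrow> module R (Hom C a b)"
    and hom_disjoint:
      "\<lbrakk>a \<in> Obj C; b \<in> Obj C; a' \<in> Obj C; b' \<in> Obj C;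
        f \<in> carrier (Hom C a b); f \<in> carrier (Hom C a' b')\<rbrakk> \<Longrightarrow> a = a' \<and> b = b'"
    \<comment> \<open>category\<close>
    and id_closed: "a \<in> Obj C \<Longrightarrow> Id C a \<in> carrier (Hom C a a)"
    and comp_closed:
      "\<lbrakk>a \<in> Obj C; b \<in> Obj C; c \<in> Obj C; f \<in> carrier (Hom C a b); g \<in> carrier (Hom C b c)\<rbrakk>
        \<Longrightarrow> g \<bullet> f \<in> carrier (Hom C a c)"
    and id_comp:
      "\<lbrakk>a \<in> Obj C; b \<in> Obj C; f \<in> carrier (Hom C a b)\<rbrakk> \<Longrightarrow> Id C b \<bullet> f = f"
    and comp_id:
      "\<lbrakk>a \<in> Obj C; b \<in> Obj C; f \<in> carrier (Hom C a b)\<rbrakk> \<Longrightarrow> f \<bullet> Id C a = f"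
    and comp_assoc:
      "\<lbrakk>a \<in> Obj C; b \<in> Obj C; c \<in> Obj C; d \<in> Obj C;
        f \<in> carrier (Hom C a b); g \<in> carrier (Hom C b c); h \<in> carrier (Hom C c d)\<rbrakk>
        \<Longrightarrow> (h \<bullet> g) \<bullet> f = h \<bullet> (g \<bullet> f)"
    \<comment> \<open>bilinearity of composition\<close>
    and comp_add_left:
      "\<lbrakk>a \<in> Obj C; b \<in> Obj C; c \<in> Obj C;
        f \<in> carrier (Hom C a b); g \<in> carrier (Hom C b c); g' \<in> carrier (Hom C b c)\<rbrakk>
        \<Longrightarrow> (g \<oplus>\<^bsub>Hom C b c\<^esub> g') \<bullet> f = (g \<bullet> f) \<oplus>\<^bsub>Hom C a c\<^esub> (g' \<bullet> f)"
    and comp_add_right: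
      "\<lbrakk>a \<in> Obj C; b \<in> Obj C; c \<in> Obj C;
        f \<in> carrier (Hom C a b); f' \<in> carrier (Hom C a b); g \<in> carrier (Hom C b c)\<rbrakk>
        \<Longrightarrow> g \<bullet> (f \<oplus>\<^bsub>Hom C a b\<^esub> f') = (g \<bullet> f) \<oplus>\<^bsub>Hom C a c\<^esub> (g \<bullet> f')"
    and comp_smult_left:
      "\<lbrakk>r \<in> carrier R; a \<in> Obj C; b \<in> Obj C; c \<in> Obj C;
        f \<in> carrier (Hom C a b); g \<in> carrier (Hom C b c)\<rbrakk>
        \<Longrightarrow> (r \<odot>\<^bsub>Hom C b c\<^esub> g) \<bullet> f = r \<odot>\<^bsub>Hom C a c\<^esub> (g \<bullet> f)"
    and comp_smult_right:
      "\<lbrakk>r \<in> carrier R; a \<in> Obj C; b \<in> Obj C; c \<in> Obj C;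
        f \<in> carrier (Hom C a b); g \<in> carrier (Hom C b c)\<rbrakk>
        \<Longrightarrow> g \<bullet> (r \<odot>\<^bsub>Hom C a b\<^esub> f) = r \<odot>\<^bsub>Hom C a c\<^esub> (g \<bullet> f)"
    \<comment> \<open>strict monoidal structure\<close>
    and unit_obj: "Unit C \<in> Obj C"
    and tens_obj: "\<lbrakk>a \<in> Obj C; b \<in> Obj C\<rbrakk> \<Longrightarrow> a \<cdot> b \<in> Obj C"
    and tens_obj_assoc:
      "\<lbrakk>a \<in> Obj C; b \<in> Obj C; c \<in> Obj C\<rbrakk> \<Longrightarrow> (a \<cdot> b) \<cdot> c = a \<cdot> (b \<cdot> c)"
    and unit_tens_obj: "a \<in> Obj C \<Longrightarrow> Unit C \<cdot> a = a"
    and tens_obj_unit: "a \<in> Obj C \<Longrightarrow> a \<cdot> Unit C = a"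
    and tens_closed:
      "\<lbrakk>a \<in> Obj C; b \<in> Obj C; a' \<in> Obj C; b' \<in> Obj C;
        f \<in> carrier (Hom C a b); f' \<in> carrier (Hom C a' b')\<rbrakk>
        \<Longrightarrow> f \<parallel> f' \<in> carrier (Hom C (a \<cdot> a') (b \<cdot> b'))"
    and tens_assoc:
      "\<lbrakk>a \<in> Obj C; b \<in> Obj C; a' \<in> Obj C; b' \<in> Obj C; a'' \<in> Obj C; b'' \<in> Obj C;
        f \<in> carrier (Hom C a b); f' \<in> carrier (Hom C a' b'); f'' \<in> carrier (Hom C a'' b'')\<rbrakk>
        \<Longrightarrow> (f \<parallel> f') \<parallel> f'' = f \<parallel> (f' \<parallel> f'')"
    and unit_tens:
      "\<lbrakk>a \<in> Obj C; b \<in> Obj C; f \<in> carrier (Hom C a b)\<rbrakk> \<Longrightarrow> Id C (Unit C) \<parallel> f = f"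
    and tens_unit:
      "\<lbrakk>a \<in> Obj C; b \<in> Obj C; f \<in> carrier (Hom C a b)\<rbrakk> \<Longrightarrow> f \<parallel> Id C (Unit C) = f"
    and tens_id: "\<lbrakk>a \<in> Obj C; b \<in> Obj C\<rbrakk> \<Longrightarrow> Id C a \<parallel> Id C b = Id C (a \<cdot> b)"
    and interchange:
      "\<lbrakk>a \<in> Obj C; b \<in> Obj C; c \<in> Obj C; a' \<in> Obj C; b' \<in> Obj C; c' \<in> Obj C;
        f \<in> carrier (Hom C a b); g \<in> carrier (Hom C b c);
        f' \<in> carrier (Hom C a' b'); g' \<in> carrier (Hom C b' c')\<rbrakk>
        \<Longrightarrow> (g \<bullet> f) \<parallel> (g' \<bullet> f') = (g \<parallel> g') \<bullet> (f \<parallel> f')"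
    \<comment> \<open>bilinearity of the tensor product\<close>
    and tens_add_left:
      "\<lbrakk>a \<in> Obj C; b \<in> Obj C; a' \<in> Obj C; b' \<in> Obj C;
        f \<in> carrier (Hom C a b); g \<in> carrier (Hom C a b); f' \<in> carrier (Hom C a' b')\<rbrakk>
        \<Longrightarrow> (f \<oplus>\<^bsub>Hom C a b\<^esub> g) \<parallel> f' = (f \<parallel> f') \<oplus>\<^bsub>Hom C (a \<cdot> a') (b \<cdot> b')\<^esub> (g \<parallel> f')"
    and tens_add_right:
      "\<lbrakk>a \<in> Obj C; b \<in> Obj C; a' \<in> Obj C; b' \<in> Obj C;
        f \<in> carrier (Hom C a b); f' \<in> carrier (Hom C a' b'); g' \<in> carrier (Hom C a' b')\<rbrakk>
        \<Longrightarrow> f \<parallel> (f' \<oplus>\<^bsub>Hom C a' b'\<^esub> g') = (f \<parallel> f') \<oplus>\<^bsub>Hom C (a \<cdot> a') (b \<cdot> b')\<^esub> (f \<parallel> g')"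
    and tens_smult_left:
      "\<lbrakk>r \<in> carrier R; a \<in> Obj C; b \<in> Obj C; a' \<in> Obj C; b' \<in> Obj C;
        f \<in> carrier (Hom C a b); f' \<in> carrier (Hom C a' b')\<rbrakk>
        \<Longrightarrow> (r \<odot>\<^bsub>Hom C a b\<^esub> f) \<parallel> f' = r \<odot>\<^bsub>Hom C (a \<cdot> a') (b \<cdot> b')\<^esub> (f \<parallel> f')"
    and tens_smult_right:
      "\<lbrakk>r \<in> carrier R; a \<in> Obj C; b \<in> Obj C; a' \<in> Obj C; b' \<in> Obj C;
        f \<in> carrier (Hom C a b); f' \<in> carrier (Hom C a' b')\<rbrakk>
        \<Longrightarrow> f \<parallel> (r \<odot>\<^bsub>Hom C a' b'\<^esub> f') = r \<odot>\<^bsub>Hom C (a \<cdot> a') (b \<cdot> b')\<^esub> (f \<parallel> f')"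

context
  fixes C :: "('o, 'm, 'r) lin_cat" (structure)
begin

text \<open>
  The two ways of turning \<open>f : a \<rightarrow> b\<close> upside down into a morphism \<open>Dual C b \<rightarrow> Dual C a\<close>.
\<close>

definition left_transpose :: "'o \<Rightarrow> 'o \<Rightarrow> 'm \<Rightarrow> 'm" where
  "left_transpose a b f =
     (Ev C (Dual C b) \<parallel> Id C (Dual C a))
     \<bullet> (Id C (Dual C b) \<parallel> f \<parallel> Id C (Dual C a))
     \<bullet> (Id C (Dual C b) \<parallel> Coev C a)"

definition right_transpose :: "'o \<Rightarrow> 'o \<Rightarrow> 'm \<Rightarrow> 'm" where
  "right_transpose a b f =
     (Id C (Dual C a) \<parallel> Ev C b)
     \<bullet> (Id C (Dual C a) \<parallel> f \<parallel> Id C (Dual C b))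
     \<bullet> (Coev C (Dual C a) \<parallel> Id C (Dual C b))"

end

text \<open>
  ``Balanced'' is meant as compatibility of left and right duality (pivotality); it does not
  presuppose a braiding.
\<close>

locale balanced_rigid_category = linear_monoidal_category +
  assumes dual_obj: "a \<in> Obj C \<Longrightarrow> Dual C a \<in> Obj C"
    and dual_dual: "a \<in> Obj C \<Longrightarrow> Dual C (Dual C a) = a"
    and dual_unit: "Dual C (Unit C) = Unit C"
    and dual_tens: "\<lbrakk>a \<in> Obj C; b \<in> Obj C\<rbrakk> \<Longrightarrow> Dual C (a \<cdot> b) = Dual C b \<cdot> Dual C a"
    and ev_closed: "a \<in> Obj C \<Longrightarrow> Ev C a \<in> carrier (Hom C (a \<cdot> Dual C a) (Unit C))"
    and coev_closed: "a \<in> Obj C \<Longrightarrow> Coev C a \<in> carrier (Hom C (Unit C) (a \<cdot> Dual C a))"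
    and zigzag_left:
      "a \<in> Obj C \<Longrightarrow> (Ev C a \<parallel> Id C a) \<bullet> (Id C a \<parallel> Coev C (Dual C a)) = Id C a"
    and zigzag_right:
      "a \<in> Obj C \<Longrightarrow> (Id C a \<parallel> Ev C (Dual C a)) \<bullet> (Coev C a \<parallel> Id C a) = Id C a"
    and ev_unit: "Ev C (Unit C) = Id C (Unit C)"
    and coev_unit: "Coev C (Unit C) = Id C (Unit C)"
    and ev_tens:
      "\<lbrakk>a \<in> Obj C; b \<in> Obj C\<rbrakk>
        \<Longrightarrow> Ev C (a \<cdot> b) = Ev C a \<bullet> (Id C a \<parallel> Ev C b \<parallel> Id C (Dual C a))"
    and coev_tens:
      "\<lbrakk>a \<in> Obj C; b \<in> Obj C\<rbrakk>
        \<Longrightarrow> Coev C (a \<cdot> b) = (Id C a \<parallel> Coev C b \<parallel> Id C (Dual C a)) \<bullet> Coev C a"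
    and balanced:
      "\<lbrakk>a \<in> Obj C; b \<in> Obj C; f \<in> carrier (Hom C a b)\<rbrakk>
        \<Longrightarrow> left_transpose C a b f = right_transpose C a b f"


section \<open>Rigid braided untwisted categories\<close>

datatype orient = Up | Down

fun flip :: "orient \<Rightarrow> orient" where
  "flip Up = Down"
| "flip Down = Up"

inductive_set monoidal_span :: "('o, 'm, 'r) lin_cat \<Rightarrow> 'o set \<Rightarrow> 'o set"
  for C :: "('o, 'm, 'r) lin_cat" (structure) and B :: "'o set" where
  unit: "Unit C \<in> monoidal_span C B"
| base: "a \<in> B \<Longrightarrow> a \<in> monoidal_span C B"
| tens: "\<lbrakk>a \<in> monoidal_span C B; b \<in> monoidal_span C B\<rbrakk> \<Longrightarrow> a \<cdot> b \<in> monoidal_span C B"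

context
  fixes C :: "('o, 'm, 'r) lin_cat" (structure)
    and V :: "'o"
begin

fun strand :: "orient \<Rightarrow> 'o" where
  "strand Up = V"
| "strand Down = Dual C V"

text \<open>
  \<open>s True\<close> and \<open>s False\<close> are the two crossings of upward strands.  \<open>crossing s e x y\<close> is the
  crossing of strands of orientations \<open>x\<close> and \<open>y\<close> (at the bottom, from left to right), obtained
  by rotating one of them, such that \<open>e\<close> has the same geometric meaning for all orientations:
  if the strand from the bottom left to the top right is the over-strand of \<open>s True\<close>, then it is
  the over-strand of \<open>crossing s e x y\<close> iff \<open>e\<close>.  A quarter turn exchanges the two diagonals,
  hence the negation.
\<close>

fun crossing :: "(bool \<Rightarrow> 'm) \<Rightarrow> bool \<Rightarrow> orient \<Rightarrow> orient \<Rightarrow> 'm" where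
  "crossing s e Up Up = s e"
| "crossing s e Down Down = left_transpose C (V \<cdot> V) (V \<cdot> V) (s e)"
| "crossing s e Down Up =
     (Ev C (Dual C V) \<parallel> Id C V \<parallel> Id C (Dual C V))
     \<bullet> (Id C (Dual C V) \<parallel> s (\<not> e) \<parallel> Id C (Dual C V))
     \<bullet> (Id C (Dual C V) \<parallel> Id C V \<parallel> Coev C V)"
| "crossing s e Up Down =
     (Id C (Dual C V) \<parallel> Id C V \<parallel> Ev C V)
     \<bullet> (Id C (Dual C V) \<parallel> s (\<not> e) \<parallel> Id C (Dual C V))
     \<bullet> (Coev C (Dual C V) \<parallel> Id C V \<parallel> Id C (Dual C V))"

end

text \<open>
  All oriented Reidemeister moves.  In the third one, \<open>p\<close>, \<open>q\<close>, \<open>r\<close> describe the crossings of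
  strands 1 and 2, 1 and 3, 2 and 3; the hypothesis says that one of three strands lies above and
  one below the two others, i.e. it excludes the two cyclic over/under patterns.
\<close>

locale rigid_braided_untwisted = balanced_rigid_category R C
  for R :: "('r, 's) ring_scheme"
    and C :: "('o, 'm, 'r) lin_cat" (structure) +
  fixes V :: "'o" and \<sigma>\<^sub>p \<sigma>\<^sub>m :: "'m"
  fixes st :: "orient \<Rightarrow> 'o" and cr :: "bool \<Rightarrow> orient \<Rightarrow> orient \<Rightarrow> 'm"
  defines "st \<equiv> strand C V"
    and "cr \<equiv> crossing C V (\<lambda>e. if e then \<sigma>\<^sub>p else \<sigma>\<^sub>m)"
  assumes generated: "Obj C = monoidal_span C {V, Dual C V}"
    and braiding_p: "\<sigma>\<^sub>p \<in> carrier (Hom C (V \<cdot> V) (V \<cdot> V))"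
    and braiding_m: "\<sigma>\<^sub>m \<in> carrier (Hom C (V \<cdot> V) (V \<cdot> V))"
    and R1:
      "(Ev C (st (flip x)) \<parallel> Id C (st x))
       \<bullet> (Id C (st (flip x)) \<parallel> cr e x x)
       \<bullet> (Coev C (st (flip x)) \<parallel> Id C (st x)) = Id C (st x)"
    and R1_mirror:
      "(Id C (st x) \<parallel> Ev C (st x))
       \<bullet> (cr e x x \<parallel> Id C (st (flip x)))
       \<bullet> (Id C (st x) \<parallel> Coev C (st x)) = Id C (st x)"
    and R2a: "cr (\<not> e) y x \<bullet> cr e x y = Id C (st x \<cdot> st y)"
    and R2b:
      "(Id C (st x) \<parallel> Ev C (st x) \<parallel> Id C (st (flip x)))
       \<bullet> (cr e x x \<parallel> cr (\<not> e) (flip x) (flip x))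
       \<bullet> (Id C (st x) \<parallel> Coev C (st x) \<parallel> Id C (st (flip x)))
       = Coev C (st x) \<bullet> Ev C (st x)"
    and R3:
      "\<not> (p = r \<and> q \<noteq> p) \<Longrightarrow>
       (cr r y z \<parallel> Id C (st x)) \<bullet> (Id C (st y) \<parallel> cr q x z) \<bullet> (cr p x y \<parallel> Id C (st z))
       = (Id C (st z) \<parallel> cr p x y) \<bullet> (cr q x z \<parallel> Id C (st y)) \<bullet> (Id C (st x) \<parallel> cr r y z)"


section \<open>Quotients by tensor ideals\<close>

locale tensor_ideal =
  fixes R :: "('r, 's) ring_scheme"
    and C :: "('o, 'm, 'r) lin_cat" (structure)
    and I :: "'m set"
  assumes ideal_subset: "I \<subseteq> (\<Union>a \<in> Obj C. \<Union>b \<in> Obj C. carrier (Hom C a b))"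
    and ideal_submodule:
      "\<lbrakk>a \<in> Obj C; b \<in> Obj C\<rbrakk> \<Longrightarrow> submodule (I \<inter> carrier (Hom C a b)) R (Hom C a b)"
    and ideal_comp_left:
      "\<lbrakk>a \<in> Obj C; b \<in> Obj C; c \<in> Obj C;
        f \<in> I \<inter> carrier (Hom C a b); g \<in> carrier (Hom C b c)\<rbrakk> \<Longrightarrow> g \<bullet> f \<in> I"
    and ideal_comp_right:
      "\<lbrakk>a \<in> Obj C; b \<in> Obj C; c \<in> Obj C;
        f \<in> carrier (Hom C a b); g \<in> I \<inter> carrier (Hom C b c)\<rbrakk> \<Longrightarrow> g \<bullet> f \<in> I"
    and ideal_tens_left:
      "\<lbrakk>a \<in> Obj C; b \<in> Obj C; a' \<in> Obj C; b' \<in> Obj C;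
        f \<in> carrier (Hom C a b); g \<in> I \<inter> carrier (Hom C a' b')\<rbrakk> \<Longrightarrow> f \<parallel> g \<in> I"
    and ideal_tens_right:
      "\<lbrakk>a \<in> Obj C; b \<in> Obj C; a' \<in> Obj C; b' \<in> Obj C;
        f \<in> I \<inter> carrier (Hom C a b); g \<in> carrier (Hom C a' b')\<rbrakk> \<Longrightarrow> f \<parallel> g \<in> I"

definition generated_tensor_ideal ::
    "('r, 's) ring_scheme \<Rightarrow> ('o, 'm, 'r) lin_cat \<Rightarrow> 'm set \<Rightarrow> 'm set" where
  "generated_tensor_ideal R C E = \<Inter>{I. tensor_ideal R C I \<and> E \<subseteq> I}"

definition ideal_class :: "('o, 'm, 'r) lin_cat \<Rightarrow> 'm set \<Rightarrow> 'm \<Rightarrow> 'm set" where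
  "ideal_class C I f =
     {g. \<exists>a \<in> Obj C. \<exists>b \<in> Obj C.
           f \<in> carrier (Hom C a b) \<and> g \<in> carrier (Hom C a b) \<and> g \<ominus>\<^bsub>Hom C a b\<^esub> f \<in> I}"

definition quotient_module ::
    "('o, 'm, 'r) lin_cat \<Rightarrow> 'm set \<Rightarrow> 'o \<Rightarrow> 'o \<Rightarrow> ('r, 'm set) module" where
  "quotient_module C I a b =
     \<lparr>carrier = ideal_class C I ` carrier (Hom C a b),
      mult = undefined, one = undefined,
      zero = ideal_class C I \<zero>\<^bsub>Hom C a b\<^esub>,
      add = (\<lambda>F G. \<Union>f \<in> F. \<Union>g \<in> G. ideal_class C I (f \<oplus>\<^bsub>Hom C a b\<^esub> g)),
      smult = (\<lambda>r F. \<Union>f \<in> F. ideal_class C I (r \<odot>\<^bsub>Hom C a b\<^esub> f))\<rparr>"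

definition quotient_category ::
    "('o, 'm, 'r) lin_cat \<Rightarrow> 'm set \<Rightarrow> ('o, 'm set, 'r) lin_cat" where
  "quotient_category C I =
     \<lparr>Obj = Obj C,
      Hom = quotient_module C I,
      Id = (\<lambda>a. ideal_class C I (Id C a)),
      Comp = (\<lambda>G F. \<Union>g \<in> G. \<Union>f \<in> F. ideal_class C I (g \<bullet>\<^bsub>C\<^esub> f)),
      Unit = Unit C,
      TensObj = TensObj C,
      TensMor = (\<lambda>F G. \<Union>f \<in> F. \<Union>g \<in> G. ideal_class C I (f \<parallel>\<^bsub>C\<^esub> g)),
      Dual = Dual C,
      Ev = (\<lambda>a. ideal_class C I (Ev C a)),
      Coev = (\<lambda>a. ideal_class C I (Coev C a))\<rparr>"


section \<open>Plane trivalent graphs\<close>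

text \<open>
  A plane graph with boundary, put in general position with respect to the height function, is
  described by a word in elementary pieces, read from bottom to top.  \<open>Cap x\<close> joins adjacent
  strands \<open>x\<close> and \<open>opp x\<close> at the bottom, \<open>Cup x\<close> the same strands at the top.  \<open>Join o'\<close> has two
  edges labelled 1 at the bottom and one labelled 2 on the top, \<open>Fork o'\<close> is the other way round;
  all three edges point upwards or all three downwards.  The remaining positions of a vertex arise
  with the help of caps and cups.
\<close>

datatype label = One | Two

type_synonym edge = "orient \<times> label"

abbreviation opp :: "edge \<Rightarrow> edge" where
  "opp x \<equiv> (flip (fst x), snd x)"

abbreviation dual_word :: "edge list \<Rightarrow> edge list" where
  "dual_word w \<equiv> rev (map opp w)"

datatype diagram =
    Ident "edge list"
  | Cap edge
  | Cup edge
  | Join orient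
  | Fork orient
  | Stack diagram diagram  \<comment> \<open>the first argument is on top\<close>
  | Juxt diagram diagram

fun bottom_word :: "diagram \<Rightarrow> edge list" where
  "bottom_word (Ident w) = w"
| "bottom_word (Cap x) = [x, opp x]"
| "bottom_word (Cup x) = []"
| "bottom_word (Join o') = [(o', One), (o', One)]"
| "bottom_word (Fork o') = [(o', Two)]"
| "bottom_word (Stack d e) = bottom_word e"
| "bottom_word (Juxt d e) = bottom_word d @ bottom_word e"

fun top_word :: "diagram \<Rightarrow> edge list" where
  "top_word (Ident w) = w"
| "top_word (Cap x) = []"
| "top_word (Cup x) = [x, opp x]"
| "top_word (Join o') = [(o', Two)]"
| "top_word (Fork o') = [(o', One), (o', One)]"
| "top_word (Stack d e) = top_word d"
| "top_word (Juxt d e) = top_word d @ top_word e"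

fun nested_cap :: "edge list \<Rightarrow> diagram" where
  "nested_cap [] = Ident []"
| "nested_cap (x # w) =
     Stack (Cap x) (Juxt (Ident [x]) (Juxt (nested_cap w) (Ident [opp x])))"

fun nested_cup :: "edge list \<Rightarrow> diagram" where
  "nested_cup [] = Ident []"
| "nested_cup (x # w) =
     Stack (Juxt (Ident [x]) (Juxt (nested_cup w) (Ident [opp x]))) (Cup x)"

text \<open>Rotation by a half turn, in the two possible directions.\<close>

definition turn_left :: "diagram \<Rightarrow> diagram" where
  "turn_left d =
     (let a = dual_word (bottom_word d); b = dual_word (top_word d) in
      Stack (Juxt (nested_cap b) (Ident a))
        (Stack (Juxt (Ident b) (Juxt d (Ident a))) (Juxt (Ident b) (nested_cup (bottom_word d)))))"

definition turn_right :: "diagram \<Rightarrow> diagram" where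
  "turn_right d =
     (let a = dual_word (bottom_word d); b = dual_word (top_word d) in
      Stack (Juxt (Ident a) (nested_cap (top_word d)))
        (Stack (Juxt (Ident a) (Juxt d (Ident b))) (Juxt (nested_cup a) (Ident b))))"

text \<open>
  Plane isotopy relative to the boundary.  The isotopies that create or cancel no local extremum
  of the height and turn no vertex are the laws of strict monoidal categories; the others are
  generated by straightening an edge and by rotating a vertex (this is the coherence theorem for
  the graphical calculus of pivotal categories of Joyal-Street and Freyd-Yetter).  A downward
  vertex is the upward vertex of the same kind (two edges in and one out, or the reverse) rotated
  by a half turn, in either direction.
\<close>

inductive isotopic :: "diagram \<Rightarrow> diagram \<Rightarrow> bool" where
  refl: "isotopic d d"
| sym: "isotopic d e \<Longrightarrow> isotopic e d"
| trans: "\<lbrakk>isotopic d e; isotopic e f\<rbrakk> \<Longrightarrow> isotopic d f"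
| stack_cong: "\<lbrakk>isotopic d d'; isotopic e e'\<rbrakk> \<Longrightarrow> isotopic (Stack d e) (Stack d' e')"
| juxt_cong: "\<lbrakk>isotopic d d'; isotopic e e'\<rbrakk> \<Longrightarrow> isotopic (Juxt d e) (Juxt d' e')"
| stack_assoc: "isotopic (Stack (Stack d e) f) (Stack d (Stack e f))"
| ident_stack: "isotopic (Stack (Ident (top_word d)) d) d"
| stack_ident: "isotopic (Stack d (Ident (bottom_word d))) d"
| juxt_assoc: "isotopic (Juxt (Juxt d e) f) (Juxt d (Juxt e f))"
| empty_juxt: "isotopic (Juxt (Ident []) d) d"
| juxt_empty: "isotopic (Juxt d (Ident [])) d"
| juxt_ident: "isotopic (Juxt (Ident v) (Ident w)) (Ident (v @ w))"
| exchange: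
    "\<lbrakk>bottom_word d = top_word e; bottom_word d' = top_word e'\<rbrakk>
      \<Longrightarrow> isotopic (Juxt (Stack d e) (Stack d' e')) (Stack (Juxt d d') (Juxt e e'))"
| straighten_left:
    "isotopic (Stack (Juxt (Cap x) (Ident [x])) (Juxt (Ident [x]) (Cup (opp x)))) (Ident [x])"
| straighten_right:
    "isotopic (Stack (Juxt (Ident [x]) (Cap (opp x))) (Juxt (Cup x) (Ident [x]))) (Ident [x])"
| rotate_left: "isotopic (turn_left (Join o')) (Fork (flip o'))"
| rotate_right: "isotopic (turn_right (Join o')) (Fork (flip o'))"

quotient_type plane_graph = diagram / isotopic
  by (rule equivpI) (auto intro: reflpI sympI transpI isotopic.refl isotopic.sym isotopic.trans)

lift_definition stack :: "plane_graph \<Rightarrow> plane_graph \<Rightarrow> plane_graph" is Stack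
  by (rule isotopic.stack_cong)

lift_definition juxt :: "plane_graph \<Rightarrow> plane_graph \<Rightarrow> plane_graph" is Juxt
  by (rule isotopic.juxt_cong)


section \<open>The category TrPD\<close>

abbreviation word :: "orient list \<Rightarrow> edge list" where
  "word a \<equiv> map (\<lambda>o'. (o', One)) a"

definition ident_graph :: "orient list \<Rightarrow> plane_graph" where
  "ident_graph a = abs_plane_graph (Ident (word a))"

definition ev_graph :: "orient list \<Rightarrow> plane_graph" where
  "ev_graph a = abs_plane_graph (nested_cap (word a))"

definition coev_graph :: "orient list \<Rightarrow> plane_graph" where
  "coev_graph a = abs_plane_graph (nested_cup (word a))"

text \<open>\<open>S_graph Up\<close> is \<open>S\<close>, and \<open>S_graph Down\<close> is the same graph with reversed orientations.\<close>

definition S_graph :: "orient \<Rightarrow> plane_graph" where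
  "S_graph o' = abs_plane_graph (Stack (Fork o') (Join o'))"

text \<open>
  The plane graphs with edges labelled 1 at the boundary that are generated by identities, caps,
  cups, \<open>S\<close> and its dual.  This excludes only circles labelled 2, which have no vertices.
\<close>

inductive trpd_graph :: "orient list \<Rightarrow> orient list \<Rightarrow> plane_graph \<Rightarrow> bool" where
  ident: "trpd_graph a a (ident_graph a)"
| ev: "trpd_graph [o', flip o'] [] (ev_graph [o'])"
| coev: "trpd_graph [] [o', flip o'] (coev_graph [o'])"
| S: "trpd_graph [o', o'] [o', o'] (S_graph o')"
| stack: "\<lbrakk>trpd_graph a b D; trpd_graph b c E\<rbrakk> \<Longrightarrow> trpd_graph a c (stack E D)"
| juxt: "\<lbrakk>trpd_graph a b D; trpd_graph a' b' E\<rbrakk> \<Longrightarrow> trpd_graph (a @ a') (b @ b') (juxt D E)"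

text \<open>
  A morphism carries its source and target, so that different hom-modules are disjoint; its third
  component is a finitely supported coefficient function.
\<close>

type_synonym 'r trpd_mor = "orient list \<times> orient list \<times> (plane_graph \<Rightarrow> 'r)"

context
  fixes R :: "('r, 's) ring_scheme" (structure)
begin

definition trpd_hom :: "orient list \<Rightarrow> orient list \<Rightarrow> ('r, 'r trpd_mor) module" where
  "trpd_hom a b =
     \<lparr>carrier = {(a, b, f) | f. (\<forall>D. f D \<in> carrier R) \<and> finite {D. f D \<noteq> \<zero>} \<and>
                               (\<forall>D. f D \<noteq> \<zero> \<longrightarrow> trpd_graph a b D)},
      mult = undefined, one = undefined,
      zero = (a, b, \<lambda>D. \<zero>),
      add = (\<lambda>(_, _, f) (_, _, g). (a, b, \<lambda>D. f D \<oplus> g D)),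
      smult = (\<lambda>r (_, _, f). (a, b, \<lambda>D. r \<otimes> f D))\<rparr>"

definition graph_mor :: "orient list \<Rightarrow> orient list \<Rightarrow> plane_graph \<Rightarrow> 'r trpd_mor" where
  "graph_mor a b D = (a, b, \<lambda>E. if E = D then \<one> else \<zero>)"

definition bilinear_ext ::
    "(plane_graph \<Rightarrow> plane_graph \<Rightarrow> plane_graph)
      \<Rightarrow> (plane_graph \<Rightarrow> 'r) \<Rightarrow> (plane_graph \<Rightarrow> 'r) \<Rightarrow> (plane_graph \<Rightarrow> 'r)" where
  "bilinear_ext m f g =
     (\<lambda>H. finsum R (\<lambda>(D, E). f D \<otimes> g E) {(D, E). f D \<noteq> \<zero> \<and> g E \<noteq> \<zero> \<and> m D E = H})"

definition TrPD :: "(orient list, 'r trpd_mor, 'r) lin_cat" where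
  "TrPD =
     \<lparr>Obj = UNIV,
      Hom = trpd_hom,
      Id = (\<lambda>a. graph_mor a a (ident_graph a)),
      Comp = (\<lambda>(_, c, g) (a, _, f). (a, c, bilinear_ext stack g f)),
      Unit = [],
      TensObj = (@),
      TensMor = (\<lambda>(a, b, f) (a', b', f'). (a @ a', b @ b', bilinear_ext juxt f f')),
      Dual = (\<lambda>a. rev (map flip a)),
      Ev = (\<lambda>a. graph_mor (a @ rev (map flip a)) [] (ev_graph a)),
      Coev = (\<lambda>a. graph_mor [] (a @ rev (map flip a)) (coev_graph a))\<rparr>"

definition S_mor :: "orient \<Rightarrow> 'r trpd_mor" where
  "S_mor o' = graph_mor [o', o'] [o', o'] (S_graph o')"


section \<open>The category MOY\<close>

text \<open>Only meaningful if \<open>\<alpha>\<close>, \<open>\<zeta>\<close> and \<open>\<zeta> \<ominus> inv \<zeta>\<close> are units; the powers have integer exponents.\<close>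

definition qbracket :: "'r \<Rightarrow> 'r \<Rightarrow> nat \<Rightarrow> int \<Rightarrow> 'r" where
  "qbracket \<alpha> \<zeta> n k =
     (inv \<alpha> \<otimes> (\<ominus> \<zeta>) [^] (k - int n) \<ominus> \<alpha> \<otimes> (\<ominus> \<zeta>) [^] (int n - k)) \<otimes> inv (\<zeta> \<ominus> inv \<zeta>)"

text \<open>
  The relations, each in the form left-hand side minus right-hand side.  Taking \<open>o' = Down\<close>
  reverses all orientations.  With \<open>x = [Up]\<close>, \<open>ev\<close> and \<open>ev'\<close> are the caps on
  \<open>[Up, Down]\<close> and on \<open>[Down, Up]\<close>.
\<close>

definition moy_relations :: "'r \<Rightarrow> 'r \<Rightarrow> nat \<Rightarrow> 'r trpd_mor set" where
  "moy_relations \<alpha> \<zeta> n =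
     (\<Union>o'. let
        T = TrPD; x = [o']; x' = [flip o'];
        S = S_mor o'; S' = S_mor (flip o');
        i = Id T x; i' = Id T x';
        ev = Ev T x; coev = Coev T x; ev' = Ev T x'; coev' = Coev T x';
        br = (\<lambda>k. qbracket \<alpha> \<zeta> n k);
        N = int n
      in
       {(ev \<bullet>\<^bsub>T\<^esub> coev) \<ominus>\<^bsub>Hom T [] []\<^esub> (br N \<odot>\<^bsub>Hom T [] []\<^esub> Id T []),

        (S \<bullet>\<^bsub>T\<^esub> S) \<ominus>\<^bsub>Hom T (x @ x) (x @ x)\<^esub> ((\<ominus> (\<zeta> \<oplus> inv \<zeta>)) \<odot>\<^bsub>Hom T (x @ x) (x @ x)\<^esub> S),

        ((ev' \<parallel>\<^bsub>T\<^esub> i) \<bullet>\<^bsub>T\<^esub> (i' \<parallel>\<^bsub>T\<^esub> S) \<bullet>\<^bsub>T\<^esub> (coev' \<parallel>\<^bsub>T\<^esub> i))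
          \<ominus>\<^bsub>Hom T x x\<^esub> (br (N - 1) \<odot>\<^bsub>Hom T x x\<^esub> i),

        ((i \<parallel>\<^bsub>T\<^esub> ev \<parallel>\<^bsub>T\<^esub> i') \<bullet>\<^bsub>T\<^esub> (S \<parallel>\<^bsub>T\<^esub> S') \<bullet>\<^bsub>T\<^esub> (i \<parallel>\<^bsub>T\<^esub> coev \<parallel>\<^bsub>T\<^esub> i'))
          \<ominus>\<^bsub>Hom T (x @ x') (x @ x')\<^esub>
            ((coev \<bullet>\<^bsub>T\<^esub> ev) \<oplus>\<^bsub>Hom T (x @ x') (x @ x')\<^esub>
              (br (N - 2) \<odot>\<^bsub>Hom T (x @ x') (x @ x')\<^esub> (i \<parallel>\<^bsub>T\<^esub> i'))),

        (((S \<parallel>\<^bsub>T\<^esub> i) \<bullet>\<^bsub>T\<^esub> (i \<parallel>\<^bsub>T\<^esub> S) \<bullet>\<^bsub>T\<^esub> (S \<parallel>\<^bsub>T\<^esub> i))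
            \<oplus>\<^bsub>Hom T (x @ x @ x) (x @ x @ x)\<^esub> (i \<parallel>\<^bsub>T\<^esub> S))
          \<ominus>\<^bsub>Hom T (x @ x @ x) (x @ x @ x)\<^esub>
            (((i \<parallel>\<^bsub>T\<^esub> S) \<bullet>\<^bsub>T\<^esub> (S \<parallel>\<^bsub>T\<^esub> i) \<bullet>\<^bsub>T\<^esub> (i \<parallel>\<^bsub>T\<^esub> S))
              \<oplus>\<^bsub>Hom T (x @ x @ x) (x @ x @ x)\<^esub> (S \<parallel>\<^bsub>T\<^esub> i))})"

definition moy_ideal :: "'r \<Rightarrow> 'r \<Rightarrow> nat \<Rightarrow> 'r trpd_mor set" where
  "moy_ideal \<alpha> \<zeta> n = generated_tensor_ideal R TrPD (moy_relations \<alpha> \<zeta> n)"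

definition MOY :: "'r \<Rightarrow> 'r \<Rightarrow> nat \<Rightarrow> (orient list, 'r trpd_mor set, 'r) lin_cat" where
  "MOY \<alpha> \<zeta> n = quotient_category TrPD (moy_ideal \<alpha> \<zeta> n)"

definition S_MOY :: "'r \<Rightarrow> 'r \<Rightarrow> nat \<Rightarrow> 'r trpd_mor set" where
  "S_MOY \<alpha> \<zeta> n = ideal_class TrPD (moy_ideal \<alpha> \<zeta> n) (S_mor Up)"

definition sigma_plus :: "'r \<Rightarrow> 'r \<Rightarrow> nat \<Rightarrow> 'r trpd_mor set" where
  "sigma_plus \<alpha> \<zeta> n =
     (let M = MOY \<alpha> \<zeta> n; H = Hom M [Up, Up] [Up, Up] in
      inv \<alpha> \<odot>\<^bsub>H\<^esub> ((inv \<zeta> \<odot>\<^bsub>H\<^esub> Id M [Up, Up]) \<oplus>\<^bsub>H\<^esub> S_MOY \<alpha> \<zeta> n))"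

definition sigma_minus :: "'r \<Rightarrow> 'r \<Rightarrow> nat \<Rightarrow> 'r trpd_mor set" where
  "sigma_minus \<alpha> \<zeta> n =
     (let M = MOY \<alpha> \<zeta> n; H = Hom M [Up, Up] [Up, Up] in
      \<alpha> \<odot>\<^bsub>H\<^esub> ((\<zeta> \<odot>\<^bsub>H\<^esub> Id M [Up, Up]) \<oplus>\<^bsub>H\<^esub> S_MOY \<alpha> \<zeta> n))"

end

end

theory Submission
  imports Defs
begin

text \<open>
  Plane graphs up to isotopy form a strict pivotal category, and so do their linearization and its
  quotient by a tensor ideal; the relations defining the ideal are then available in the quotient.
  Writing \<open>\<sigma>\<close> as a combination of the identity and \<open>S\<close>, the first two Reidemeister moves become scalar
  identities between the brackets; only the braid relation for \<open>\<sigma>\<^sup>+\<close> on upward strands is expanded.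
  All remaining cases follow by moving crossings.  A quarter turn takes the move (R2b) to the
  second move for antiparallel strands.  Composing with inverse crossings exchanges neighbouring
  strands in the third move, and rotating the third move turns its rightmost strand into the
  leftmost one with opposite orientation; starting from three upward strands with positive
  crossings, these operations reach all orientations and all admissible over/under patterns.
\<close>

section \<open>Calculus in strict pivotal categories with words as objects\<close>

text \<open>The same diagram manipulations are needed twice: for plane graphs, where they give
  duality and pivotality of \<open>TrPD\<close>, and for morphisms of the quotient, where they move
  crossings. Hence the calculus is stated for an abstract composition on morphisms that know their
  source and target words.

  The scalars fit as follows. Let \<open>b0\<close>, \<open>b1\<close>, \<open>b2\<close> be the
  brackets at n, n-1, n-2. Closing \<open>inv \<zeta>\<close> times the identity plus
  \<open>S\<close> into a curl gives \<open>inv \<zeta> * b0 + b1 = \<alpha>\<close>, which the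
  prefactor \<open>inv \<alpha>\<close> normalizes to 1; for the other crossing the curl is
  \<open>\<zeta> * b0 + b1 = inv \<alpha>\<close>. The weights \<open>inv \<zeta>\<close> and
  \<open>\<zeta>\<close> have product 1, and their sum cancels the scalar in the relation for
  \<open>S\<close> composed with \<open>S\<close>; so the two crossings are inverse to each other.
  In (R2b) the coefficient of the identity is
  \<open>b0 + (\<zeta> + inv \<zeta>) * b1 + b2 = 0\<close>.

  Pivotality is used twice: the two crossings of antiparallel strands are bent in opposite
  directions by definition, and the loop relation closes \<open>S\<close> only on the left, while
  the first move is required on both sides.\<close>

locale monoidal_calculus =
  fixes arr :: "'m \<Rightarrow> bool" and dm cd :: "'m \<Rightarrow> 'x list"
    and idm :: "'x list \<Rightarrow> 'm"
    and comp :: "'m \<Rightarrow> 'm \<Rightarrow> 'm" (infixr \<open>\<ast>\<close> 55)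
    and tens :: "'m \<Rightarrow> 'm \<Rightarrow> 'm" (infixr \<open>\<star>\<close> 60)
  assumes arr_id [simp]: "arr (idm a)" "dm (idm a) = a" "cd (idm a) = a"
    and arr_comp [simp]:
      "\<lbrakk>arr g; arr f; dm g = cd f\<rbrakk> \<Longrightarrow> arr (g \<ast> f)"
      "\<lbrakk>arr g; arr f; dm g = cd f\<rbrakk> \<Longrightarrow> dm (g \<ast> f) = dm f"
      "\<lbrakk>arr g; arr f; dm g = cd f\<rbrakk> \<Longrightarrow> cd (g \<ast> f) = cd g"
    and arr_tens [simp]:
      "\<lbrakk>arr f; arr g\<rbrakk> \<Longrightarrow> arr (f \<star> g)"
      "\<lbrakk>arr f; arr g\<rbrakk> \<Longrightarrow> dm (f \<star> g) = dm f @ dm g"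
      "\<lbrakk>arr f; arr g\<rbrakk> \<Longrightarrow> cd (f \<star> g) = cd f @ cd g"
    and id_comp [simp]: "\<lbrakk>arr f; cd f = b\<rbrakk> \<Longrightarrow> idm b \<ast> f = f"
    and comp_id [simp]: "\<lbrakk>arr f; dm f = a\<rbrakk> \<Longrightarrow> f \<ast> idm a = f"
    and comp_assoc [simp]:
      "\<lbrakk>arr h; arr g; arr f; dm h = cd g; dm g = cd f\<rbrakk> \<Longrightarrow> (h \<ast> g) \<ast> f = h \<ast> g \<ast> f"
    and tens_assoc [simp]: "\<lbrakk>arr f; arr g; arr h\<rbrakk> \<Longrightarrow> (f \<star> g) \<star> h = f \<star> g \<star> h"
    and id_tens [simp]: "arr f \<Longrightarrow> idm [] \<star> f = f"
    and tens_id [simp]: "arr f \<Longrightarrow> f \<star> idm [] = f"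
    and tens_ids [simp]: "idm a \<star> idm b = idm (a @ b)"
    and interchange:
      "\<lbrakk>arr g; arr f; arr g'; arr f'; dm g = cd f; dm g' = cd f'\<rbrakk>
        \<Longrightarrow> (g \<ast> f) \<star> (g' \<ast> f') = (g \<star> g') \<ast> (f \<star> f')"
begin

lemma tens_ids_assoc [simp]: "arr f \<Longrightarrow> idm a \<star> idm b \<star> f = idm (a @ b) \<star> f"
  using tens_assoc[of "idm a" "idm b" f] by simp

text \<open>Oriented so that simplification pushes identities inward: a diagram becomes a
  right-nested composite of layers, each one a generator with identity strands on its sides. What is
  left to apply by hand is the exchange of layers and the straightening of zigzags.\<close>

lemma whisker_left [simp]:
  assumes "arr g" "arr f" "dm g = cd f"
  shows "idm u \<star> (g \<ast> f) = (idm u \<star> g) \<ast> (idm u \<star> f)"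
  using interchange[of "idm u" "idm u" g f] assms by simp

lemma whisker_right [simp]:
  assumes "arr g" "arr f" "dm g = cd f"
  shows "(g \<ast> f) \<star> idm u = (g \<star> idm u) \<ast> (f \<star> idm u)"
  using interchange[of g f "idm u" "idm u"] assms by simp

lemma tens_slide:
  assumes "arr f" "arr g" "dm f = p" "cd f = q" "dm g = r" "cd g = s"
  shows "f \<star> g = (f \<star> idm s) \<ast> (idm p \<star> g)" "f \<star> g = (idm q \<star> g) \<ast> (f \<star> idm r)"
  using interchange[of f "idm p" "idm s" g] interchange[of "idm q" f g "idm r"] assms by simp_all

text \<open>Far commutativity: generators on disjoint groups of strands can trade heights, since
  both composites equal \<open>f\<close> beside \<open>g\<close> with the strands \<open>w\<close>
  between them.\<close>

lemma slide:
  assumes "arr f" "arr g"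
  shows "(idm (u @ cd f @ w) \<star> g \<star> idm v) \<ast> (idm u \<star> f \<star> idm (w @ dm g @ v))
       = (idm u \<star> f \<star> idm (w @ cd g @ v)) \<ast> (idm (u @ dm f @ w) \<star> g \<star> idm v)"
proof -
  have "(idm (cd f) \<star> idm w \<star> g) \<ast> (f \<star> idm (w @ dm g)) = (f \<star> idm (w @ cd g)) \<ast> (idm (dm f @ w) \<star> g)"
    using assms tens_slide[of f "idm w \<star> g" "dm f" "cd f" "w @ dm g" "w @ cd g"] by simp
  from arg_cong[OF this, of "\<lambda>X. idm u \<star> X \<star> idm v"] show ?thesis
    using assms by simp
qed

text \<open>\<open>slide\<close> on top of a further diagram \<open>k\<close>, the shape in which
  two neighbouring layers occur inside a right-nested composite.\<close>

lemma slide_assoc: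
  assumes "arr f" "arr g" "arr k" "cd k = u @ dm f @ w @ dm g @ v"
  shows "(idm (u @ cd f @ w) \<star> g \<star> idm v) \<ast> (idm u \<star> f \<star> idm (w @ dm g @ v)) \<ast> k
       = (idm u \<star> f \<star> idm (w @ cd g @ v)) \<ast> (idm (u @ dm f @ w) \<star> g \<star> idm v) \<ast> k"
  using arg_cong[OF slide[OF assms(1,2), of u w v], of "\<lambda>X. X \<ast> k"] assms by simp

end

locale rigid_calculus = monoidal_calculus +
  fixes dual :: "'x list \<Rightarrow> 'x list"
    and ev coev :: "'x list \<Rightarrow> 'm"
  assumes dual_dual [simp]: "dual (dual a) = a"
    and dual_append [simp]: "dual (a @ b) = dual b @ dual a"
    and arr_ev [simp]: "arr (ev a)" "dm (ev a) = a @ dual a" "cd (ev a) = []"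
    and arr_coev [simp]: "arr (coev a)" "dm (coev a) = []" "cd (coev a) = a @ dual a"
    and zigzag_left: "(ev a \<star> idm a) \<ast> (idm a \<star> coev (dual a)) = idm a"
    and zigzag_right: "(idm a \<star> ev (dual a)) \<ast> (coev a \<star> idm a) = idm a"
    and ev_unit: "ev [] = idm []"
    and coev_unit: "coev [] = idm []"
    and ev_append: "ev (a @ b) = ev a \<ast> (idm a \<star> ev b \<star> idm (dual a))"
    and coev_append: "coev (a @ b) = (idm a \<star> coev b \<star> idm (dual a)) \<ast> coev a"
begin

lemma dual_Nil [simp]: "dual [] = []"
  using dual_append[of "[]" "[]"] by simp

text \<open>
  Quarter turns of \<open>f\<close>: \<open>rho\<close> turns counterclockwise, bending the outputs \<open>c\<close> down on the left and the
  inputs \<open>b\<close> up on the right; \<open>lam\<close> turns clockwise.  With \<open>a\<close> and \<open>d\<close> empty they are the two transposes.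
\<close>

definition rho :: "'x list \<Rightarrow> 'x list \<Rightarrow> 'x list \<Rightarrow> 'x list \<Rightarrow> 'm \<Rightarrow> 'm" where
  "rho a b c d f =
     (ev (dual c) \<star> idm (d @ dual b)) \<ast> (idm (dual c) \<star> f \<star> idm (dual b)) \<ast> (idm (dual c @ a) \<star> coev b)"

definition lam :: "'x list \<Rightarrow> 'x list \<Rightarrow> 'x list \<Rightarrow> 'x list \<Rightarrow> 'm \<Rightarrow> 'm" where
  "lam b a d c f =
     (idm (dual b @ d) \<star> ev c) \<ast> (idm (dual b) \<star> f \<star> idm (dual c)) \<ast> (coev (dual b) \<star> idm (a @ dual c))"

lemma arr_rho [simp]:
  assumes "arr f" "dm f = a @ b" "cd f = c @ d"
  shows "arr (rho a b c d f)" "dm (rho a b c d f) = dual c @ a" "cd (rho a b c d f) = d @ dual b"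
  using assms by (simp_all add: rho_def)

lemma arr_lam [simp]:
  assumes "arr f" "dm f = b @ a" "cd f = d @ c"
  shows "arr (lam b a d c f)" "dm (lam b a d c f) = a @ dual c" "cd (lam b a d c f) = dual b @ d"
  using assms by (simp_all add: lam_def)

lemma zigzag_left_whisker:
  "(idm u \<star> ev a \<star> idm (a @ v)) \<ast> (idm (u @ a) \<star> coev (dual a) \<star> idm v) = idm (u @ a @ v)"
  using arg_cong[OF zigzag_left, of "\<lambda>X. idm u \<star> X \<star> idm v"] by simp

lemma zigzag_right_whisker:
  "(idm (u @ a) \<star> ev (dual a) \<star> idm v) \<ast> (idm u \<star> coev a \<star> idm (a @ v)) = idm (u @ a @ v)"
  using arg_cong[OF zigzag_right, of "\<lambda>X. idm u \<star> X \<star> idm v"] by simp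

lemma zigzag_left_assoc:
  assumes "arr k" "cd k = u @ a @ v"
  shows "(idm u \<star> ev a \<star> idm (a @ v)) \<ast> (idm (u @ a) \<star> coev (dual a) \<star> idm v) \<ast> k = k"
  using arg_cong[OF zigzag_left_whisker[of u a v], of "\<lambda>X. X \<ast> k"] assms by simp

lemma zigzag_right_assoc:
  assumes "arr k" "cd k = u @ a @ v"
  shows "(idm (u @ a) \<star> ev (dual a) \<star> idm v) \<ast> (idm u \<star> coev a \<star> idm (a @ v)) \<ast> k = k"
  using arg_cong[OF zigzag_right_whisker[of u a v], of "\<lambda>X. X \<ast> k"] assms by simp

text \<open>\<open>k\<close> touches only outputs that are not bent, so it slides past the
  cap.\<close>

lemma rho_post:
  assumes "arr f" "dm f = a @ b" "cd f = c @ d" "arr k" "dm k = d" "cd k = d'"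
  shows "rho a b c d' ((idm c \<star> k) \<ast> f) = (k \<star> idm (dual b)) \<ast> rho a b c d f"
  using slide_assoc[of "ev (dual c)" k "(idm (dual c) \<star> f \<star> idm (dual b)) \<ast> (idm (dual c @ a) \<star> coev b)"
    "[]" "[]" "dual b"] assms by (simp add: rho_def)

lemma rho_pre:
  assumes "arr f" "dm f = a @ b" "cd f = c @ d" "arr k" "dm k = a'" "cd k = a"
  shows "rho a' b c d (f \<ast> (k \<star> idm b)) = rho a b c d f \<ast> (idm (dual c) \<star> k)"
  using slide[of k "coev b" "dual c" "[]" "[]"] assms by (simp add: rho_def)

text \<open>The cup on \<open>c\<close> and the cap inside \<open>rho\<close> form a zigzag once the
  rest of the diagram is slid out of the way. This is what makes quarter turns compatible with
  composition.\<close>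

lemma rho_coev:
  assumes [simp]: "arr h" "dm h = b @ t" "cd h = c @ d"
  shows "(idm c \<star> rho b t c d h) \<ast> (coev c \<star> idm b) = (h \<star> idm (dual t)) \<ast> (idm b \<star> coev t)"
proof -
  define k where "k = (h \<star> idm (dual t)) \<ast> (idm b \<star> coev t)"
  have [simp]: "arr k" "dm k = b" "cd k = c @ d @ dual t" by (simp_all add: k_def)
  have "rho b t c d h = (ev (dual c) \<star> idm (d @ dual t)) \<ast> (idm (dual c) \<star> k)"
    by (simp add: rho_def k_def)
  then show ?thesis
    unfolding k_def[symmetric]
    using slide[of "coev c" k "[]" "[]" "[]"] zigzag_right_assoc[of k "[]" c "d @ dual t"] by simp
qed

text \<open>The strand running from \<open>t\<close> through \<open>b\<close> to \<open>c\<close> is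
  bent as a whole, so the two boxes on it appear in the opposite vertical order. With
  \<open>a\<close>, \<open>a'\<close>, \<open>d\<close>, \<open>e\<close> empty this is the
  contravariance of transposition.\<close>

lemma rho_comp:
  assumes [simp]: "arr g" "dm g = a @ b" "cd g = c @ e" "arr h" "dm h = a' @ t" "cd h = b @ d"
  shows "rho (a @ a') t c (e @ d) ((g \<star> idm d) \<ast> (idm a \<star> h))
       = (idm e \<star> rho a' t b d h) \<ast> (rho a b c e g \<star> idm a')"
proof -
  define k where "k = rho a' t b d h"
  have [simp]: "arr k" "dm k = dual b @ a'" "cd k = d @ dual t" by (simp_all add: k_def)
  let ?x = "idm (dual c @ a) \<star> coev b \<star> idm a'"
  have "(idm e \<star> k) \<ast> (rho a b c e g \<star> idm a')
      = (ev (dual c) \<star> idm (e @ d @ dual t)) \<ast> (idm (dual c) \<star> g \<star> idm (d @ dual t))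
        \<ast> (idm (dual c @ a @ b) \<star> k) \<ast> ?x"
    using slide_assoc[of "ev (dual c)" k "(idm (dual c) \<star> g \<star> idm (dual b @ a')) \<ast> ?x" "[]" e "[]"]
      slide_assoc[of g k ?x "dual c" "[]" "[]"]
    by (simp add: rho_def)
  then show ?thesis
    using arg_cong[OF rho_coev[of h a' t b d], of "\<lambda>X. idm (dual c @ a) \<star> X"]
    unfolding k_def[symmetric] by (simp add: rho_def)
qed

text \<open>Bending back and forth leaves one zigzag for each bent group, on \<open>b\<close> and on
  \<open>c\<close>; \<open>f\<close> is slid away so that they can be straightened.\<close>

lemma rho_lam:
  assumes [simp]: "arr f" "dm f = b @ a" "cd f = d @ c"
  shows "rho a (dual c) (dual b) d (lam b a d c f) = f"
proof -
  have "rho a (dual c) (dual b) d (lam b a d c f)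
    = (ev b \<star> idm (d @ c)) \<ast> (idm (b @ dual b @ d) \<star> ev c \<star> idm c) \<ast>
      (idm (b @ dual b) \<star> f \<star> idm (dual c @ c)) \<ast> (idm (b @ dual b @ b @ a) \<star> coev (dual c))
      \<ast> (idm b \<star> coev (dual b) \<star> idm a)"
    using slide[of "coev (dual b)" "coev (dual c)" b a "[]"] by (simp add: rho_def lam_def)
  also have "\<dots> = (ev b \<star> idm (d @ c)) \<ast> (idm (b @ dual b @ d) \<star> ev c \<star> idm c) \<ast>
       (idm (b @ dual b @ d @ c) \<star> coev (dual c)) \<ast> (idm (b @ dual b) \<star> f)
      \<ast> (idm b \<star> coev (dual b) \<star> idm a)"
    using slide_assoc[of f "coev (dual c)" "idm b \<star> coev (dual b) \<star> idm a" "b @ dual b" "[]" "[]"] by simp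
  also have "\<dots> = (ev b \<star> idm (d @ c)) \<ast> (idm (b @ dual b) \<star> f) \<ast> (idm b \<star> coev (dual b) \<star> idm a)"
    using zigzag_left_assoc[of "(idm (b @ dual b) \<star> f) \<ast> (idm b \<star> coev (dual b) \<star> idm a)" "b @ dual b @ d" c "[]"]
    by simp
  also have "\<dots> = f \<ast> (ev b \<star> idm (b @ a)) \<ast> (idm b \<star> coev (dual b) \<star> idm a)"
    using slide_assoc[of "ev b" f "idm b \<star> coev (dual b) \<star> idm a" "[]" "[]" "[]"] by simp
  also have "\<dots> = f"
    using zigzag_left_whisker[of "[]" b a] by simp
  finally show ?thesis .
qed

lemma lam_rho:
  assumes [simp]: "arr f" "dm f = a @ b" "cd f = c @ d"
  shows "lam (dual c) a d (dual b) (rho a b c d f) = f"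
proof -
  have "lam (dual c) a d (dual b) (rho a b c d f)
    = (idm (c @ d) \<star> ev (dual b)) \<ast> (idm c \<star> ev (dual c) \<star> idm (d @ dual b @ b)) \<ast>
      (idm (c @ dual c) \<star> f \<star> idm (dual b @ b)) \<ast> (coev c \<star> idm (a @ b @ dual b @ b)) \<ast> (idm a \<star> coev b \<star> idm b)"
    using slide[of "coev c" "coev b" "[]" a b] by (simp add: rho_def lam_def)
  also have "\<dots> = (idm (c @ d) \<star> ev (dual b)) \<ast> (f \<star> idm (dual b @ b)) \<ast> (idm a \<star> coev b \<star> idm b)"
    using slide_assoc[of "coev c" f "idm a \<star> coev b \<star> idm b" "[]" "[]" "dual b @ b"]
      zigzag_right_assoc[of "(f \<star> idm (dual b @ b)) \<ast> (idm a \<star> coev b \<star> idm b)" "[]" c "d @ dual b @ b"] by simp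
  also have "\<dots> = f \<ast> (idm (a @ b) \<star> ev (dual b)) \<ast> (idm a \<star> coev b \<star> idm b)"
    using slide_assoc[of f "ev (dual b)" "idm a \<star> coev b \<star> idm b" "[]" "[]" "[]"] by simp
  also have "\<dots> = f"
    using zigzag_right_whisker[of a b "[]"] by simp
  finally show ?thesis .
qed


lemma rho_id: "rho [] a a [] (idm a) = idm (dual a)"
  using zigzag_left[of "dual a"] by (simp add: rho_def)

lemma lam_id: "lam a [] [] a (idm a) = idm (dual a)"
  using zigzag_right[of "dual a"] by (simp add: lam_def)

lemma rho_ev: "rho [] (a @ dual a) [] [] (ev a) = coev a"
  using slide_assoc[of "ev a" "coev (dual a)" "coev a" "[]" a "dual a"]
    zigzag_left_assoc[of "coev a" "[]" a "dual a"] slide[of "ev a" "coev (dual a)" "[]" "[]" "dual a"]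
  by (simp add: rho_def coev_append ev_unit)

lemma lam_ev: "lam (a @ dual a) [] [] [] (ev a) = coev a"
  using zigzag_right_assoc[of "coev a" a "dual a" "[]"]
  by (simp add: lam_def coev_append ev_unit)

text \<open>A half turn exchanges left and right. The inner cap and cup are slid along the strands
  until they nest as in \<open>ev_append\<close> and \<open>coev_append\<close>.\<close>

lemma rho_tens:
  assumes [simp]: "arr f" "dm f = a" "cd f = b" "arr g" "dm g = a'" "cd g = b'"
  shows "rho [] (a @ a') (b @ b') [] (f \<star> g) = rho [] a' b' [] g \<star> rho [] a b [] f"
proof -
  let ?F = "rho [] a b [] f" and ?G = "rho [] a' b' [] g"
  have "?G \<star> ?F = (?G \<star> idm (dual a)) \<ast> (idm (dual b') \<star> ?F)"
    by (rule tens_slide(1)) simp_all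
  also have "\<dots> = (ev (dual b') \<star> idm (dual a' @ dual a)) \<ast> (idm (dual b') \<star> g \<star> idm (dual a' @ dual a)) \<ast>
     (idm (dual b') \<star> ev (dual b) \<star> idm (a' @ dual a' @ dual a)) \<ast>
     (idm (dual b' @ dual b @ b) \<star> coev a' \<star> idm (dual a)) \<ast>
     (idm (dual b' @ dual b) \<star> f \<star> idm (dual a)) \<ast> (idm (dual b' @ dual b) \<star> coev a)"
    using slide_assoc[of "ev (dual b)" "coev a'"
     "(idm (dual b' @ dual b) \<star> f \<star> idm (dual a)) \<ast> (idm (dual b' @ dual b) \<star> coev a)" "dual b'" "[]" "dual a"]
    by (simp add: rho_def)
  also have "\<dots> = (ev (dual b') \<star> idm (dual a' @ dual a)) \<ast>
     (idm (dual b') \<star> ev (dual b) \<star> idm (b' @ dual a' @ dual a)) \<ast>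
     (idm (dual b' @ dual b @ b) \<star> g \<star> idm (dual a' @ dual a)) \<ast>
     (idm (dual b' @ dual b) \<star> f \<star> idm (a' @ dual a' @ dual a)) \<ast>
     (idm (dual b' @ dual b @ a) \<star> coev a' \<star> idm (dual a)) \<ast>
     (idm (dual b' @ dual b) \<star> coev a)"
    using slide_assoc[of "ev (dual b)" g
     "(idm (dual b' @ dual b @ b) \<star> coev a' \<star> idm (dual a)) \<ast>
     (idm (dual b' @ dual b) \<star> f \<star> idm (dual a)) \<ast> (idm (dual b' @ dual b) \<star> coev a)" "dual b'" "[]" "dual a' @ dual a"]
     slide_assoc[of f "coev a'" "idm (dual b' @ dual b) \<star> coev a" "dual b' @ dual b" "[]" "dual a"]
    by simp
  also have "\<dots> = rho [] (a @ a') (b @ b') [] (f \<star> g)"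
    using tens_slide(2)[of f g a b a' b'] by (simp add: rho_def coev_append ev_append)
  finally show ?thesis by simp
qed

section \<open>Pivotality: agreement of the two half turns\<close>

definition balanced :: "'m \<Rightarrow> bool" where
  "balanced f \<longleftrightarrow> rho [] (dm f) (cd f) [] f = lam (dm f) [] [] (cd f) f"

lemma balanced_id: "balanced (idm a)"
  by (simp add: balanced_def rho_id lam_id)

lemma balanced_ev: "balanced (ev a)"
  by (simp add: balanced_def rho_ev lam_ev)

lemma balanced_rho:
  assumes "arr f" "dm f = a" "cd f = b" "balanced f"
  shows "balanced (rho [] a b [] f)"
  using assms rho_lam[of f a "[]" "[]" b] lam_rho[of f "[]" a b "[]"] by (simp add: balanced_def)

lemma balanced_coev: "balanced (coev a)"
  using balanced_rho[of "ev a" "a @ dual a" "[]"] by (simp add: balanced_ev rho_ev)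

text \<open>For \<open>rho\<close>, reversal of composites is \<open>rho_comp\<close>. For
  \<open>lam\<close> it is deduced from \<open>lam\<close> being inverse to \<open>rho\<close>: the
  clockwise half turns \<open>f'\<close> and \<open>g'\<close> are turned back by
  \<open>rho\<close>, their composite becomes the given one, and \<open>lam\<close> recovers
  it.\<close>

lemma balanced_comp:
  assumes [simp]: "arr g" "arr f" "dm g = cd f" and bal: "balanced g" "balanced f"
  shows "balanced (g \<ast> f)"
proof -
  define f' where "f' = lam (dm f) [] [] (cd f) f"
  define g' where "g' = lam (cd f) [] [] (cd g) g"
  have [simp]: "arr f'" "dm f' = dual (cd f)" "cd f' = dual (dm f)"
    "arr g'" "dm g' = dual (cd g)" "cd g' = dual (cd f)"
    by (simp_all add: f'_def g'_def)
  have f: "f = rho [] (dual (cd f)) (dual (dm f)) [] f'"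
    and g: "g = rho [] (dual (cd g)) (dual (cd f)) [] g'"
    using rho_lam[of f "dm f" "[]" "[]" "cd f"] rho_lam[of g "cd f" "[]" "[]" "cd g"]
    by (simp_all add: f'_def g'_def)
  have *: "rho [] (dm f) (cd g) [] (g \<ast> f) = f' \<ast> g'"
    using rho_comp[of g "[]" "cd f" "cd g" "[]" f "[]" "dm f" "[]"] bal
    by (simp add: balanced_def f'_def g'_def)
  have "rho [] (dual (cd g)) (dual (dm f)) [] (f' \<ast> g') = g \<ast> f"
    using rho_comp[of f' "[]" "dual (cd f)" "dual (dm f)" "[]" g' "[]" "dual (cd g)" "[]"] f g by simp
  then have "lam (dm f) [] [] (cd g) (g \<ast> f) = f' \<ast> g'"
    using lam_rho[of "f' \<ast> g'" "[]" "dual (cd g)" "dual (dm f)" "[]"] by simp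
  then show ?thesis using * by (simp add: balanced_def)
qed

text \<open>The same device as for composites: the behaviour of \<open>lam\<close> is read off from
  \<open>rho_tens\<close> by inverting.\<close>

lemma balanced_tens:
  assumes [simp]: "arr g" "arr f" and bal: "balanced g" "balanced f"
  shows "balanced (f \<star> g)"
proof -
  define f' where "f' = lam (dm f) [] [] (cd f) f"
  define g' where "g' = lam (dm g) [] [] (cd g) g"
  have [simp]: "arr f'" "dm f' = dual (cd f)" "cd f' = dual (dm f)"
    "arr g'" "dm g' = dual (cd g)" "cd g' = dual (dm g)"
    by (simp_all add: f'_def g'_def)
  have f: "f = rho [] (dual (cd f)) (dual (dm f)) [] f'"
    and g: "g = rho [] (dual (cd g)) (dual (dm g)) [] g'"
    using rho_lam[of f "dm f" "[]" "[]" "cd f"] rho_lam[of g "dm g" "[]" "[]" "cd g"]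
    by (simp_all add: f'_def g'_def)
  have *: "rho [] (dm f @ dm g) (cd f @ cd g) [] (f \<star> g) = g' \<star> f'"
    using rho_tens[of f _ _ g] bal by (simp add: balanced_def f'_def g'_def)
  have "rho [] (dual (cd g) @ dual (cd f)) (dual (dm g) @ dual (dm f)) [] (g' \<star> f') = f \<star> g"
    using rho_tens[of g' _ _ f'] f g by simp
  then have "lam (dm f @ dm g) [] [] (cd f @ cd g) (f \<star> g) = g' \<star> f'"
    using lam_rho[of "g' \<star> f'" "[]" "dual (cd g) @ dual (cd f)" "dual (dm g) @ dual (dm f)" "[]"] by simp
  then show ?thesis using * by (simp add: balanced_def)
qed

text \<open>Two quarter turns make a half turn, because caps and cups on two groups of strands nest
  to those on their concatenation.\<close>

lemma lam_lam:
  assumes [simp]: "arr f" "dm f = b @ a" "cd f = d @ c"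
  shows "lam a (dual c) (dual b) d (lam b a d c f) = lam (b @ a) [] [] (d @ c) f"
  by (simp add: lam_def coev_append ev_append)

lemma rho_rho:
  assumes [simp]: "arr f" "dm f = a @ b" "cd f = c @ d"
  shows "rho (dual c) a d (dual b) (rho a b c d f) = rho [] (a @ b) (c @ d) [] f"
  by (simp add: rho_def coev_append ev_append)

text \<open>Gluing side by side along \<open>e\<close> and \<open>b\<close> becomes stacking after a
  quarter turn. This converts the bigon of (R2b) into the composite of two antiparallel
  crossings.\<close>

lemma rho_horizontal:
  assumes [simp]: "arr s" "dm s = a @ b" "cd s = c @ e" "arr t" "dm t = dual b @ a'" "cd t = dual e @ d"
  shows "rho (dual b) a' (dual e) d t \<ast> rho a b c e s
    = rho a a' c d ((idm c \<star> ev e \<star> idm d) \<ast> (s \<star> t) \<ast> (idm a \<star> coev b \<star> idm a'))"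
proof -
  define k where "k = (ev e \<star> idm (d @ dual a')) \<ast> (idm e \<star> t \<star> idm (dual a'))"
  have [simp]: "arr k" "dm k = e @ dual b @ a' @ dual a'" "cd k = d @ dual a'" by (simp_all add: k_def)
  have "rho (dual b) a' (dual e) d t \<ast> rho a b c e s
    = k \<ast> (idm (e @ dual b) \<star> coev a') \<ast> rho a b c e s"
    by (simp add: rho_def k_def)
  also have "\<dots> = k \<ast> (rho a b c e s \<star> idm (a' @ dual a')) \<ast> (idm (dual c @ a) \<star> coev a')"
    using slide[of "rho a b c e s" "coev a'" "[]" "[]" "[]"] by simp
  also have "\<dots> = k \<ast> (ev (dual c) \<star> idm (e @ dual b @ a' @ dual a')) \<ast> (idm (dual c) \<star> s \<star> idm (dual b @ a' @ dual a')) \<ast>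
    (idm (dual c @ a) \<star> coev b \<star> idm (a' @ dual a')) \<ast> (idm (dual c @ a) \<star> coev a')"
    by (simp add: rho_def)
  also have "\<dots> = (ev (dual c) \<star> idm (d @ dual a')) \<ast> (idm (dual c @ c) \<star> k) \<ast> (idm (dual c) \<star> s \<star> idm (dual b @ a' @ dual a')) \<ast>
    (idm (dual c @ a) \<star> coev b \<star> idm (a' @ dual a')) \<ast> (idm (dual c @ a) \<star> coev a')"
    using slide_assoc[of "ev (dual c)" k "(idm (dual c) \<star> s \<star> idm (dual b @ a' @ dual a')) \<ast>
    (idm (dual c @ a) \<star> coev b \<star> idm (a' @ dual a')) \<ast> (idm (dual c @ a) \<star> coev a')" "[]" "[]" "[]"] by simp
  also have "\<dots> = rho a a' c d ((idm c \<star> ev e \<star> idm d) \<ast> (s \<star> t) \<ast> (idm a \<star> coev b \<star> idm a'))"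
    using tens_slide(2)[of s t] by (simp add: rho_def k_def)
  finally show ?thesis .
qed

text \<open>Provides the other side of the turned bigon move: a cap below a cup becomes two vertical
  strands.\<close>

lemma rho_coev_ev: "rho a (dual a) a (dual a) (coev a \<ast> ev a) = idm (dual a @ a)"
  using zigzag_left_whisker[of "[]" "dual a" a] zigzag_left_whisker[of "dual a" a "[]"]
  by (simp add: rho_def)

section \<open>Partial traces on either side\<close>

definition ptr_left :: "'x list \<Rightarrow> 'm \<Rightarrow> 'm" where
  "ptr_left a f = (ev (dual a) \<star> idm a) \<ast> (idm (dual a) \<star> f) \<ast> (coev (dual a) \<star> idm a)"

definition ptr_right :: "'x list \<Rightarrow> 'm \<Rightarrow> 'm" where
  "ptr_right a f = (idm a \<star> ev a) \<ast> (f \<star> idm (dual a)) \<ast> (idm a \<star> coev a)"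

text \<open>A half turn carries a loop on the right to a loop on the left. Together with pivotality
  this yields the right loop on \<open>S\<close> from a relation about the left loop.\<close>

lemma ptr_left_lam:
  assumes [simp]: "arr f" "dm f = a @ a" "cd f = a @ a"
  shows "ptr_left (dual a) (lam (a @ a) [] [] (a @ a) f) = lam a [] [] a (ptr_right a f)"
proof -
  define g where "g = lam a a a a f"
  have [simp]: "arr g" "dm g = a @ dual a" "cd g = dual a @ a" by (simp_all add: g_def)
  \<comment> \<open>Feeding a cup into the quarter turn \<open>g\<close> of \<open>f\<close> joins
    its bent output to its unbent input, which closes the right strand of \<open>f\<close>.\<close>
  have g: "g \<ast> coev a = (idm (dual a) \<star> ptr_right a f) \<ast> coev (dual a)"
    using slide[of "coev (dual a)" "coev a" "[]" a "[]"] slide[of "coev (dual a)" "coev a" "[]" "[]" "[]"]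
     tens_slide[of "coev (dual a)" "coev a"]
    by (simp add: g_def lam_def ptr_right_def)
  have "ptr_left (dual a) (lam (a @ a) [] [] (a @ a) f) = ptr_left (dual a) (lam a (dual a) (dual a) a g)"
    by (simp add: g_def lam_lam)
  also have "\<dots> = (idm (dual a) \<star> ev a) \<ast> (g \<star> idm (dual a)) \<ast> (coev a \<star> idm (dual a))"
    using slide_assoc[of "ev a" "ev a" "(idm (a @ dual a) \<star> g \<star> idm (dual a)) \<ast>
        (idm a \<star> coev (dual a) \<star> idm (dual a @ dual a)) \<ast> (coev a \<star> idm (dual a))" "[]" "dual a" "[]"]
      slide_assoc[of "ev a" g "(idm a \<star> coev (dual a) \<star> idm (dual a @ dual a)) \<ast> (coev a \<star> idm (dual a))"
        "[]" "[]" "dual a"]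
      zigzag_left_assoc[of "coev a \<star> idm (dual a)" "[]" a "dual a @ dual a"]
      slide[of "ev a" "ev a" "[]" "dual a" "[]"]
    by (simp add: ptr_left_def lam_def)
  also have "\<dots> = lam a [] [] a (ptr_right a f)"
    using arg_cong[OF g, of "\<lambda>X. X \<star> idm (dual a)"] by (simp add: lam_def ptr_right_def)
  finally show ?thesis .
qed

end

section \<open>Plane graphs up to isotopy\<close>

lemma flip_flip [simp]: "flip (flip x) = x"
  by (cases x) simp_all

lemma dual_word_dual_word [simp]: "dual_word (dual_word w) = w"
  by (induction w) simp_all

lemma nested_words [simp]:
  "bottom_word (nested_cap w) = w @ dual_word w" "top_word (nested_cap w) = []"
  "bottom_word (nested_cup w) = []" "top_word (nested_cup w) = w @ dual_word w"
  by (induction w) simp_all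

text \<open>Every generating isotopy fixes the boundary; hence source and target words descend to
  the quotient type.\<close>

lemma isotopic_words:
  "isotopic d e \<Longrightarrow> bottom_word d = bottom_word e \<and> top_word d = top_word e"
  by (induction rule: isotopic.induct) (auto simp: turn_left_def turn_right_def Let_def)

lift_definition source_word :: "plane_graph \<Rightarrow> edge list" is bottom_word
  by (simp add: isotopic_words)

lift_definition target_word :: "plane_graph \<Rightarrow> edge list" is top_word
  by (simp add: isotopic_words)

lift_definition id_graph :: "edge list \<Rightarrow> plane_graph" is Ident .

lift_definition cap_graph :: "edge list \<Rightarrow> plane_graph" is nested_cap .

lift_definition cup_graph :: "edge list \<Rightarrow> plane_graph" is nested_cup .

text \<open>The type also contains stackings with unequal boundaries, so \<open>arr\<close> is
  constantly true and composability is expressed only by the boundary conditions in the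
  laws.\<close>

interpretation pg: monoidal_calculus "\<lambda>_. True" source_word target_word id_graph stack juxt
proof
  fix f g h f' g' :: plane_graph and a b :: "edge list"
  show "source_word (id_graph a) = a" "target_word (id_graph a) = a" by (transfer; simp)+
  show "source_word (stack g f) = source_word f" "target_word (stack g f) = target_word g"
    by (transfer; simp)+
  show "source_word (juxt g f) = source_word g @ source_word f"
    "target_word (juxt g f) = target_word g @ target_word f"
    by (transfer; simp)+
  show "stack (stack h g) f = stack h (stack g f)" by transfer (rule isotopic.stack_assoc)
  show "juxt (juxt f g) h = juxt f (juxt g h)" by transfer (rule isotopic.juxt_assoc)
  show "juxt (id_graph []) f = f" by transfer (rule isotopic.empty_juxt)
  show "juxt f (id_graph []) = f" by transfer (rule isotopic.juxt_empty)
  show "juxt (id_graph a) (id_graph b) = id_graph (a @ b)" by transfer (rule isotopic.juxt_ident)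
  show "stack (id_graph b) f = f" if "target_word f = b"
    using that by transfer (use isotopic.ident_stack in blast)
  show "stack f (id_graph a) = f" if "source_word f = a"
    using that by transfer (use isotopic.stack_ident in blast)
  show "juxt (stack g f) (stack g' f') = stack (juxt g g') (juxt f f')"
    if "source_word g = target_word f" "source_word g' = target_word f'"
    using that by transfer (rule isotopic.exchange)
qed simp_all

lemma source_cap_graph [simp]: "source_word (cap_graph w) = w @ dual_word w" "target_word (cap_graph w) = []"
  by (transfer; simp)+

lemma source_cup_graph [simp]: "source_word (cup_graph w) = []" "target_word (cup_graph w) = w @ dual_word w"
  by (transfer; simp)+

lemma cap_graph_Nil [simp]: "cap_graph [] = id_graph []" and cup_graph_Nil [simp]: "cup_graph [] = id_graph []"
  by (transfer; simp add: isotopic.refl)+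

text \<open>A nested cap or cup on one letter still carries identity strands and an empty diagram.
  Absorbing them gives the elementary piece that occurs in the straightening isotopies.\<close>

lemma nested_singleton:
  "isotopic (nested_cap [x]) (Cap x)" "isotopic (nested_cup [x]) (Cup x)"
proof -
  have "isotopic (Juxt (Ident [x]) (Juxt (Ident []) (Ident [opp x]))) (Ident ([x] @ [opp x]))"
    by (meson isotopic.intros)
  then show "isotopic (nested_cap [x]) (Cap x)" "isotopic (nested_cup [x]) (Cup x)"
    using isotopic.stack_ident[of "Cap x"] isotopic.ident_stack[of "Cup x"]
    by (auto intro: isotopic.trans isotopic.stack_cong isotopic.refl)
qed

lemma cap_graph_Cons: "cap_graph (x # w) = stack (cap_graph [x]) (juxt (id_graph [x]) (juxt (cap_graph w) (id_graph [opp x])))"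
proof transfer
  fix x and w :: "edge list"
  show "isotopic (nested_cap (x # w))
    (Stack (nested_cap [x]) (Juxt (Ident [x]) (Juxt (nested_cap w) (Ident [opp x]))))"
    using nested_singleton(1)[of x] by (simp del: nested_cap.simps add: nested_cap.simps(2)[of x w] isotopic.stack_cong isotopic.refl isotopic.sym)
qed

lemma cup_graph_Cons: "cup_graph (x # w) = stack (juxt (id_graph [x]) (juxt (cup_graph w) (id_graph [opp x]))) (cup_graph [x])"
proof transfer
  fix x and w :: "edge list"
  show "isotopic (nested_cup (x # w))
    (Stack (Juxt (Ident [x]) (Juxt (nested_cup w) (Ident [opp x]))) (nested_cup [x]))"
    using nested_singleton(2)[of x] by (simp del: nested_cup.simps add: nested_cup.simps(2)[of x w] isotopic.stack_cong isotopic.refl isotopic.sym)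
qed

lemma cap_graph_append: "cap_graph (v @ w) = stack (cap_graph v) (juxt (id_graph v) (juxt (cap_graph w) (id_graph (dual_word v))))"
proof (induction v)
  case (Cons x v)
  then show ?case
    by (simp add: cap_graph_Cons[of x "v @ w"] cap_graph_Cons[of x v])
qed simp

lemma cup_graph_append: "cup_graph (v @ w) = stack (juxt (id_graph v) (juxt (cup_graph w) (id_graph (dual_word v)))) (cup_graph v)"
proof (induction v)
  case (Cons x v)
  then show ?case
    by (simp add: cup_graph_Cons[of x "v @ w"] cup_graph_Cons[of x v])
qed simp

lemma zigzag_letter:
  "stack (juxt (cap_graph [x]) (id_graph [x])) (juxt (id_graph [x]) (cup_graph [opp x])) = id_graph [x]"
  "stack (juxt (id_graph [x]) (cap_graph [opp x])) (juxt (cup_graph [x]) (id_graph [x])) = id_graph [x]"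
proof (transfer)
  show "isotopic (Stack (Juxt (nested_cap [x]) (Ident [x])) (Juxt (Ident [x]) (nested_cup [opp x]))) (Ident [x])" for x
    by (rule isotopic.trans[OF isotopic.stack_cong isotopic.straighten_left])
      (intro isotopic.juxt_cong nested_singleton isotopic.refl)+
next
  show "stack (juxt (id_graph [x]) (cap_graph [opp x])) (juxt (cup_graph [x]) (id_graph [x])) = id_graph [x]"
    by transfer (rule isotopic.trans[OF isotopic.stack_cong isotopic.straighten_right];
      intro isotopic.juxt_cong nested_singleton isotopic.refl)
qed

text \<open>Trading heights between the cap on \<open>w\<close> and the cup on the new letter (in
  the second part, between cup and cap) separates the zigzag of the new letter from the one given by
  induction.\<close>

lemma zigzag_words:
  "stack (juxt (cap_graph w) (id_graph w)) (juxt (id_graph w) (cup_graph (dual_word w))) = id_graph w"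
  "stack (juxt (id_graph w) (cap_graph (dual_word w))) (juxt (cup_graph w) (id_graph w)) = id_graph w"
proof (induction w)
  case (Cons x w)
  note z = arg_cong[OF zigzag_letter(1), of "\<lambda>X. juxt X (id_graph w)"]
    arg_cong[OF zigzag_letter(2), of "\<lambda>X. juxt X (id_graph w)"]
  note y = arg_cong[OF Cons.IH(1), of "\<lambda>X. juxt (id_graph [x]) X"]
    arg_cong[OF Cons.IH(2), of "\<lambda>X. juxt (id_graph [x]) X"]
  case 1
  show ?case
    using z(1)[of x] y(1) pg.slide_assoc[where f = "cap_graph w" and g = "cup_graph [opp x]" and k = "juxt (id_graph (x # w)) (cup_graph (dual_word w))"
        and u = "[x]" and w = "[]" and v = w]
    by (simp add: cap_graph_Cons[of x w] cup_graph_append)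
  case 2
  show ?case
    using z(2)[of x] y(2) pg.slide_assoc[where f = "cup_graph w" and g = "cap_graph [opp x]" and k = "juxt (cup_graph [x]) (id_graph (x # w))"
        and u = "[x]" and w = "[]" and v = w]
    by (simp add: cup_graph_Cons[of x w] cap_graph_append)
qed simp_all

interpretation pg: rigid_calculus "\<lambda>_. True" source_word target_word id_graph stack juxt dual_word cap_graph cup_graph
  by unfold_locales (simp_all add: zigzag_words[unfolded rev_map] cap_graph_append cup_graph_append rev_map comp_def)

section \<open>Trivalent vertices and the graphs that span \<open>TrPD\<close>\<close>

lift_definition join_graph :: "orient \<Rightarrow> plane_graph" is Join .

lift_definition fork_graph :: "orient \<Rightarrow> plane_graph" is Fork .

lemma source_join_graph [simp]: "source_word (join_graph x) = [(x, One), (x, One)]" "target_word (join_graph x) = [(x, Two)]"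
  and source_fork_graph [simp]: "source_word (fork_graph x) = [(x, Two)]" "target_word (fork_graph x) = [(x, One), (x, One)]"
  by (transfer; simp)+

lemma turn_join_graph:
  "pg.rho [] [(x, One), (x, One)] [(x, Two)] [] (join_graph x) = fork_graph (flip x)"
  "pg.lam [(x, One), (x, One)] [] [] [(x, Two)] (join_graph x) = fork_graph (flip x)"
proof -
  show "pg.rho [] [(x, One), (x, One)] [(x, Two)] [] (join_graph x) = fork_graph (flip x)"
    unfolding pg.rho_def
    using isotopic.rotate_left[of x]
    by transfer (simp add: turn_left_def Let_def)
  show "pg.lam [(x, One), (x, One)] [] [] [(x, Two)] (join_graph x) = fork_graph (flip x)"
    unfolding pg.lam_def
    using isotopic.rotate_right[of x]
    by transfer (simp add: turn_right_def Let_def)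
qed

text \<open>The isotopies prescribe the rotation of merging vertices only; splitting vertices follow
  because \<open>rho\<close> and \<open>lam\<close> undo each other.\<close>

lemma turn_fork_graph: "pg.rho [] [(x, Two)] [(x, One), (x, One)] [] (fork_graph x) = join_graph (flip x)"
  "pg.lam [(x, Two)] [] [] [(x, One), (x, One)] (fork_graph x) = join_graph (flip x)"
  using pg.rho_lam[of "join_graph (flip x)" "[(flip x, One), (flip x, One)]" "[]" "[]" "[(flip x, Two)]"]
    pg.lam_rho[of "join_graph (flip x)" "[]" "[(flip x, One), (flip x, One)]" "[(flip x, Two)]" "[]"]
    turn_join_graph[of "flip x"] by simp_all

lemma S_graph_eq: "S_graph x = stack (fork_graph x) (join_graph x)"
  by (simp add: S_graph_def stack.abs_eq fork_graph.abs_eq join_graph.abs_eq)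

text \<open>A half turn reverses the order of merge and split and also exchanges these two kinds of
  vertices, so the result is again a merge followed by a split.\<close>

lemma turn_S_graph: "pg.rho [] (word [x, x]) (word [x, x]) [] (S_graph x) = S_graph (flip x)"
  using pg.rho_comp[of "fork_graph x" "[]" "[(x, Two)]" "[(x, One), (x, One)]" "[]" "join_graph x" "[]" "[(x, One), (x, One)]" "[]"]
  by (simp add: S_graph_eq turn_join_graph turn_fork_graph)

lemma ident_graph_eq: "ident_graph a = id_graph (word a)"
  and ev_graph_eq: "ev_graph a = cap_graph (word a)"
  and coev_graph_eq: "coev_graph a = cup_graph (word a)"
  by (simp_all add: ident_graph_def id_graph.abs_eq ev_graph_def cap_graph.abs_eq coev_graph_def cup_graph.abs_eq)

lemma word_dual: "word (rev (map flip a)) = dual_word (word a)"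
  by (simp add: rev_map)

lemma trpd_graph_words: "trpd_graph a b D \<Longrightarrow> source_word D = word a \<and> target_word D = word b"
  by (induction rule: trpd_graph.induct)
    (simp_all add: ident_graph_eq ev_graph_eq coev_graph_eq S_graph_eq)

text \<open>Pivotality passes to stackings and juxtapositions, so generators suffice; for vertices
  it is the agreement of their two rotations. Membership in \<open>trpd_graph\<close> supplies the
  matching boundaries that stacking needs.\<close>

lemma trpd_graph_balanced: "trpd_graph a b D \<Longrightarrow> pg.balanced D"
proof (induction rule: trpd_graph.induct)
  case (S x)
  show ?case
    using pg.balanced_comp[where g = "fork_graph x" and f = "join_graph x"]
    by (simp add: S_graph_eq pg.balanced_def turn_join_graph turn_fork_graph)
next
  case (stack a b D c E)
  then show ?case by (simp add: pg.balanced_comp trpd_graph_words)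
qed (simp_all add: ident_graph_eq ev_graph_eq coev_graph_eq pg.balanced_id pg.balanced_ev pg.balanced_coev pg.balanced_tens)

lemma trpd_ev: "trpd_graph (a @ rev (map flip a)) [] (ev_graph a)"
proof (induction a)
  case Nil
  then show ?case using trpd_graph.ident[of "[]"] by (simp add: ev_graph_eq ident_graph_eq)
next
  case (Cons x a)
  have "trpd_graph ([x] @ (a @ rev (map flip a)) @ [flip x]) ([x] @ [] @ [flip x])
    (juxt (ident_graph [x]) (juxt (ev_graph a) (ident_graph [flip x])))"
    using Cons by (intro trpd_graph.juxt trpd_graph.ident)
  from trpd_graph.stack[OF this, of "[]" "ev_graph [x]"] trpd_graph.ev[of x]
  show ?case using cap_graph_Cons[of "(x, One)" "word a"] by (simp add: ev_graph_eq ident_graph_eq)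
qed

lemma trpd_coev: "trpd_graph [] (a @ rev (map flip a)) (coev_graph a)"
proof (induction a)
  case Nil
  then show ?case using trpd_graph.ident[of "[]"] by (simp add: coev_graph_eq ident_graph_eq)
next
  case (Cons x a)
  have "trpd_graph ([x] @ [] @ [flip x]) ([x] @ (a @ rev (map flip a)) @ [flip x])
    (juxt (ident_graph [x]) (juxt (coev_graph a) (ident_graph [flip x])))"
    using Cons by (intro trpd_graph.juxt trpd_graph.ident)
  from trpd_graph.stack[OF _ this, of "[]" "coev_graph [x]"] trpd_graph.coev[of x]
  show ?case using cup_graph_Cons[of "(x, One)" "word a"] by (simp add: coev_graph_eq ident_graph_eq)
qed

section \<open>The linear category of plane graphs\<close>

lemma stack_assoc: "stack (stack h g) f = stack h (stack g f)"
  by transfer (rule isotopic.stack_assoc)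

section \<open>Finitely supported functions and bilinear extension\<close>

definition finitely_supported :: "('r, 's) ring_scheme \<Rightarrow> ('g \<Rightarrow> 'r) \<Rightarrow> bool" where
  "finitely_supported R f \<longleftrightarrow> range f \<subseteq> carrier R \<and> finite {D. f D \<noteq> \<zero>\<^bsub>R\<^esub>}"

definition indic :: "('r, 's) ring_scheme \<Rightarrow> 'g \<Rightarrow> 'g \<Rightarrow> 'r" where
  "indic R D = (\<lambda>E. if E = D then \<one>\<^bsub>R\<^esub> else \<zero>\<^bsub>R\<^esub>)"

context cring
begin

abbreviation fs :: "('g \<Rightarrow> 'a) \<Rightarrow> bool" where "fs \<equiv> finitely_supported R"
abbreviation be where "be \<equiv> bilinear_ext R"

lemma fs_closed [simp]: "fs f \<Longrightarrow> f D \<in> carrier R"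
  by (auto simp: finitely_supported_def)

lemma fs_zero [simp]: "fs (\<lambda>_. \<zero>)"
  by (simp add: finitely_supported_def image_subset_iff)

lemma fs_indic [simp]: "fs (indic R D)"
  by (auto simp: finitely_supported_def indic_def)

lemma finitely_supportedI:
  assumes "fs f" "\<And>D. g D \<in> carrier R" "\<And>D. f D = \<zero> \<Longrightarrow> g D = \<zero>"
  shows "fs g"
proof -
  have "{D. g D \<noteq> \<zero>} \<subseteq> {D. f D \<noteq> \<zero>}" using assms(3) by auto
  then show ?thesis
    using assms(1,2) finite_subset by (auto simp: finitely_supported_def)
qed

lemma fs_add [simp]:
  assumes "fs f" "fs g"
  shows "fs (\<lambda>D. f D \<oplus> g D)"
proof -
  have "{D. f D \<oplus> g D \<noteq> \<zero>} \<subseteq> {D. f D \<noteq> \<zero>} \<union> {D. g D \<noteq> \<zero>}" by auto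
  moreover have "finite ({D. f D \<noteq> \<zero>} \<union> {D. g D \<noteq> \<zero>})"
    using assms by (simp add: finitely_supported_def)
  ultimately have "finite {D. f D \<oplus> g D \<noteq> \<zero>}" by (rule finite_subset)
  then show ?thesis using assms by (auto simp: finitely_supported_def)
qed

lemma fs_smult [simp]: "r \<in> carrier R \<Longrightarrow> fs f \<Longrightarrow> fs (\<lambda>D. r \<otimes> f D)"
  by (rule finitely_supportedI[of f]) simp_all

text \<open>Induction over a free module: a property stable under linear combinations is checked on
  basis elements. The bound \<open>A\<close> on the support allows these to be graphs with
  prescribed boundary.\<close>

lemma fs_induct [consumes 2, case_names zero indic add smult]:
  assumes "fs f" and supp: "{D. f D \<noteq> \<zero>} \<subseteq> A"
    and zero: "P (\<lambda>_. \<zero>)"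
    and indic: "\<And>D. D \<in> A \<Longrightarrow> P (indic R D)"
    and add: "\<And>f g. \<lbrakk>fs f; fs g; P f; P g\<rbrakk> \<Longrightarrow> P (\<lambda>D. f D \<oplus> g D)"
    and smult: "\<And>r f. \<lbrakk>r \<in> carrier R; fs f; P f\<rbrakk> \<Longrightarrow> P (\<lambda>D. r \<otimes> f D)"
  shows "P f"
proof -
  have "P f" if "finite B" "fs f" "{D. f D \<noteq> \<zero>} \<subseteq> B" "B \<subseteq> A" for B f
    using that
  proof (induction B arbitrary: f rule: finite_induct)
    case empty
    then have "f = (\<lambda>_. \<zero>)" by auto
    then show ?case using zero by simp
  next
    case (insert D B)
    define g where "g = f(D := \<zero>)"
    have g: "fs g"
      by (rule finitely_supportedI[of f]) (use insert.prems in \<open>auto simp: g_def\<close>)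
    have "{E. g E \<noteq> \<zero>} \<subseteq> B" using insert.prems by (auto simp: g_def)
    then have "P g" using insert.IH g insert.prems by simp
    moreover have "P (\<lambda>E. f D \<otimes> indic R D E)"
      using insert.prems by (intro smult indic) auto
    ultimately have "P (\<lambda>E. g E \<oplus> f D \<otimes> indic R D E)"
      using g insert.prems by (intro add) auto
    moreover have "(\<lambda>E. g E \<oplus> f D \<otimes> indic R D E) = f"
      using insert.prems by (auto simp: g_def indic_def)
    ultimately show ?case by simp
  qed
  from this[of "{D. f D \<noteq> \<zero>}" f] show ?thesis
    using assms(1,2) by (auto simp: finitely_supported_def)
qed

text \<open>The index set in \<open>bilinear_ext\<close> depends on the functions and on
  \<open>H\<close>. Passing to a fixed finite rectangle, with zero entries off that set, makes sums
  for different functions comparable term by term.\<close>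

lemma be_eq:
  assumes "fs f" "fs g" "finite A" "finite B" "{D. f D \<noteq> \<zero>} \<subseteq> A" "{D. g D \<noteq> \<zero>} \<subseteq> B"
  shows "be m f g H = (\<Oplus>p \<in> A \<times> B. if m (fst p) (snd p) = H then f (fst p) \<otimes> g (snd p) else \<zero>)"
  unfolding bilinear_ext_def
  by (rule add.finprod_mono_neutral_cong_left) (use assms in \<open>auto simp: case_prod_beta\<close>)

lemma be_supp: "be m f g H \<noteq> \<zero> \<Longrightarrow> \<exists>D E. f D \<noteq> \<zero> \<and> g E \<noteq> \<zero> \<and> m D E = H"
proof (rule ccontr)
  assume "be m f g H \<noteq> \<zero>" "\<nexists>D E. f D \<noteq> \<zero> \<and> g E \<noteq> \<zero> \<and> m D E = H"
  moreover from this(2) have "{(D, E). f D \<noteq> \<zero> \<and> g E \<noteq> \<zero> \<and> m D E = H} = {}" by auto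
  ultimately show False by (simp add: bilinear_ext_def)
qed

lemma fs_be [simp]: "fs f \<Longrightarrow> fs g \<Longrightarrow> fs (be m f g)"
proof -
  assume fg: "fs f" "fs g"
  have "{H. be m f g H \<noteq> \<zero>} \<subseteq> (\<lambda>(D, E). m D E) ` ({D. f D \<noteq> \<zero>} \<times> {E. g E \<noteq> \<zero>})"
    using be_supp[of m f g] by fastforce
  then have "finite {H. be m f g H \<noteq> \<zero>}"
    using finite_subset fg by (fastforce simp: finitely_supported_def)
  moreover have "be m f g H \<in> carrier R" for H
    unfolding bilinear_ext_def using fg by (intro finsum_closed) auto
  ultimately show "fs (be m f g)" by (auto simp: finitely_supported_def)
qed

lemma be_zero [simp]: "be m (\<lambda>_. \<zero>) g = (\<lambda>_. \<zero>)" "be m f (\<lambda>_. \<zero>) = (\<lambda>_. \<zero>)"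
  by (simp_all add: bilinear_ext_def)

lemma indic_supp: "{E. indic R D E \<noteq> \<zero>} \<subseteq> {D}"
  by (auto simp: indic_def)

lemma be_indic [simp]: "be m (indic R D) (indic R E) = indic R (m D E)"
proof
  fix H
  show "be m (indic R D) (indic R E) H = indic R (m D E) H"
    using be_eq[OF fs_indic fs_indic _ _ indic_supp indic_supp, of D E m H] by (auto simp: indic_def[of R])
qed

lemma be_add_left [simp]:
  assumes "fs f" "fs f'" "fs g"
  shows "be m (\<lambda>D. f D \<oplus> f' D) g = (\<lambda>H. be m f g H \<oplus> be m f' g H)"
proof
  fix H
  let ?A = "{D. f D \<noteq> \<zero>} \<union> {D. f' D \<noteq> \<zero>}" and ?B = "{E. g E \<noteq> \<zero>}"
  have A: "finite ?A" "finite ?B" using assms by (auto simp: finitely_supported_def)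
  have "be m (\<lambda>D. f D \<oplus> f' D) g H =
    (\<Oplus>p \<in> ?A \<times> ?B. if m (fst p) (snd p) = H then (f (fst p) \<oplus> f' (fst p)) \<otimes> g (snd p) else \<zero>)"
    using assms A by (intro be_eq) auto
  also have "\<dots> = (\<Oplus>p \<in> ?A \<times> ?B. (if m (fst p) (snd p) = H then f (fst p) \<otimes> g (snd p) else \<zero>)
     \<oplus> (if m (fst p) (snd p) = H then f' (fst p) \<otimes> g (snd p) else \<zero>))"
    using assms by (intro finsum_cong') (auto simp: l_distr)
  also have "\<dots> = be m f g H \<oplus> be m f' g H"
    using assms A by (subst finsum_addf) (auto simp: be_eq[of _ _ ?A ?B])
  finally show "be m (\<lambda>D. f D \<oplus> f' D) g H = be m f g H \<oplus> be m f' g H" .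
qed

lemma be_smult_left [simp]:
  assumes "r \<in> carrier R" "fs f" "fs g"
  shows "be m (\<lambda>D. r \<otimes> f D) g = (\<lambda>H. r \<otimes> be m f g H)"
proof
  fix H
  let ?A = "{D. f D \<noteq> \<zero>}" and ?B = "{E. g E \<noteq> \<zero>}"
  have A: "finite ?A" "finite ?B" using assms by (auto simp: finitely_supported_def)
  have "be m (\<lambda>D. r \<otimes> f D) g H =
    (\<Oplus>p \<in> ?A \<times> ?B. if m (fst p) (snd p) = H then (r \<otimes> f (fst p)) \<otimes> g (snd p) else \<zero>)"
    using assms A by (intro be_eq) auto
  also have "\<dots> = (\<Oplus>p \<in> ?A \<times> ?B. r \<otimes> (if m (fst p) (snd p) = H then f (fst p) \<otimes> g (snd p) else \<zero>))"
    using assms by (intro finsum_cong') (auto simp: m_assoc)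
  also have "\<dots> = r \<otimes> be m f g H"
    using assms A by (subst finsum_rdistr[symmetric]) (auto simp: be_eq[of _ _ ?A ?B])
  finally show "be m (\<lambda>D. r \<otimes> f D) g H = r \<otimes> be m f g H" .
qed

text \<open>Transfers linearity from the left argument to the right one, by commutativity of the
  ring.\<close>

lemma be_flip: "fs f \<Longrightarrow> fs g \<Longrightarrow> be m f g = be (\<lambda>D E. m E D) g f"
proof
  fix H assume fg: "fs f" "fs g"
  let ?A = "{D. f D \<noteq> \<zero>}" and ?B = "{E. g E \<noteq> \<zero>}"
  have A: "finite ?A" "finite ?B" using fg by (auto simp: finitely_supported_def)
  have "be m f g H = (\<Oplus>p \<in> ?A \<times> ?B. if m (fst p) (snd p) = H then f (fst p) \<otimes> g (snd p) else \<zero>)"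
    using fg A by (intro be_eq) auto
  also have "\<dots> = (\<Oplus>p \<in> prod.swap ` (?B \<times> ?A). if m (fst p) (snd p) = H then f (fst p) \<otimes> g (snd p) else \<zero>)"
    by (simp add: product_swap)
  also have "\<dots> = (\<Oplus>p \<in> ?B \<times> ?A. if m (snd p) (fst p) = H then f (snd p) \<otimes> g (fst p) else \<zero>)"
    using fg by (subst finsum_reindex) (auto simp: inj_on_def intro!: finsum_cong')
  also have "\<dots> = be (\<lambda>D E. m E D) g f H"
    using fg A by (subst be_eq[of _ _ ?B ?A]) (auto simp: m_comm intro!: finsum_cong')
  finally show "be m f g H = be (\<lambda>D E. m E D) g f H" .
qed

lemma be_add_right [simp]:
  "fs f \<Longrightarrow> fs g \<Longrightarrow> fs g' \<Longrightarrow> be m f (\<lambda>D. g D \<oplus> g' D) = (\<lambda>H. be m f g H \<oplus> be m f g' H)"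
  by (simp add: be_flip[of f _ m])

lemma be_smult_right [simp]:
  "r \<in> carrier R \<Longrightarrow> fs f \<Longrightarrow> fs g \<Longrightarrow> be m f (\<lambda>D. r \<otimes> g D) = (\<lambda>H. r \<otimes> be m f g H)"
  by (simp add: be_flip[of f _ m])

lemma be_assoc:
  assumes "fs f" "fs g" "fs h" "\<And>D E F. m (m D E) F = m D (m E F)"
  shows "be m (be m f g) h = be m f (be m g h)"
  using assms(1) subset_UNIV
proof (induction f rule: fs_induct)
  case (indic D)
  show ?case using assms(2) subset_UNIV
  proof (induction g rule: fs_induct)
    case (indic E)
    show ?case using assms(3) subset_UNIV
      by (induction h rule: fs_induct) (simp_all add: assms(4))
  qed (simp_all add: assms(3))
qed (simp_all add: assms(2,3))

text \<open>The exchange law for graphs requires matching boundaries. Therefore the hypothesis on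
  \<open>m\<close> and \<open>n\<close> is confined to sets containing the supports, unlike the
  associativity hypothesis of \<open>be_assoc\<close>.\<close>

lemma be_interchange:
  assumes g: "fs g" "{D. g D \<noteq> \<zero>} \<subseteq> A" and f: "fs f" "{D. f D \<noteq> \<zero>} \<subseteq> B"
    and g': "fs g'" "{D. g' D \<noteq> \<zero>} \<subseteq> A'" and f': "fs f'" "{D. f' D \<noteq> \<zero>} \<subseteq> B'"
    and m: "\<And>G F G' F'. \<lbrakk>G \<in> A; F \<in> B; G' \<in> A'; F' \<in> B'\<rbrakk>
      \<Longrightarrow> n (m G F) (m G' F') = m (n G G') (n F F')"
  shows "be n (be m g f) (be m g' f') = be m (be n g g') (be n f f')"
  using g
proof (induction g rule: fs_induct)
  case (indic G)
  note G = indic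
  show ?case using f
  proof (induction f rule: fs_induct)
    case (indic F)
    note F = indic
    show ?case using g'
    proof (induction g' rule: fs_induct)
      case (indic G')
      note G' = indic
      show ?case using f'
        by (induction f' rule: fs_induct) (simp_all add: m G F G')
    qed (simp_all add: f')
  qed (simp_all add: g' f')
qed (simp_all add: f g' f')


lemma be_supp_subset:
  assumes "{D. f D \<noteq> \<zero>} \<subseteq> A" "{D. g D \<noteq> \<zero>} \<subseteq> B" "\<And>D E. D \<in> A \<Longrightarrow> E \<in> B \<Longrightarrow> m D E \<in> C"
  shows "{H. be m f g H \<noteq> \<zero>} \<subseteq> C"
  using assms be_supp[of m f g] by blast

section \<open>Morphisms of \<open>TrPD\<close> and its pivotal structure\<close>

definition trpd_coeffs :: "orient list \<Rightarrow> orient list \<Rightarrow> (plane_graph \<Rightarrow> 'a) \<Rightarrow> bool" where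
  "trpd_coeffs a b f \<longleftrightarrow> fs f \<and> {D. f D \<noteq> \<zero>} \<subseteq> {D. trpd_graph a b D}"

lemma coeffs_fs [simp]: "trpd_coeffs a b f \<Longrightarrow> fs f"
  by (simp add: trpd_coeffs_def)

lemma coeffs_zero [simp]: "trpd_coeffs a b (\<lambda>_. \<zero>)"
  by (simp add: trpd_coeffs_def)

lemma coeffs_indic [simp]: "trpd_graph a b D \<Longrightarrow> trpd_coeffs a b (indic R D)"
  using indic_supp[of D] by (auto simp: trpd_coeffs_def)

lemma coeffs_add [simp]:
  assumes f: "trpd_coeffs a b f" and g: "trpd_coeffs a b g"
  shows "trpd_coeffs a b (\<lambda>D. f D \<oplus> g D)"
  unfolding trpd_coeffs_def
proof (intro conjI subsetI)
  show "fs (\<lambda>D. f D \<oplus> g D)" using f g by simp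
  fix D assume "D \<in> {D. f D \<oplus> g D \<noteq> \<zero>}"
  then have "f D \<noteq> \<zero> \<or> g D \<noteq> \<zero>" by auto
  then show "D \<in> {D. trpd_graph a b D}"
    using f g unfolding trpd_coeffs_def by blast
qed

lemma coeffs_smult [simp]:
  assumes r: "r \<in> carrier R" and f: "trpd_coeffs a b f"
  shows "trpd_coeffs a b (\<lambda>D. r \<otimes> f D)"
  unfolding trpd_coeffs_def
proof (intro conjI subsetI)
  show "fs (\<lambda>D. r \<otimes> f D)" using r f by simp
  fix D assume "D \<in> {D. r \<otimes> f D \<noteq> \<zero>}"
  then have "f D \<noteq> \<zero>" using r by auto
  then show "D \<in> {D. trpd_graph a b D}"
    using f unfolding trpd_coeffs_def by blast
qed

lemma coeffs_uminus [simp]: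
  assumes "trpd_coeffs a b f"
  shows "trpd_coeffs a b (\<lambda>D. \<ominus> f D)"
proof -
  have "(\<lambda>D. \<ominus> f D) = (\<lambda>D. (\<ominus> \<one>) \<otimes> f D)"
    using assms by (simp add: l_minus)
  then show ?thesis using assms by simp
qed

lemma coeffs_stack [simp]:
  "trpd_coeffs a b f \<Longrightarrow> trpd_coeffs b c g \<Longrightarrow> trpd_coeffs a c (be stack g f)"
  unfolding trpd_coeffs_def
  using be_supp_subset[of g "{D. trpd_graph b c D}" f "{D. trpd_graph a b D}" stack] trpd_graph.stack
  by simp

lemma coeffs_juxt [simp]:
  "trpd_coeffs a b f \<Longrightarrow> trpd_coeffs a' b' f' \<Longrightarrow> trpd_coeffs (a @ a') (b @ b') (be juxt f f')"
  unfolding trpd_coeffs_def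
  using be_supp_subset[of f "{D. trpd_graph a b D}" f' "{D. trpd_graph a' b' D}" juxt] trpd_graph.juxt
  by simp

lemma coeffs_induct [consumes 1, case_names zero indic add smult]:
  assumes "trpd_coeffs a b f"
    and "P (\<lambda>_. \<zero>)"
    and "\<And>D. trpd_graph a b D \<Longrightarrow> P (indic R D)"
    and "\<And>f g. \<lbrakk>fs f; fs g; P f; P g\<rbrakk> \<Longrightarrow> P (\<lambda>D. f D \<oplus> g D)"
    and "\<And>r f. \<lbrakk>r \<in> carrier R; fs f; P f\<rbrakk> \<Longrightarrow> P (\<lambda>D. r \<otimes> f D)"
  shows "P f"
proof -
  from assms(1) have "fs f" "{D. f D \<noteq> \<zero>} \<subseteq> {D. trpd_graph a b D}"
    by (simp_all add: trpd_coeffs_def)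
  then show ?thesis
    by (induction f rule: fs_induct) (use assms(2-) in auto)
qed

lemma coeffs_ident_stack [simp]: "trpd_coeffs a b f \<Longrightarrow> be stack (indic R (ident_graph b)) f = f"
  and coeffs_stack_ident [simp]: "trpd_coeffs a b f \<Longrightarrow> be stack f (indic R (ident_graph a)) = f"
  and coeffs_empty_juxt [simp]: "trpd_coeffs a b f \<Longrightarrow> be juxt (indic R (ident_graph [])) f = f"
  and coeffs_juxt_empty [simp]: "trpd_coeffs a b f \<Longrightarrow> be juxt f (indic R (ident_graph [])) = f"
  by (induction f rule: coeffs_induct; simp add: ident_graph_eq trpd_graph_words)+

lemma coeffs_stack_assoc:
  "\<lbrakk>trpd_coeffs a b f; trpd_coeffs b c g; trpd_coeffs c d h\<rbrakk>
    \<Longrightarrow> be stack (be stack h g) f = be stack h (be stack g f)"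
  by (intro be_assoc) (auto intro: coeffs_fs stack_assoc)

lemma coeffs_juxt_assoc:
  "\<lbrakk>trpd_coeffs a b f; trpd_coeffs a' b' g; trpd_coeffs a'' b'' h\<rbrakk>
    \<Longrightarrow> be juxt (be juxt f g) h = be juxt f (be juxt g h)"
  by (intro be_assoc) (auto intro: coeffs_fs)

lemma coeffs_exchange:
  assumes "trpd_coeffs a b f" "trpd_coeffs b c g" "trpd_coeffs a' b' f'" "trpd_coeffs b' c' g'"
  shows "be juxt (be stack g f) (be stack g' f') = be stack (be juxt g g') (be juxt f f')"
  by (rule be_interchange[where A = "{D. trpd_graph b c D}" and B = "{D. trpd_graph a b D}"
      and A' = "{D. trpd_graph b' c' D}" and B' = "{D. trpd_graph a' b' D}"])
    (use assms in \<open>auto simp: trpd_coeffs_def trpd_graph_words intro: pg.interchange\<close>)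

lemma trpd_hom_iff:
  "F \<in> carrier (trpd_hom R a b) \<longleftrightarrow> (\<exists>f. F = (a, b, f) \<and> trpd_coeffs a b f)"
  by (auto simp: trpd_hom_def finitely_supported_def trpd_coeffs_def)

lemma trpd_hom_simps [simp]:
  "(a', b', f) \<in> carrier (trpd_hom R a b) \<longleftrightarrow> a' = a \<and> b' = b \<and> trpd_coeffs a b f"
  "\<zero>\<^bsub>trpd_hom R a b\<^esub> = (a, b, \<lambda>D. \<zero>)"
  "(c, d, f) \<oplus>\<^bsub>trpd_hom R a b\<^esub> (c', d', g) = (a, b, \<lambda>D. f D \<oplus> g D)"
  "r \<odot>\<^bsub>trpd_hom R a b\<^esub> (c, d, f) = (a, b, \<lambda>D. r \<otimes> f D)"
  by (auto simp: trpd_hom_iff) (simp_all add: trpd_hom_def)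

lemma trpd_module: "module R (trpd_hom R a b)"
proof -
  let ?M = "trpd_hom R a b"
  have "abelian_group ?M"
  proof (rule abelian_groupI)
    fix F assume "F \<in> carrier ?M"
    then have "(\<ominus> \<one>) \<odot>\<^bsub>?M\<^esub> F \<in> carrier ?M" "(\<ominus> \<one>) \<odot>\<^bsub>?M\<^esub> F \<oplus>\<^bsub>?M\<^esub> F = \<zero>\<^bsub>?M\<^esub>"
      by (auto simp: trpd_hom_iff l_minus l_neg)
    then show "\<exists>G \<in> carrier ?M. G \<oplus>\<^bsub>?M\<^esub> F = \<zero>\<^bsub>?M\<^esub>" by blast
  qed (auto simp: trpd_hom_iff a_ac)
  then show ?thesis
    using is_cring by (intro moduleI) (auto simp: trpd_hom_iff l_distr r_distr m_assoc)
qed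

lemma TrPD_simps [simp]:
  "Obj (TrPD R) = UNIV" "Hom (TrPD R) = trpd_hom R" "Unit (TrPD R) = []"
  "TensObj (TrPD R) = (@)" "Dual (TrPD R) = (\<lambda>a. rev (map flip a))"
  "Id (TrPD R) = (\<lambda>a. graph_mor R a a (ident_graph a))"
  "Ev (TrPD R) = (\<lambda>a. graph_mor R (a @ rev (map flip a)) [] (ev_graph a))"
  "Coev (TrPD R) = (\<lambda>a. graph_mor R [] (a @ rev (map flip a)) (coev_graph a))"
  "(b', c, g) \<bullet>\<^bsub>TrPD R\<^esub> (a, b, f) = (a, c, be stack g f)"
  "(a, b, f) \<parallel>\<^bsub>TrPD R\<^esub> (a', b', f') = (a @ a', b @ b', be juxt f f')"
  by (simp_all add: TrPD_def)

lemma graph_mor_eq: "graph_mor R a b D = (a, b, indic R D)"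
  by (simp add: graph_mor_def indic_def)

lemma TrPD_linear_monoidal: "linear_monoidal_category R (TrPD R)"
proof -
  have [simp]: "juxt (ident_graph a) (ident_graph b) = ident_graph (a @ b)" for a b
    by (simp add: ident_graph_eq)
  show ?thesis
    using is_cring
    by (intro linear_monoidal_category.intro)
      (auto simp: trpd_hom_iff trpd_module graph_mor_eq trpd_graph.ident coeffs_exchange
        coeffs_juxt_assoc intro: coeffs_stack_assoc)
qed

lemma TrPD_balanced_rigid: "balanced_rigid_category R (TrPD R)"
proof -
  interpret linear_monoidal_category R "TrPD R" by (rule TrPD_linear_monoidal)
  note graph_eqs = graph_mor_eq ident_graph_eq ev_graph_eq coev_graph_eq word_dual
  \<comment> \<open>Both transposes are linear in \<open>F\<close>, so the claim reduces to single
    graphs, where it is \<open>trpd_graph_balanced\<close>.\<close>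
  have bal: "left_transpose (TrPD R) a b F = right_transpose (TrPD R) a b F"
    if F: "F \<in> carrier (trpd_hom R a b)" for a b F
  proof -
    obtain f where f: "F = (a, b, f)" "trpd_coeffs a b f" using F by (auto simp: trpd_hom_iff)
    show ?thesis using f(2) unfolding f(1) left_transpose_def right_transpose_def
    proof (induction f rule: coeffs_induct)
      case (indic D)
      then show ?case
        using trpd_graph_balanced[of a b D] trpd_graph_words[of a b D]
        by (simp add: graph_eqs pg.balanced_def pg.rho_def pg.lam_def stack_assoc)
    qed (simp_all add: graph_mor_eq)
  qed
  have dd: "rev (map flip (rev (map flip a))) = a" for a
    by (simp add: rev_map comp_def)
  have z: "stack (juxt (ev_graph a) (ident_graph a)) (juxt (ident_graph a) (coev_graph (rev (map flip a)))) = ident_graph a"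
    "stack (juxt (ident_graph a) (ev_graph (rev (map flip a)))) (juxt (coev_graph a) (ident_graph a)) = ident_graph a"
    for a using zigzag_words[of "word a"] by (simp_all add: graph_eqs)
  have t: "ev_graph (a @ b) = stack (ev_graph a) (juxt (juxt (ident_graph a) (ev_graph b)) (ident_graph (rev (map flip a))))"
    "coev_graph (a @ b) = stack (juxt (juxt (ident_graph a) (coev_graph b)) (ident_graph (rev (map flip a)))) (coev_graph a)"
    for a b by (simp_all add: graph_eqs cap_graph_append cup_graph_append)
  have e: "ev_graph [] = ident_graph []" "coev_graph [] = ident_graph []"
    by (simp_all add: graph_eqs)
  show ?thesis
  proof unfold_locales
    fix a b :: "orient list" and f :: "'a trpd_mor"
    show "Ev (TrPD R) a \<in> carrier (Hom (TrPD R) (a \<cdot>\<^bsub>TrPD R\<^esub> Dual (TrPD R) a) (Unit (TrPD R)))"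
      "Coev (TrPD R) a \<in> carrier (Hom (TrPD R) (Unit (TrPD R)) (a \<cdot>\<^bsub>TrPD R\<^esub> Dual (TrPD R) a))"
      by (simp_all add: graph_mor_eq trpd_ev trpd_coev)
    assume "f \<in> carrier (Hom (TrPD R) a b)"
    then show "left_transpose (TrPD R) a b f = right_transpose (TrPD R) a b f"
      by (simp add: bal)
  qed (simp_all add: graph_mor_eq z dd t e)
qed

end

section \<open>Quotients by tensor ideals\<close>

context linear_monoidal_category
begin

text \<open>As hom-modules are disjoint, a morphism determines its source and target. This replaces
  the object parameters of the axioms by side conditions that rewriting can discharge.\<close>

definition arr where
  "arr f \<longleftrightarrow> (\<exists>a \<in> Obj C. \<exists>b \<in> Obj C. f \<in> carrier (Hom C a b))"

definition src where
  "src f = (THE a. a \<in> Obj C \<and> (\<exists>b \<in> Obj C. f \<in> carrier (Hom C a b)))"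

definition tgt where
  "tgt f = (THE b. b \<in> Obj C \<and> (\<exists>a \<in> Obj C. f \<in> carrier (Hom C a b)))"

lemma hom_iff:
  assumes "a \<in> Obj C" "b \<in> Obj C"
  shows "f \<in> carrier (Hom C a b) \<longleftrightarrow> arr f \<and> src f = a \<and> tgt f = b"
proof -
  have *: "arr f \<and> src f = a \<and> tgt f = b"
    if "a \<in> Obj C" "b \<in> Obj C" "f \<in> carrier (Hom C a b)" for a b
    using that hom_disjoint unfolding arr_def src_def tgt_def by (blast intro!: the_equality)
  show ?thesis
  proof
    assume f: "arr f \<and> src f = a \<and> tgt f = b"
    then obtain a' b' where ab: "a' \<in> Obj C" "b' \<in> Obj C" "f \<in> carrier (Hom C a' b')"
      unfolding arr_def by blast
    from *[OF this] f ab show "f \<in> carrier (Hom C a b)" by simp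
  qed (use * assms in blast)
qed

lemma arr_obj [simp]:
  assumes "arr f"
  shows "src f \<in> Obj C" "tgt f \<in> Obj C"
proof -
  obtain a b where ab: "a \<in> Obj C" "b \<in> Obj C" "f \<in> carrier (Hom C a b)"
    using assms unfolding arr_def by blast
  then have "src f = a" "tgt f = b" using hom_iff[OF ab(1,2)] by simp_all
  then show "src f \<in> Obj C" "tgt f \<in> Obj C" using ab by simp_all
qed

lemma hom_srctgt: "arr f \<Longrightarrow> src f = a \<Longrightarrow> tgt f = b \<Longrightarrow> f \<in> carrier (Hom C a b)"
  using hom_iff[of a b f] by auto

lemma arr_Id [simp]: "a \<in> Obj C \<Longrightarrow> arr (Id C a)" "a \<in> Obj C \<Longrightarrow> src (Id C a) = a"
  "a \<in> Obj C \<Longrightarrow> tgt (Id C a) = a"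
  using id_closed[of a] by (simp_all add: hom_iff)

lemma arr_Comp [simp]:
  assumes "arr g" "arr f" "src g = tgt f"
  shows "arr (g \<bullet> f)" "src (g \<bullet> f) = src f" "tgt (g \<bullet> f) = tgt g"
  using comp_closed[of "src f" "tgt f" "tgt g" f g] assms by (simp_all add: hom_iff)

lemma arr_Tens [simp]:
  assumes "arr g" "arr f"
  shows "arr (f \<parallel> g)" "src (f \<parallel> g) = src f \<cdot> src g" "tgt (f \<parallel> g) = tgt f \<cdot> tgt g"
  using tens_closed[of "src f" "tgt f" "src g" "tgt g" f g] assms by (simp_all add: hom_iff tens_obj)

lemma arr_add [simp]:
  assumes "arr f" "arr g" "src f = a" "tgt f = b" "src g = a" "tgt g = b"
  shows "arr (f \<oplus>\<^bsub>Hom C a b\<^esub> g)" "src (f \<oplus>\<^bsub>Hom C a b\<^esub> g) = a" "tgt (f \<oplus>\<^bsub>Hom C a b\<^esub> g) = b"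
proof -
  have ab: "a \<in> Obj C" "b \<in> Obj C" using assms by auto
  interpret M: module R "Hom C a b" using ab by (rule hom_module)
  show "arr (f \<oplus>\<^bsub>Hom C a b\<^esub> g)" "src (f \<oplus>\<^bsub>Hom C a b\<^esub> g) = a" "tgt (f \<oplus>\<^bsub>Hom C a b\<^esub> g) = b"
    using M.a_closed[of f g] assms by (simp_all add: hom_iff[OF ab])
qed

lemma arr_smult [simp]:
  assumes "r \<in> carrier R" "arr f" "src f = a" "tgt f = b"
  shows "arr (r \<odot>\<^bsub>Hom C a b\<^esub> f)" "src (r \<odot>\<^bsub>Hom C a b\<^esub> f) = a" "tgt (r \<odot>\<^bsub>Hom C a b\<^esub> f) = b"
proof -
  have ab: "a \<in> Obj C" "b \<in> Obj C" using assms by auto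
  interpret M: module R "Hom C a b" using ab by (rule hom_module)
  show "arr (r \<odot>\<^bsub>Hom C a b\<^esub> f)" "src (r \<odot>\<^bsub>Hom C a b\<^esub> f) = a" "tgt (r \<odot>\<^bsub>Hom C a b\<^esub> f) = b"
    using M.smult_closed[of r f] assms by (simp_all add: hom_iff[OF ab])
qed

lemma Id_Comp: "arr f \<Longrightarrow> tgt f = b \<Longrightarrow> Id C b \<bullet> f = f"
  and Comp_Id: "arr f \<Longrightarrow> src f = a \<Longrightarrow> f \<bullet> Id C a = f"
  and Id_Tens: "arr f \<Longrightarrow> Id C (Unit C) \<parallel> f = f"
  and Tens_Id: "arr f \<Longrightarrow> f \<parallel> Id C (Unit C) = f"
  using id_comp[of "src f" "tgt f" f] comp_id[of "src f" "tgt f" f]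
    unit_tens[of "src f" "tgt f" f] tens_unit[of "src f" "tgt f" f] by (auto simp: hom_iff)

lemma Comp_assoc:
  "\<lbrakk>arr h; arr g; arr f; src h = tgt g; src g = tgt f\<rbrakk> \<Longrightarrow> h \<bullet> g \<bullet> f = h \<bullet> (g \<bullet> f)"
  by (rule comp_assoc[of "src f" "tgt f" "tgt g" "tgt h"]) (auto simp: hom_iff)

lemma Tens_assoc: "\<lbrakk>arr h; arr g; arr f\<rbrakk> \<Longrightarrow> h \<parallel> g \<parallel> f = h \<parallel> (g \<parallel> f)"
  by (rule tens_assoc[of "src h" "tgt h" "src g" "tgt g" "src f" "tgt f"]) (auto simp: hom_iff)

lemma Interchange:
  "\<lbrakk>arr g; arr f; arr g'; arr f'; src g = tgt f; src g' = tgt f'\<rbrakk>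
    \<Longrightarrow> (g \<bullet> f) \<parallel> (g' \<bullet> f') = (g \<parallel> g') \<bullet> (f \<parallel> f')"
  by (rule interchange[of "src f" "tgt f" "tgt g" "src f'" "tgt f'" "tgt g'"]) (auto simp: hom_iff)

lemma Comp_add:
  "\<lbrakk>arr g; arr g'; arr f; src g = tgt f; src g' = src g; tgt g' = tgt g; src g = b; tgt g = c\<rbrakk>
    \<Longrightarrow> (g \<oplus>\<^bsub>Hom C b c\<^esub> g') \<bullet> f = (g \<bullet> f) \<oplus>\<^bsub>Hom C (src f) (tgt g)\<^esub> (g' \<bullet> f)"
  "\<lbrakk>arr f; arr f'; arr g; src g = tgt f; src f' = src f; tgt f' = tgt f; src f = a; tgt f = b\<rbrakk>
    \<Longrightarrow> g \<bullet> (f \<oplus>\<^bsub>Hom C a b\<^esub> f') = (g \<bullet> f) \<oplus>\<^bsub>Hom C (src f) (tgt g)\<^esub> (g \<bullet> f')"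
  using comp_add_left[of "src f" "tgt f" "tgt g" f g g'] comp_add_right[of "src f" "tgt f" "tgt g" f f' g]
  by (auto simp: hom_iff)

lemma Comp_smult:
  "\<lbrakk>r \<in> carrier R; arr g; arr f; src g = tgt f; src g = b; tgt g = c\<rbrakk>
    \<Longrightarrow> (r \<odot>\<^bsub>Hom C b c\<^esub> g) \<bullet> f = r \<odot>\<^bsub>Hom C (src f) (tgt g)\<^esub> (g \<bullet> f)"
  "\<lbrakk>r \<in> carrier R; arr f; arr g; src g = tgt f; src f = a; tgt f = b\<rbrakk>
    \<Longrightarrow> g \<bullet> (r \<odot>\<^bsub>Hom C a b\<^esub> f) = r \<odot>\<^bsub>Hom C (src f) (tgt g)\<^esub> (g \<bullet> f)"
  using comp_smult_left[of r "src f" "tgt f" "tgt g" f g] comp_smult_right[of r "src f" "tgt f" "tgt g" f g]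
  by (auto simp: hom_iff)

lemma Tens_add:
  "\<lbrakk>arr f; arr g; arr h; src g = src f; tgt g = tgt f; src f = a; tgt f = b\<rbrakk>
    \<Longrightarrow> (f \<oplus>\<^bsub>Hom C a b\<^esub> g) \<parallel> h = (f \<parallel> h) \<oplus>\<^bsub>Hom C (src f \<cdot> src h) (tgt f \<cdot> tgt h)\<^esub> (g \<parallel> h)"
  "\<lbrakk>arr f; arr g; arr h; src g = src f; tgt g = tgt f; src f = a; tgt f = b\<rbrakk>
    \<Longrightarrow> h \<parallel> (f \<oplus>\<^bsub>Hom C a b\<^esub> g) = (h \<parallel> f) \<oplus>\<^bsub>Hom C (src h \<cdot> src f) (tgt h \<cdot> tgt f)\<^esub> (h \<parallel> g)"
  using tens_add_left[of "src f" "tgt f" "src h" "tgt h" f g h]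
    tens_add_right[of "src h" "tgt h" "src f" "tgt f" h f g]
  by (auto simp: hom_iff)

lemma Tens_smult:
  "\<lbrakk>r \<in> carrier R; arr f; arr h; src f = a; tgt f = b\<rbrakk>
    \<Longrightarrow> (r \<odot>\<^bsub>Hom C a b\<^esub> f) \<parallel> h = r \<odot>\<^bsub>Hom C (src f \<cdot> src h) (tgt f \<cdot> tgt h)\<^esub> (f \<parallel> h)"
  "\<lbrakk>r \<in> carrier R; arr f; arr h; src f = a; tgt f = b\<rbrakk>
    \<Longrightarrow> h \<parallel> (r \<odot>\<^bsub>Hom C a b\<^esub> f) = r \<odot>\<^bsub>Hom C (src h \<cdot> src f) (tgt h \<cdot> tgt f)\<^esub> (h \<parallel> f)"
  using tens_smult_left[of r "src f" "tgt f" "src h" "tgt h" f h]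
    tens_smult_right[of r "src h" "tgt h" "src f" "tgt f" h f]
  by (auto simp: hom_iff)

end

locale ideal_quotient = linear_monoidal_category R C + tensor_ideal R C I
  for R :: "('r, 's) ring_scheme" and C :: "('o, 'm, 'r) lin_cat" (structure) and I
begin

abbreviation cl :: "'m \<Rightarrow> 'm set" where "cl \<equiv> ideal_class C I"
abbreviation Q :: "('o, 'm set, 'r) lin_cat" where "Q \<equiv> quotient_category C I"
abbreviation ideal_hom :: "'o \<Rightarrow> 'o \<Rightarrow> 'm set" where "ideal_hom a b \<equiv> I \<inter> carrier (Hom C a b)"

lemma ideal_hom_closed:
  assumes "a \<in> Obj C" "b \<in> Obj C"
  shows "i \<in> ideal_hom a b \<Longrightarrow> j \<in> ideal_hom a b \<Longrightarrow> i \<oplus>\<^bsub>Hom C a b\<^esub> j \<in> ideal_hom a b"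
    and "i \<in> ideal_hom a b \<Longrightarrow> \<ominus>\<^bsub>Hom C a b\<^esub> i \<in> ideal_hom a b"
    and "r \<in> carrier R \<Longrightarrow> i \<in> ideal_hom a b \<Longrightarrow> r \<odot>\<^bsub>Hom C a b\<^esub> i \<in> ideal_hom a b"
    and "\<zero>\<^bsub>Hom C a b\<^esub> \<in> ideal_hom a b"
  using module.submoduleE[OF hom_module ideal_submodule, OF assms assms]
    subgroup.one_closed[OF submodule.axioms(1)[OF ideal_submodule[OF assms]]] by auto

text \<open>Disjointness of the hom-modules makes the objects in \<open>ideal_class\<close> unique,
  so the class is a coset of the ideal in one hom-module.\<close>

lemma cl_eq:
  assumes "f \<in> carrier (Hom C a b)" "a \<in> Obj C" "b \<in> Obj C"
  shows "cl f = (\<lambda>i. f \<oplus>\<^bsub>Hom C a b\<^esub> i) ` ideal_hom a b"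
proof -
  interpret M: module R "Hom C a b" using assms hom_module by simp
  have "cl f = {g \<in> carrier (Hom C a b). g \<ominus>\<^bsub>Hom C a b\<^esub> f \<in> I}"
    unfolding ideal_class_def using assms hom_disjoint by blast
  also have "\<dots> = (\<lambda>i. f \<oplus>\<^bsub>Hom C a b\<^esub> i) ` ideal_hom a b"
  proof (intro equalityI subsetI)
    fix g assume "g \<in> {g \<in> carrier (Hom C a b). g \<ominus>\<^bsub>Hom C a b\<^esub> f \<in> I}"
    moreover from this have "g = f \<oplus>\<^bsub>Hom C a b\<^esub> (g \<ominus>\<^bsub>Hom C a b\<^esub> f)"
      using assms by (simp add: a_minus_def M.a_lcomm[of f g] M.r_neg)
    ultimately show "g \<in> (\<lambda>i. f \<oplus>\<^bsub>Hom C a b\<^esub> i) ` ideal_hom a b"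
      using assms by blast
  next
    fix g assume "g \<in> (\<lambda>i. f \<oplus>\<^bsub>Hom C a b\<^esub> i) ` ideal_hom a b"
    then obtain i where i: "i \<in> ideal_hom a b" "g = f \<oplus>\<^bsub>Hom C a b\<^esub> i" by blast
    then have "g \<ominus>\<^bsub>Hom C a b\<^esub> f = i"
      using assms by (simp add: a_minus_def M.a_comm[of f i] M.a_assoc M.r_neg)
    then show "g \<in> {g \<in> carrier (Hom C a b). g \<ominus>\<^bsub>Hom C a b\<^esub> f \<in> I}"
      using i assms by simp
  qed
  finally show ?thesis .
qed

lemma cl_self: "f \<in> carrier (Hom C a b) \<Longrightarrow> a \<in> Obj C \<Longrightarrow> b \<in> Obj C \<Longrightarrow> f \<in> cl f"
  using cl_eq ideal_hom_closed(4) hom_module[THEN module.axioms(2)]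
  by (metis abelian_group.axioms(1) abelian_monoid.r_zero image_eqI)

lemma cl_closed:
  "g \<in> cl f \<Longrightarrow> f \<in> carrier (Hom C a b) \<Longrightarrow> a \<in> Obj C \<Longrightarrow> b \<in> Obj C \<Longrightarrow> g \<in> carrier (Hom C a b)"
  unfolding ideal_class_def using hom_disjoint by blast

lemma cl_add_ideal:
  assumes "f \<in> carrier (Hom C a b)" "i \<in> ideal_hom a b" "a \<in> Obj C" "b \<in> Obj C"
  shows "cl (f \<oplus>\<^bsub>Hom C a b\<^esub> i) = cl f"
proof -
  interpret M: module R "Hom C a b" using assms hom_module by simp
  have "(\<lambda>j. f \<oplus>\<^bsub>Hom C a b\<^esub> i \<oplus>\<^bsub>Hom C a b\<^esub> j) ` ideal_hom a b = (\<lambda>i. f \<oplus>\<^bsub>Hom C a b\<^esub> i) ` ideal_hom a b"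
  proof (intro equalityI subsetI; elim imageE)
    fix g j assume "j \<in> ideal_hom a b" "g = f \<oplus>\<^bsub>Hom C a b\<^esub> i \<oplus>\<^bsub>Hom C a b\<^esub> j"
    then show "g \<in> (\<lambda>i. f \<oplus>\<^bsub>Hom C a b\<^esub> i) ` ideal_hom a b"
      using assms ideal_hom_closed(1)[of a b i j]
      by (intro image_eqI[of _ _ "i \<oplus>\<^bsub>Hom C a b\<^esub> j"]) (auto simp: M.a_assoc)
  next
    fix g j assume "j \<in> ideal_hom a b" "g = f \<oplus>\<^bsub>Hom C a b\<^esub> j"
    then show "g \<in> (\<lambda>j. f \<oplus>\<^bsub>Hom C a b\<^esub> i \<oplus>\<^bsub>Hom C a b\<^esub> j) ` ideal_hom a b"
      using assms ideal_hom_closed(1)[of a b "\<ominus>\<^bsub>Hom C a b\<^esub> i" j] ideal_hom_closed(2)[of a b i]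
      by (intro image_eqI[of _ _ "\<ominus>\<^bsub>Hom C a b\<^esub> i \<oplus>\<^bsub>Hom C a b\<^esub> j"]) (auto simp: M.a_assoc M.r_neg2)
  qed
  then show ?thesis
    using assms by (simp add: cl_eq[of _ a b])
qed

lemma cl_eqI:
  assumes "f \<in> carrier (Hom C a b)" "g \<in> carrier (Hom C a b)" "f \<ominus>\<^bsub>Hom C a b\<^esub> g \<in> I" "a \<in> Obj C" "b \<in> Obj C"
  shows "cl f = cl g"
proof -
  interpret M: module R "Hom C a b" using assms hom_module by simp
  have "g \<oplus>\<^bsub>Hom C a b\<^esub> (f \<ominus>\<^bsub>Hom C a b\<^esub> g) = f"
    using assms by (simp add: a_minus_def M.a_lcomm[of g f] M.r_neg)
  then show ?thesis
    using cl_add_ideal[of g a b "f \<ominus>\<^bsub>Hom C a b\<^esub> g"] assms by simp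
qed

text \<open>The operations of the quotient are unions over representatives. If the value is constant
  on a coset, the union collapses to it, because the coset contains \<open>f\<close>.\<close>

lemma UN_cl:
  assumes "f \<in> carrier (Hom C a b)" "a \<in> Obj C" "b \<in> Obj C"
    and "\<And>i. i \<in> ideal_hom a b \<Longrightarrow> \<phi> (f \<oplus>\<^bsub>Hom C a b\<^esub> i) = \<phi> f"
  shows "(\<Union>x \<in> cl f. \<phi> x) = \<phi> f"
proof -
  have "\<phi> x = \<phi> f" if "x \<in> cl f" for x
    using that assms(4) unfolding cl_eq[OF assms(1-3)] by blast
  then show ?thesis using cl_self[OF assms(1-3)] by blast
qed

text \<open>Changing either factor by an element of the ideal changes the composite by an element of
  the ideal; the two unions are collapsed one after the other.\<close>

lemma Q_comp:
  assumes "f \<in> carrier (Hom C a b)" "g \<in> carrier (Hom C b c)" "a \<in> Obj C" "b \<in> Obj C" "c \<in> Obj C"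
  shows "cl g \<bullet>\<^bsub>Q\<^esub> cl f = cl (g \<bullet> f)"
proof -
  have "(\<Union>x \<in> cl f. cl (g' \<bullet> x)) = cl (g' \<bullet> f)" if "g' \<in> carrier (Hom C b c)" for g'
    using assms that
    by (intro UN_cl[of f a b]) (auto simp: comp_add_right[of a b c] cl_add_ideal[of _ a c] ideal_comp_left comp_closed[of a b c])
  moreover have "(\<Union>y \<in> cl g. cl (y \<bullet> f)) = cl (g \<bullet> f)"
    using assms
    by (intro UN_cl[of g b c]) (auto simp: comp_add_left[of a b c] cl_add_ideal[of _ a c] ideal_comp_right comp_closed[of a b c])
  ultimately show ?thesis
    using assms cl_closed[of _ g b c] by (simp add: quotient_category_def cong: SUP_cong)
qed

lemma Q_tens:
  assumes "f \<in> carrier (Hom C a b)" "g \<in> carrier (Hom C a' b')"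
    "a \<in> Obj C" "b \<in> Obj C" "a' \<in> Obj C" "b' \<in> Obj C"
  shows "cl f \<parallel>\<^bsub>Q\<^esub> cl g = cl (f \<parallel> g)"
proof -
  have "(\<Union>x \<in> cl g. cl (f' \<parallel> x)) = cl (f' \<parallel> g)" if "f' \<in> carrier (Hom C a b)" for f'
    using assms that
    by (intro UN_cl[of g a' b'])
      (auto simp: tens_add_right[of a b a' b'] cl_add_ideal[of _ "a \<cdot> a'" "b \<cdot> b'"]
        tens_obj ideal_tens_left tens_closed[of a b a' b'])
  moreover have "(\<Union>y \<in> cl f. cl (y \<parallel> g)) = cl (f \<parallel> g)"
    using assms
    by (intro UN_cl[of f a b])
      (auto simp: tens_add_left[of a b a' b'] cl_add_ideal[of _ "a \<cdot> a'" "b \<cdot> b'"]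
        tens_obj ideal_tens_right tens_closed[of a b a' b'])
  ultimately show ?thesis
    using assms cl_closed[of _ f a b] by (simp add: quotient_category_def cong: SUP_cong)
qed

lemma Q_add:
  assumes "f \<in> carrier (Hom C a b)" "g \<in> carrier (Hom C a b)" "a \<in> Obj C" "b \<in> Obj C"
  shows "cl f \<oplus>\<^bsub>Hom Q a b\<^esub> cl g = cl (f \<oplus>\<^bsub>Hom C a b\<^esub> g)"
proof -
  interpret M: module R "Hom C a b" using assms hom_module by simp
  have "(\<Union>x \<in> cl g. cl (f' \<oplus>\<^bsub>Hom C a b\<^esub> x)) = cl (f' \<oplus>\<^bsub>Hom C a b\<^esub> g)" if "f' \<in> carrier (Hom C a b)" for f'
    using assms that
    by (intro UN_cl[of g a b]) (auto simp: M.a_assoc[symmetric] cl_add_ideal)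
  moreover have "(\<Union>y \<in> cl f. cl (y \<oplus>\<^bsub>Hom C a b\<^esub> g)) = cl (f \<oplus>\<^bsub>Hom C a b\<^esub> g)"
    using assms M.a_comm[of _ g]
    by (intro UN_cl[of f a b]) (auto simp: M.a_assoc[symmetric] cl_add_ideal)
  ultimately show ?thesis
    using assms cl_closed[of _ f a b]
    by (simp add: quotient_category_def quotient_module_def cong: SUP_cong)
qed

lemma Q_smult:
  assumes "f \<in> carrier (Hom C a b)" "r \<in> carrier R" "a \<in> Obj C" "b \<in> Obj C"
  shows "r \<odot>\<^bsub>Hom Q a b\<^esub> cl f = cl (r \<odot>\<^bsub>Hom C a b\<^esub> f)"
proof -
  interpret M: module R "Hom C a b" using assms hom_module by simp
  have "(\<Union>x \<in> cl f. cl (r \<odot>\<^bsub>Hom C a b\<^esub> x)) = cl (r \<odot>\<^bsub>Hom C a b\<^esub> f)"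
    using assms ideal_hom_closed(3)[of a b r]
    by (intro UN_cl[of f a b]) (auto simp: M.smult_r_distr cl_add_ideal)
  then show ?thesis
    by (simp add: quotient_category_def quotient_module_def)
qed

lemma Q_hom_iff: "F \<in> carrier (Hom Q a b) \<longleftrightarrow> (\<exists>f \<in> carrier (Hom C a b). F = cl f)"
  by (auto simp: quotient_category_def quotient_module_def)

lemma Q_simps [simp]:
  "Obj Q = Obj C" "Unit Q = Unit C" "TensObj Q = TensObj C" "Dual Q = Dual C"
  "Id Q a = cl (Id C a)" "Ev Q a = cl (Ev C a)" "Coev Q a = cl (Coev C a)"
  "\<zero>\<^bsub>Hom Q a b\<^esub> = cl \<zero>\<^bsub>Hom C a b\<^esub>"
  by (simp_all add: quotient_category_def quotient_module_def)

lemma Q_module: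
  assumes ab: "a \<in> Obj C" "b \<in> Obj C"
  shows "module R (Hom Q a b)"
proof -
  interpret M: module R "Hom C a b" using ab hom_module by simp
  have "abelian_group (Hom Q a b)"
  proof (rule abelian_groupI)
    fix F assume "F \<in> carrier (Hom Q a b)"
    then obtain f where f: "f \<in> carrier (Hom C a b)" "F = cl f" by (auto simp: Q_hom_iff)
    then have "cl (\<ominus>\<^bsub>Hom C a b\<^esub> f) \<oplus>\<^bsub>Hom Q a b\<^esub> F = \<zero>\<^bsub>Hom Q a b\<^esub>"
      using ab by (simp add: Q_add M.l_neg)
    then show "\<exists>G \<in> carrier (Hom Q a b). G \<oplus>\<^bsub>Hom Q a b\<^esub> F = \<zero>\<^bsub>Hom Q a b\<^esub>"
      using f by (intro bexI[of _ "cl (\<ominus>\<^bsub>Hom C a b\<^esub> f)"]) (auto simp: Q_hom_iff)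
  qed (use ab in \<open>auto simp: Q_hom_iff Q_add M.a_ac\<close>)
  then show ?thesis
    using base_ring ab
    by (intro moduleI) (auto simp: Q_hom_iff Q_add Q_smult M.smult_l_distr M.smult_r_distr M.smult_assoc1)
qed

text \<open>A class contains its representative and stays within one hom-module, so disjointness is
  inherited.\<close>

lemma Q_disjoint:
  assumes "a \<in> Obj Q" "b \<in> Obj Q" "a' \<in> Obj Q" "b' \<in> Obj Q"
    and "F \<in> carrier (Hom Q a b)" "F \<in> carrier (Hom Q a' b')"
  shows "a = a' \<and> b = b'"
proof -
  obtain f f' where "f \<in> carrier (Hom C a b)" "f' \<in> carrier (Hom C a' b')" "F = cl f" "F = cl f'"
    using assms by (auto simp: Q_hom_iff)
  moreover from this have "f \<in> carrier (Hom C a' b')"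
    using assms cl_self[of f a b] cl_closed[of f f' a' b'] by simp
  ultimately show ?thesis using assms hom_disjoint by simp
qed

lemma Q_Comp: "\<lbrakk>arr f; arr g; src g = tgt f\<rbrakk> \<Longrightarrow> cl g \<bullet>\<^bsub>Q\<^esub> cl f = cl (g \<bullet> f)"
  by (rule Q_comp[of _ "src f" "tgt f" _ "tgt g"]) (auto simp: hom_iff)

lemma Q_Tens: "\<lbrakk>arr f; arr g\<rbrakk> \<Longrightarrow> cl f \<parallel>\<^bsub>Q\<^esub> cl g = cl (f \<parallel> g)"
  by (rule Q_tens[of _ "src f" "tgt f" _ "src g" "tgt g"]) (auto simp: hom_iff)

lemma Q_Add:
  "\<lbrakk>arr f; arr g; src f = a; src g = a; tgt f = b; tgt g = b\<rbrakk>
    \<Longrightarrow> cl f \<oplus>\<^bsub>Hom Q a b\<^esub> cl g = cl (f \<oplus>\<^bsub>Hom C a b\<^esub> g)"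
  by (rule Q_add) (auto simp: hom_iff)

lemma Q_Smult:
  "\<lbrakk>r \<in> carrier R; arr f; src f = a; tgt f = b\<rbrakk> \<Longrightarrow> r \<odot>\<^bsub>Hom Q a b\<^esub> cl f = cl (r \<odot>\<^bsub>Hom C a b\<^esub> f)"
  by (rule Q_smult) (auto simp: hom_iff)

lemma quotient_linear_monoidal: "linear_monoidal_category R Q"
proof -
  have hom_Q: "F \<in> carrier (Hom Q a b) \<longleftrightarrow> (\<exists>f. F = cl f \<and> arr f \<and> src f = a \<and> tgt f = b)"
    if "a \<in> Obj C" "b \<in> Obj C" for a b F
    using that by (auto simp: Q_hom_iff hom_iff)
  note [simp] = Id_Comp Comp_Id Comp_assoc Id_Tens Tens_Id Tens_assoc Comp_add Comp_smult
    Tens_add Tens_smult Q_Comp Q_Tens Q_Add Q_Smult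
    tens_obj unit_obj tens_obj_assoc unit_tens_obj tens_obj_unit tens_id
  show ?thesis
    by (intro linear_monoidal_category.intro base_ring Q_disjoint, simp_all only: Q_simps)
      (simp_all add: Q_module hom_Q, safe?, simp_all add: Interchange, auto intro: exI[of _ "Id C _"] exI[of _ "_ \<bullet> _"] exI[of _ "_ \<parallel> _"])
qed

end

locale rigid_ideal_quotient = balanced_rigid_category R C + ideal_quotient R C I
  for R :: "('r, 's) ring_scheme" and C :: "('o, 'm, 'r) lin_cat" (structure) and I
begin

lemma arr_Ev [simp]:
  assumes "a \<in> Obj C"
  shows "arr (Ev C a)" "src (Ev C a) = a \<cdot> Dual C a" "tgt (Ev C a) = Unit C"
    and "arr (Coev C a)" "src (Coev C a) = Unit C" "tgt (Coev C a) = a \<cdot> Dual C a"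
  using ev_closed[OF assms] coev_closed[OF assms] assms by (simp_all add: hom_iff tens_obj dual_obj unit_obj)

lemma Q_transpose:
  assumes "arr f" "src f = a" "tgt f = b"
  shows "left_transpose Q a b (cl f) = cl (left_transpose C a b f)"
    and "right_transpose Q a b (cl f) = cl (right_transpose C a b f)"
proof -
  have "a \<in> Obj C" "b \<in> Obj C" using assms by auto
  with assms show "left_transpose Q a b (cl f) = cl (left_transpose C a b f)"
    "right_transpose Q a b (cl f) = cl (right_transpose C a b f)"
    by (simp_all add: left_transpose_def right_transpose_def Q_Comp Q_Tens tens_obj unit_obj dual_obj
        tens_obj_assoc unit_tens_obj tens_obj_unit dual_dual)
qed

lemma quotient_balanced_rigid: "balanced_rigid_category R Q"
proof -
  note [simp] = Q_Comp Q_Tens tens_obj unit_obj dual_obj tens_obj_assoc unit_tens_obj tens_obj_unit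
    dual_dual dual_unit dual_tens
  have "left_transpose Q a b F = right_transpose Q a b F"
    if "a \<in> Obj C" "b \<in> Obj C" "F \<in> carrier (Hom Q a b)" for a b F
    using that balanced by (auto simp: Q_hom_iff Q_transpose hom_iff)
  then show ?thesis
    using quotient_linear_monoidal
    by (intro balanced_rigid_category.intro balanced_rigid_category_axioms.intro)
      (auto simp: zigzag_left zigzag_right ev_unit coev_unit ev_tens coev_tens Q_hom_iff
        intro!: exI ev_closed coev_closed)
qed

end

text \<open>The set of all morphisms is a tensor ideal containing \<open>E\<close>. So the family
  being intersected is nonempty, and its intersection consists of morphisms.\<close>

lemma (in linear_monoidal_category) generated_tensor_ideal:
  assumes E: "E \<subseteq> (\<Union>a \<in> Obj C. \<Union>b \<in> Obj C. carrier (Hom C a b))"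
  shows "tensor_ideal R C (generated_tensor_ideal R C E)" "E \<subseteq> generated_tensor_ideal R C E"
proof -
  let ?I = "\<Union>a \<in> Obj C. \<Union>b \<in> Obj C. carrier (Hom C a b)"
  let ?J = "{I. tensor_ideal R C I \<and> E \<subseteq> I}"
  have inter: "?I \<inter> carrier (Hom C a b) = carrier (Hom C a b)" if "a \<in> Obj C" "b \<in> Obj C" for a b
    using that by blast
  have memI: "f \<in> ?I" if "a \<in> Obj C" "b \<in> Obj C" "f \<in> carrier (Hom C a b)" for a b f
    using that by blast
  have full: "?I \<in> ?J"
  proof (intro CollectI conjI E tensor_ideal.intro)
    show "submodule (?I \<inter> carrier (Hom C a b)) R (Hom C a b)" if "a \<in> Obj C" "b \<in> Obj C" for a b
      using that module.carrier_is_submodule[OF hom_module] by (simp only: inter)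
    show "g \<bullet> f \<in> ?I" if "a \<in> Obj C" "b \<in> Obj C" "c \<in> Obj C"
      "f \<in> ?I \<inter> carrier (Hom C a b)" "g \<in> carrier (Hom C b c)" for a b c f g
      using that by (intro memI[OF _ _ comp_closed[of a b c]]) auto
    show "g \<bullet> f \<in> ?I" if "a \<in> Obj C" "b \<in> Obj C" "c \<in> Obj C"
      "f \<in> carrier (Hom C a b)" "g \<in> ?I \<inter> carrier (Hom C b c)" for a b c f g
      using that by (intro memI[OF _ _ comp_closed[of a b c]]) auto
    show "f \<parallel> g \<in> ?I" if "a \<in> Obj C" "b \<in> Obj C" "a' \<in> Obj C" "b' \<in> Obj C"
      "f \<in> carrier (Hom C a b)" "g \<in> ?I \<inter> carrier (Hom C a' b')" for a b a' b' f g
      using that by (intro memI[OF _ _ tens_closed[of a b a' b']] tens_obj) auto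
    show "f \<parallel> g \<in> ?I" if "a \<in> Obj C" "b \<in> Obj C" "a' \<in> Obj C" "b' \<in> Obj C"
      "f \<in> ?I \<inter> carrier (Hom C a b)" "g \<in> carrier (Hom C a' b')" for a b a' b' f g
      using that by (intro memI[OF _ _ tens_closed[of a b a' b']] tens_obj) auto
  qed blast
  have J: "tensor_ideal R C I" if "I \<in> ?J" for I using that by simp
  show "E \<subseteq> generated_tensor_ideal R C E" unfolding generated_tensor_ideal_def by blast
  show "tensor_ideal R C (generated_tensor_ideal R C E)"
    unfolding generated_tensor_ideal_def
  proof (rule tensor_ideal.intro)
    show "\<Inter> ?J \<subseteq> ?I" using full by blast
    show "submodule (\<Inter> ?J \<inter> carrier (Hom C a b)) R (Hom C a b)" if ab: "a \<in> Obj C" "b \<in> Obj C" for a b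
    proof -
      interpret M: module R "Hom C a b" using ab by (rule hom_module)
      have sub: "submodule (I \<inter> carrier (Hom C a b)) R (Hom C a b)" if "I \<in> ?J" for I
        using tensor_ideal.ideal_submodule[OF J[OF that] ab] .
      show ?thesis
      proof (rule M.submoduleI)
        show "\<zero>\<^bsub>Hom C a b\<^esub> \<in> \<Inter> ?J \<inter> carrier (Hom C a b)"
          using subgroup.one_closed[OF submodule.axioms(1)[OF sub]] by auto
      next
        fix f assume "f \<in> \<Inter> ?J \<inter> carrier (Hom C a b)"
        then show "\<ominus>\<^bsub>Hom C a b\<^esub> f \<in> \<Inter> ?J \<inter> carrier (Hom C a b)"
          using M.submoduleE(3)[OF sub] by blast
      next
        fix f g assume "f \<in> \<Inter> ?J \<inter> carrier (Hom C a b)" "g \<in> \<Inter> ?J \<inter> carrier (Hom C a b)"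
        then show "f \<oplus>\<^bsub>Hom C a b\<^esub> g \<in> \<Inter> ?J \<inter> carrier (Hom C a b)"
          using M.submoduleE(5)[OF sub] by blast
      next
        fix r f assume "r \<in> carrier R" "f \<in> \<Inter> ?J \<inter> carrier (Hom C a b)"
        then show "r \<odot>\<^bsub>Hom C a b\<^esub> f \<in> \<Inter> ?J \<inter> carrier (Hom C a b)"
          using M.submoduleE(4)[OF sub] by blast
      qed blast
    qed
  next
    fix a b c f g
    assume "a \<in> Obj C" "b \<in> Obj C" "c \<in> Obj C" "f \<in> \<Inter> ?J \<inter> carrier (Hom C a b)" "g \<in> carrier (Hom C b c)"
    then show "g \<bullet> f \<in> \<Inter> ?J" using tensor_ideal.ideal_comp_left[OF J] by blast
  next
    fix a b c f g
    assume "a \<in> Obj C" "b \<in> Obj C" "c \<in> Obj C" "f \<in> carrier (Hom C a b)" "g \<in> \<Inter> ?J \<inter> carrier (Hom C b c)"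
    then show "g \<bullet> f \<in> \<Inter> ?J" using tensor_ideal.ideal_comp_right[OF J] by blast
  next
    fix a b a' b' f g
    assume "a \<in> Obj C" "b \<in> Obj C" "a' \<in> Obj C" "b' \<in> Obj C"
      "f \<in> carrier (Hom C a b)" "g \<in> \<Inter> ?J \<inter> carrier (Hom C a' b')"
    then show "f \<parallel> g \<in> \<Inter> ?J" using tensor_ideal.ideal_tens_left[OF J] by blast
  next
    fix a b a' b' f g
    assume "a \<in> Obj C" "b \<in> Obj C" "a' \<in> Obj C" "b' \<in> Obj C"
      "f \<in> \<Inter> ?J \<inter> carrier (Hom C a b)" "g \<in> carrier (Hom C a' b')"
    then show "f \<parallel> g \<in> \<Inter> ?J" using tensor_ideal.ideal_tens_right[OF J] by blast
  qed
qed

section \<open>The Reidemeister moves\<close>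

context monoidal_calculus
begin

text \<open>Composing with \<open>k\<close> at bottom and top cancels \<open>f\<close> on either
  side, where it is the lowest layer on the left and the highest on the right; the inverse crossing
  survives at the opposite ends.\<close>

lemma yang_baxter_swap12:
  assumes [simp]: "arr f" "dm f = x @ y" "cd f = y @ x" "arr g" "dm g = x @ z" "cd g = z @ x"
    "arr h" "dm h = y @ z" "cd h = z @ y" "arr k" "dm k = y @ x" "cd k = x @ y"
    and k: "k \<ast> f = idm (x @ y)" "f \<ast> k = idm (y @ x)"
    and yb: "(h \<star> idm x) \<ast> (idm y \<star> g) \<ast> (f \<star> idm z) = (idm z \<star> f) \<ast> (g \<star> idm y) \<ast> (idm x \<star> h)"
  shows "(g \<star> idm y) \<ast> (idm x \<star> h) \<ast> (k \<star> idm z) = (idm z \<star> k) \<ast> (h \<star> idm x) \<ast> (idm y \<star> g)"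
proof -
  have "(idm z \<star> k) \<ast> (h \<star> idm x) \<ast> (idm y \<star> g)
    = (idm z \<star> k) \<ast> ((h \<star> idm x) \<ast> (idm y \<star> g) \<ast> (f \<star> idm z)) \<ast> (k \<star> idm z)"
    using arg_cong[OF k(2), of "\<lambda>X. X \<star> idm z"] by simp
  also have "\<dots> = (idm z \<star> (k \<ast> f)) \<ast> (g \<star> idm y) \<ast> (idm x \<star> h) \<ast> (k \<star> idm z)"
    unfolding yb by simp
  finally show ?thesis by (simp add: k)
qed

lemma yang_baxter_swap23:
  assumes [simp]: "arr f" "dm f = x @ y" "cd f = y @ x" "arr g" "dm g = x @ z" "cd g = z @ x"
    "arr h" "dm h = y @ z" "cd h = z @ y" "arr k" "dm k = z @ y" "cd k = y @ z"
    and k: "k \<ast> h = idm (y @ z)" "h \<ast> k = idm (z @ y)"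
    and yb: "(h \<star> idm x) \<ast> (idm y \<star> g) \<ast> (f \<star> idm z) = (idm z \<star> f) \<ast> (g \<star> idm y) \<ast> (idm x \<star> h)"
  shows "(k \<star> idm x) \<ast> (idm z \<star> f) \<ast> (g \<star> idm y) = (idm y \<star> g) \<ast> (f \<star> idm z) \<ast> (idm x \<star> k)"
proof -
  have "(k \<star> idm x) \<ast> (idm z \<star> f) \<ast> (g \<star> idm y)
    = (k \<star> idm x) \<ast> ((idm z \<star> f) \<ast> (g \<star> idm y) \<ast> (idm x \<star> h)) \<ast> (idm x \<star> k)"
    using arg_cong[OF k(2), of "\<lambda>X. idm x \<star> X"] by simp
  also have "\<dots> = ((k \<ast> h) \<star> idm x) \<ast> (idm y \<star> g) \<ast> (f \<star> idm z) \<ast> (idm x \<star> k)"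
    unfolding yb[symmetric] by simp
  finally show ?thesis by (simp add: k)
qed

end

text \<open>Both sides are turned along the strand \<open>z\<close>, which passes through
  \<open>g\<close> and \<open>h\<close>; \<open>f\<close> does not touch it and leaves the turn by
  \<open>rho_post\<close> and \<open>rho_pre\<close>.\<close>

lemma (in rigid_calculus) yang_baxter_rho:
  assumes [simp]: "arr f" "dm f = x @ y" "cd f = y @ x" "arr g" "dm g = x @ z" "cd g = z @ x"
    "arr h" "dm h = y @ z" "cd h = z @ y"
    and yb: "(h \<star> idm x) \<ast> (idm y \<star> g) \<ast> (f \<star> idm z) = (idm z \<star> f) \<ast> (g \<star> idm y) \<ast> (idm x \<star> h)"
  shows "(f \<star> idm (dual z)) \<ast> (idm x \<star> rho y z z y h) \<ast> (rho x z z x g \<star> idm y)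
    = (idm y \<star> rho x z z x g) \<ast> (rho y z z y h \<star> idm x) \<ast> (idm (dual z) \<star> f)"
proof -
  have "(f \<star> idm (dual z)) \<ast> (idm x \<star> rho y z z y h) \<ast> (rho x z z x g \<star> idm y)
    = rho (x @ y) z z (y @ x) ((idm z \<star> f) \<ast> (g \<star> idm y) \<ast> (idm x \<star> h))"
    by (subst rho_post[where d = "x @ y"]) (simp_all add: rho_comp)
  also have "\<dots> = rho (x @ y) z z (y @ x) (((h \<star> idm x) \<ast> (idm y \<star> g)) \<ast> (f \<star> idm z))"
    using yb by simp
  also have "\<dots> = (idm y \<star> rho x z z x g) \<ast> (rho y z z y h \<star> idm x) \<ast> (idm (dual z) \<star> f)"
    by (subst rho_pre[where a = "y @ x"]) (simp_all add: rho_comp)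
  finally show ?thesis .
qed

section \<open>Linear combinations of morphisms\<close>

context linear_monoidal_category
begin

text \<open>The hom-module is read off from the summand, so rewriting is not obstructed by different
  spellings of source and target.\<close>

definition plus (infixl \<open>\<uplus>\<close> 57) where
  "f \<uplus> g = f \<oplus>\<^bsub>Hom C (src f) (tgt f)\<^esub> g"

definition scale (infixr \<open>\<diamondop>\<close> 58) where
  "r \<diamondop> f = r \<odot>\<^bsub>Hom C (src f) (tgt f)\<^esub> f"

lemma arr_plus [simp]:
  assumes "arr f" "arr g" "src g = src f" "tgt g = tgt f"
  shows "arr (f \<uplus> g)" "src (f \<uplus> g) = src f" "tgt (f \<uplus> g) = tgt f"
  using assms by (simp_all add: plus_def)

lemma arr_scale [simp]:
  assumes "r \<in> carrier R" "arr f"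
  shows "arr (r \<diamondop> f)" "src (r \<diamondop> f) = src f" "tgt (r \<diamondop> f) = tgt f"
  using assms by (simp_all add: scale_def)

lemma plus_assoc:
  assumes "arr f" "arr g" "arr h" "src g = src f" "tgt g = tgt f" "src h = src f" "tgt h = tgt f"
  shows "f \<uplus> g \<uplus> h = f \<uplus> (g \<uplus> h)"
proof -
  interpret M: module R "Hom C (src f) (tgt f)" using assms by (intro hom_module) auto
  show ?thesis using assms by (simp add: plus_def M.a_assoc hom_srctgt)
qed

lemma plus_comm:
  assumes "arr f" "arr g" "src g = src f" "tgt g = tgt f"
  shows "f \<uplus> g = g \<uplus> f"
proof -
  interpret M: module R "Hom C (src f) (tgt f)" using assms by (intro hom_module) auto
  show ?thesis using assms by (simp add: plus_def M.a_comm hom_srctgt)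
qed

lemma plus_left_comm:
  assumes "arr f" "arr g" "arr h" "src g = src f" "tgt g = tgt f" "src h = src f" "tgt h = tgt f"
  shows "f \<uplus> (g \<uplus> h) = g \<uplus> (f \<uplus> h)"
  using assms plus_assoc[of f g h] plus_assoc[of g f h] plus_comm[of f g] by simp

lemmas plus_ac = plus_assoc plus_comm plus_left_comm

lemma scale_plus:
  assumes "r \<in> carrier R" "arr f" "arr g" "src g = src f" "tgt g = tgt f"
  shows "r \<diamondop> (f \<uplus> g) = r \<diamondop> f \<uplus> r \<diamondop> g"
proof -
  interpret M: module R "Hom C (src f) (tgt f)" using assms by (intro hom_module) auto
  show ?thesis using assms by (simp add: plus_def scale_def M.smult_r_distr hom_srctgt)
qed

lemma scale_scale:
  assumes "r \<in> carrier R" "s \<in> carrier R" "arr f"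
  shows "r \<diamondop> s \<diamondop> f = (r \<otimes>\<^bsub>R\<^esub> s) \<diamondop> f"
proof -
  interpret M: module R "Hom C (src f) (tgt f)" using assms by (intro hom_module) auto
  show ?thesis using assms by (simp add: scale_def M.smult_assoc1 hom_srctgt)
qed

lemma plus_scale:
  assumes "r \<in> carrier R" "s \<in> carrier R" "arr f"
  shows "r \<diamondop> f \<uplus> s \<diamondop> f = (r \<oplus>\<^bsub>R\<^esub> s) \<diamondop> f"
proof -
  interpret M: module R "Hom C (src f) (tgt f)" using assms by (intro hom_module) auto
  show ?thesis using assms by (simp add: plus_def scale_def M.smult_l_distr hom_srctgt)
qed

lemma plus_scale_left:
  assumes "r \<in> carrier R" "s \<in> carrier R" "arr f" "arr g" "src g = src f" "tgt g = tgt f"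
  shows "r \<diamondop> f \<uplus> (s \<diamondop> f \<uplus> g) = (r \<oplus>\<^bsub>R\<^esub> s) \<diamondop> f \<uplus> g"
  using assms by (simp add: plus_assoc[symmetric] plus_scale)

lemma scale_one:
  assumes "arr f"
  shows "\<one>\<^bsub>R\<^esub> \<diamondop> f = f"
proof -
  interpret M: module R "Hom C (src f) (tgt f)" using assms by (intro hom_module) auto
  show ?thesis using assms by (simp add: scale_def hom_srctgt)
qed

lemma plus_scale_zero:
  assumes "arr f" "arr g" "src g = src f" "tgt g = tgt f"
  shows "f \<uplus> \<zero>\<^bsub>R\<^esub> \<diamondop> g = f"
proof -
  interpret M: module R "Hom C (src f) (tgt f)" using assms by (intro hom_module) auto
  show ?thesis using assms by (simp add: scale_def plus_def hom_srctgt)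
qed

lemma comp_plus:
  "\<lbrakk>arr g; arr g'; arr f; src g = tgt f; src g' = src g; tgt g' = tgt g\<rbrakk>
    \<Longrightarrow> (g \<uplus> g') \<bullet> f = (g \<bullet> f) \<uplus> (g' \<bullet> f)"
  "\<lbrakk>arr f; arr f'; arr g; src g = tgt f; src f' = src f; tgt f' = tgt f\<rbrakk>
    \<Longrightarrow> g \<bullet> (f \<uplus> f') = (g \<bullet> f) \<uplus> (g \<bullet> f')"
  by (simp_all add: plus_def Comp_add)

lemma comp_scale:
  "\<lbrakk>r \<in> carrier R; arr g; arr f; src g = tgt f\<rbrakk> \<Longrightarrow> (r \<diamondop> g) \<bullet> f = r \<diamondop> (g \<bullet> f)"
  "\<lbrakk>r \<in> carrier R; arr f; arr g; src g = tgt f\<rbrakk> \<Longrightarrow> g \<bullet> (r \<diamondop> f) = r \<diamondop> (g \<bullet> f)"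
  by (simp_all add: scale_def Comp_smult)

lemma tens_plus:
  "\<lbrakk>arr f; arr g; arr h; src g = src f; tgt g = tgt f\<rbrakk> \<Longrightarrow> (f \<uplus> g) \<parallel> h = (f \<parallel> h) \<uplus> (g \<parallel> h)"
  "\<lbrakk>arr f; arr g; arr h; src g = src f; tgt g = tgt f\<rbrakk> \<Longrightarrow> h \<parallel> (f \<uplus> g) = (h \<parallel> f) \<uplus> (h \<parallel> g)"
  by (simp_all add: plus_def Tens_add)

lemma tens_scale:
  "\<lbrakk>r \<in> carrier R; arr f; arr h\<rbrakk> \<Longrightarrow> (r \<diamondop> f) \<parallel> h = r \<diamondop> (f \<parallel> h)"
  "\<lbrakk>r \<in> carrier R; arr f; arr h\<rbrakk> \<Longrightarrow> h \<parallel> (r \<diamondop> f) = r \<diamondop> (h \<parallel> f)"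
  by (simp_all add: scale_def Tens_smult)

lemmas linear = comp_plus comp_scale tens_plus tens_scale

end

text \<open>Isolates what the crossings need from the quotient: \<open>S\<close> in both
  orientations, exchanged by transposition, the five relations, and of the brackets at n, n-1, n-2,
  here \<open>b\<^sub>0\<close>, \<open>b\<^sub>1\<close>, \<open>b\<^sub>2\<close>, only the three
  scalar identities behind the curls and the bigon.\<close>

locale moy_category = balanced_rigid_category R C
  for R :: "('r, 's) ring_scheme" and C :: "(orient list, 'm, 'r) lin_cat" (structure) +
  fixes S :: "orient \<Rightarrow> 'm" and \<alpha> \<zeta> b\<^sub>0 b\<^sub>1 b\<^sub>2 :: 'r
  assumes Obj_words: "Obj C = UNIV" and Unit_words: "Unit C = []"
    and Tens_words: "TensObj C = (@)" and Dual_words: "Dual C = (\<lambda>a. rev (map flip a))"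
    and S_hom: "S x \<in> carrier (Hom C [x, x] [x, x])"
    and S_transpose: "left_transpose C [x, x] [x, x] (S x) = S (flip x)"
    and scalars: "\<alpha> \<in> Units R" "\<zeta> \<in> Units R" "b\<^sub>0 \<in> carrier R" "b\<^sub>1 \<in> carrier R" "b\<^sub>2 \<in> carrier R"
    and curl_plus: "inv\<^bsub>R\<^esub> \<alpha> \<otimes>\<^bsub>R\<^esub> (inv\<^bsub>R\<^esub> \<zeta> \<otimes>\<^bsub>R\<^esub> b\<^sub>0 \<oplus>\<^bsub>R\<^esub> b\<^sub>1) = \<one>\<^bsub>R\<^esub>"
    and curl_minus: "\<alpha> \<otimes>\<^bsub>R\<^esub> (\<zeta> \<otimes>\<^bsub>R\<^esub> b\<^sub>0 \<oplus>\<^bsub>R\<^esub> b\<^sub>1) = \<one>\<^bsub>R\<^esub>"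
    and bracket_recursion: "b\<^sub>0 \<oplus>\<^bsub>R\<^esub> ((\<zeta> \<oplus>\<^bsub>R\<^esub> inv\<^bsub>R\<^esub> \<zeta>) \<otimes>\<^bsub>R\<^esub> b\<^sub>1 \<oplus>\<^bsub>R\<^esub> b\<^sub>2) = \<zero>\<^bsub>R\<^esub>"
    and circle: "Ev C [x] \<bullet> Coev C [x] = b\<^sub>0 \<odot>\<^bsub>Hom C [] []\<^esub> Id C []"
    and digon: "S x \<bullet> S x = (\<ominus>\<^bsub>R\<^esub> (\<zeta> \<oplus>\<^bsub>R\<^esub> inv\<^bsub>R\<^esub> \<zeta>)) \<odot>\<^bsub>Hom C [x, x] [x, x]\<^esub> S x"
    and bubble: "(Ev C [flip x] \<parallel> Id C [x]) \<bullet> (Id C [flip x] \<parallel> S x) \<bullet> (Coev C [flip x] \<parallel> Id C [x])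
      = b\<^sub>1 \<odot>\<^bsub>Hom C [x] [x]\<^esub> Id C [x]"
    and square:
      "(Id C [x] \<parallel> Ev C [x] \<parallel> Id C [flip x]) \<bullet> (S x \<parallel> S (flip x)) \<bullet> (Id C [x] \<parallel> Coev C [x] \<parallel> Id C [flip x])
      = (Coev C [x] \<bullet> Ev C [x]) \<oplus>\<^bsub>Hom C [x, flip x] [x, flip x]\<^esub>
          (b\<^sub>2 \<odot>\<^bsub>Hom C [x, flip x] [x, flip x]\<^esub> (Id C [x] \<parallel> Id C [flip x]))"
    and hexagon:
      "((S x \<parallel> Id C [x]) \<bullet> (Id C [x] \<parallel> S x) \<bullet> (S x \<parallel> Id C [x])) \<oplus>\<^bsub>Hom C [x, x, x] [x, x, x]\<^esub> (Id C [x] \<parallel> S x)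
      = ((Id C [x] \<parallel> S x) \<bullet> (S x \<parallel> Id C [x]) \<bullet> (Id C [x] \<parallel> S x)) \<oplus>\<^bsub>Hom C [x, x, x] [x, x, x]\<^esub> (S x \<parallel> Id C [x])"
begin

sublocale cring R by (rule base_ring)

declare Obj_words [simp] Unit_words [simp] Tens_words [simp]

abbreviation dualw :: "orient list \<Rightarrow> orient list" where
  "dualw a \<equiv> rev (map flip a)"

lemma dualw_dualw [simp]: "dualw (dualw a) = a"
  by (simp add: rev_map comp_def)

lemma arr_ev [simp]: "arr (Ev C a)" "src (Ev C a) = a @ dualw a" "tgt (Ev C a) = []"
  and arr_coev [simp]: "arr (Coev C a)" "src (Coev C a) = []" "tgt (Coev C a) = a @ dualw a"
  using ev_closed[of a] coev_closed[of a]
  by (simp_all add: hom_iff Obj_words Unit_words Tens_words Dual_words)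

sublocale K: rigid_calculus arr src tgt "Id C" "Comp C" "TensMor C" dualw "Ev C" "Coev C"
proof
  fix f assume "arr f"
  then show "Id C [] \<parallel> f = f" "f \<parallel> Id C [] = f" 
    using Id_Tens[of f] Tens_Id[of f] by (simp_all add: Unit_words)
qed (simp_all add: Obj_words Tens_words Interchange
  Comp_assoc Tens_assoc Id_Comp Comp_Id tens_id[unfolded Obj_words Tens_words, simplified]
  zigzag_left[unfolded Obj_words Tens_words Dual_words, simplified] 
  zigzag_right[unfolded Obj_words Tens_words Dual_words, simplified]
  ev_unit[unfolded Unit_words] coev_unit[unfolded Unit_words]
  ev_tens[unfolded Obj_words Tens_words Dual_words, simplified]
  coev_tens[unfolded Obj_words Tens_words Dual_words, simplified])


lemma arr_S [simp]: "arr (S x)" "src (S x) = [x, x]" "tgt (S x) = [x, x]"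
  using S_hom[of x] by (simp_all add: hom_iff Obj_words)

section \<open>Crossings of parallel strands and the first two moves\<close>

definition coef :: "bool \<Rightarrow> 'r" where "coef e = (if e then inv\<^bsub>R\<^esub> \<alpha> else \<alpha>)"
definition weight :: "bool \<Rightarrow> 'r" where "weight e = (if e then inv\<^bsub>R\<^esub> \<zeta> else \<zeta>)"

lemma scalar_closed [simp]: "coef e \<in> carrier R" "weight e \<in> carrier R"
    "b\<^sub>0 \<in> carrier R" "b\<^sub>1 \<in> carrier R" "b\<^sub>2 \<in> carrier R"
  using scalars by (auto simp: coef_def weight_def)

lemma coef_not [simp]: "coef (\<not> e) \<otimes>\<^bsub>R\<^esub> coef e = \<one>\<^bsub>R\<^esub>"
  and weight_not [simp]: "weight (\<not> e) \<otimes>\<^bsub>R\<^esub> weight e = \<one>\<^bsub>R\<^esub>"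
  and weight_sum: "weight (\<not> e) \<oplus>\<^bsub>R\<^esub> weight e = \<zeta> \<oplus>\<^bsub>R\<^esub> inv\<^bsub>R\<^esub> \<zeta>"
  using scalars by (auto simp: coef_def weight_def a_comm Units_closed)

lemma curl: "coef e \<otimes>\<^bsub>R\<^esub> (weight e \<otimes>\<^bsub>R\<^esub> b\<^sub>0 \<oplus>\<^bsub>R\<^esub> b\<^sub>1) = \<one>\<^bsub>R\<^esub>"
  using curl_plus curl_minus by (simp add: coef_def weight_def)

definition tau :: "orient \<Rightarrow> bool \<Rightarrow> 'm" where
  "tau x e = weight e \<diamondop> Id C [x, x] \<uplus> S x"

definition sigma :: "orient \<Rightarrow> bool \<Rightarrow> 'm" where
  "sigma x e = coef e \<diamondop> tau x e"

lemma arr_tau [simp]: "arr (tau x e)" "src (tau x e) = [x, x]" "tgt (tau x e) = [x, x]"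
  by (simp_all add: tau_def)

lemma arr_sigma [simp]: "arr (sigma x e)" "src (sigma x e) = [x, x]" "tgt (sigma x e) = [x, x]"
  by (simp_all add: sigma_def)

lemma relations:
  "Ev C [x] \<bullet> Coev C [x] = b\<^sub>0 \<diamondop> Id C []"
  "S x \<bullet> S x = (\<ominus>\<^bsub>R\<^esub> (\<zeta> \<oplus>\<^bsub>R\<^esub> inv\<^bsub>R\<^esub> \<zeta>)) \<diamondop> S x"
  "K.ptr_left [x] (S x) = b\<^sub>1 \<diamondop> Id C [x]"
  "(Id C [x] \<parallel> (Ev C [x] \<parallel> Id C [flip x])) \<bullet> ((S x \<parallel> S (flip x)) \<bullet> (Id C [x] \<parallel> (Coev C [x] \<parallel> Id C [flip x])))
   = (Coev C [x] \<bullet> Ev C [x]) \<uplus> b\<^sub>2 \<diamondop> Id C [x, flip x]"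
  "((S x \<parallel> Id C [x]) \<bullet> ((Id C [x] \<parallel> S x) \<bullet> (S x \<parallel> Id C [x]))) \<uplus> (Id C [x] \<parallel> S x)
   = ((Id C [x] \<parallel> S x) \<bullet> ((S x \<parallel> Id C [x]) \<bullet> (Id C [x] \<parallel> S x))) \<uplus> (S x \<parallel> Id C [x])"
  using circle[of x] digon[of x] bubble[of x] square[of x] hexagon[of x]
  by (simp_all add: plus_def scale_def K.ptr_left_def)

lemma rho_linear:
  assumes "arr f" "src f = a @ b" "tgt f = c @ d"
  shows "r \<in> carrier R \<Longrightarrow> K.rho a b c d (r \<diamondop> f) = r \<diamondop> K.rho a b c d f"
    and "\<lbrakk>arr g; src g = src f; tgt g = tgt f\<rbrakk> \<Longrightarrow> K.rho a b c d (f \<uplus> g) = K.rho a b c d f \<uplus> K.rho a b c d g"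
  using assms by (simp_all add: K.rho_def linear)

lemma left_transpose_eq_rho: "arr f \<Longrightarrow> src f = a \<Longrightarrow> tgt f = b \<Longrightarrow> left_transpose C a b f = K.rho [] a b [] f"
  by (simp add: left_transpose_def K.rho_def Dual_words)

lemma right_transpose_eq_lam: "arr f \<Longrightarrow> src f = a \<Longrightarrow> tgt f = b \<Longrightarrow> right_transpose C a b f = K.lam a [] [] b f"
  by (simp add: right_transpose_def K.lam_def Dual_words)

lemma rho_eq_lam: "arr f \<Longrightarrow> src f = a \<Longrightarrow> tgt f = b \<Longrightarrow> K.rho [] a b [] f = K.lam a [] [] b f"
  using balanced[of a b f] by (simp add: hom_iff Obj_words left_transpose_eq_rho right_transpose_eq_lam)

lemma rho_S: "K.rho [] [x, x] [x, x] [] (S x) = S (flip x)"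
  using S_transpose[of x] by (simp add: left_transpose_eq_rho)

text \<open>The half turn is linear, sends identities to identities and reverses the orientation of
  \<open>S\<close>; so the sign \<open>e\<close> is kept.\<close>

lemma rho_sigma: "K.rho [] [x, x] [x, x] [] (sigma x e) = sigma (flip x) e"
  by (simp add: sigma_def tau_def rho_linear rho_S K.rho_id)

lemma ptr_left_S: "K.ptr_left [x] (S x) = b\<^sub>1 \<diamondop> Id C [x]"
  by (rule relations)

text \<open>By \<open>ptr_left_lam\<close> and pivotality, the transpose of this loop is the left
  loop on \<open>S (flip x)\<close>, which is known; turning back gives the claim.\<close>

lemma ptr_right_S: "K.ptr_right [x] (S x) = b\<^sub>1 \<diamondop> Id C [x]"
proof -
  have arr: "arr (K.ptr_right [x] (S x))" "src (K.ptr_right [x] (S x)) = [x]" "tgt (K.ptr_right [x] (S x)) = [x]"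
    by (simp_all add: K.ptr_right_def)
  have "K.lam [x] [] [] [x] (K.ptr_right [x] (S x)) = b\<^sub>1 \<diamondop> Id C [flip x]"
    using K.ptr_left_lam[of "S x" "[x]"] ptr_left_S[of "flip x"] by (simp add: rho_eq_lam[symmetric] rho_S)
  then have "K.rho [] [flip x] [flip x] [] (b\<^sub>1 \<diamondop> Id C [flip x]) = K.ptr_right [x] (S x)"
    using K.rho_lam[of "K.ptr_right [x] (S x)" "[x]" "[]" "[]" "[x]"] arr by simp
  then show ?thesis by (simp add: rho_linear K.rho_id)
qed

lemma circle_whisker: "(Id C a \<parallel> (Ev C [x] \<parallel> Id C b)) \<bullet> (Id C a \<parallel> (Coev C [x] \<parallel> Id C b)) = b\<^sub>0 \<diamondop> Id C (a @ b)"
proof -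
  have "Id C a \<parallel> ((Ev C [x] \<bullet> Coev C [x]) \<parallel> Id C b) = b\<^sub>0 \<diamondop> Id C (a @ b)"
    unfolding relations(1) by (simp add: linear)
  then show ?thesis by simp
qed

lemma ptr_left_Id: "K.ptr_left [x] (Id C [x, x]) = b\<^sub>0 \<diamondop> Id C [x]"
  using circle_whisker[of "[]" "flip x" "[x]"] by (simp add: K.ptr_left_def)

lemma ptr_right_Id: "K.ptr_right [x] (Id C [x, x]) = b\<^sub>0 \<diamondop> Id C [x]"
  using circle_whisker[of "[x]" "x" "[]"] by (simp add: K.ptr_right_def)

lemma ptr_linear:
  assumes "arr f" "src f = [x, x]" "tgt f = [x, x]"
  shows "r \<in> carrier R \<Longrightarrow> K.ptr_left [x] (r \<diamondop> f) = r \<diamondop> K.ptr_left [x] f"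
    and "r \<in> carrier R \<Longrightarrow> K.ptr_right [x] (r \<diamondop> f) = r \<diamondop> K.ptr_right [x] f"
    and "\<lbrakk>arr g; src g = [x, x]; tgt g = [x, x]\<rbrakk> \<Longrightarrow> K.ptr_left [x] (f \<uplus> g) = K.ptr_left [x] f \<uplus> K.ptr_left [x] g"
    and "\<lbrakk>arr g; src g = [x, x]; tgt g = [x, x]\<rbrakk> \<Longrightarrow> K.ptr_right [x] (f \<uplus> g) = K.ptr_right [x] f \<uplus> K.ptr_right [x] g"
  using assms by (simp_all add: K.ptr_left_def K.ptr_right_def linear)

lemma ptr_sigma: "K.ptr_left [x] (sigma x e) = Id C [x]" "K.ptr_right [x] (sigma x e) = Id C [x]"
  by (simp_all add: sigma_def tau_def ptr_linear ptr_left_S ptr_right_S ptr_left_Id ptr_right_Id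
      scale_scale plus_scale curl scale_one)

text \<open>In the product, \<open>S\<close> has as coefficient the sum of the two weights minus
  \<open>d\<close>, which vanishes; the weights and the prefactors are pairwise inverse.\<close>

lemma sigma_inverse: "sigma x (\<not> e) \<bullet> sigma x e = Id C [x, x]"
proof -
  define d where "d = \<zeta> \<oplus>\<^bsub>R\<^esub> inv\<^bsub>R\<^esub> \<zeta>"
  have d [simp]: "d \<in> carrier R" using scalars by (simp add: d_def Units_closed)
  have "weight (\<not> e) \<oplus>\<^bsub>R\<^esub> (weight e \<oplus>\<^bsub>R\<^esub> \<ominus>\<^bsub>R\<^esub> d) = (weight (\<not> e) \<oplus>\<^bsub>R\<^esub> weight e) \<oplus>\<^bsub>R\<^esub> \<ominus>\<^bsub>R\<^esub> d"
    by (simp add: a_assoc)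
  then have z: "weight (\<not> e) \<oplus>\<^bsub>R\<^esub> (weight e \<oplus>\<^bsub>R\<^esub> \<ominus>\<^bsub>R\<^esub> d) = \<zero>\<^bsub>R\<^esub>"
    unfolding weight_sum d_def[symmetric] by (simp only: r_neg d)
  have "tau x (\<not> e) \<bullet> tau x e = Id C [x, x] \<uplus> (weight (\<not> e) \<oplus>\<^bsub>R\<^esub> (weight e \<oplus>\<^bsub>R\<^esub> \<ominus>\<^bsub>R\<^esub> d)) \<diamondop> S x"
    using m_comm[of "weight e" "weight (\<not> e)"]
    by (simp add: tau_def linear relations d_def[symmetric] scale_plus scale_scale scale_one plus_assoc plus_scale
        a_lcomm[of "weight e"])
  also have "\<dots> = Id C [x, x]"
    unfolding z by (simp add: plus_scale_zero)
  finally show ?thesis by (simp add: sigma_def linear scale_scale scale_one m_comm[of "coef e"])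
qed

text \<open>The left-hand side of (R2b) as a bilinear function of its two crossings.\<close>

definition bigon :: "orient \<Rightarrow> 'm \<Rightarrow> 'm \<Rightarrow> 'm" where
  "bigon x f g = (Id C [x] \<parallel> (Ev C [x] \<parallel> Id C [flip x])) \<bullet> ((f \<parallel> g) \<bullet> (Id C [x] \<parallel> (Coev C [x] \<parallel> Id C [flip x])))"

lemma bigon_linear:
  assumes "arr f" "src f = [x, x]" "tgt f = [x, x]" "arr g" "src g = [flip x, flip x]" "tgt g = [flip x, flip x]"
  shows "r \<in> carrier R \<Longrightarrow> bigon x (r \<diamondop> f) g = r \<diamondop> bigon x f g"
    and "r \<in> carrier R \<Longrightarrow> bigon x f (r \<diamondop> g) = r \<diamondop> bigon x f g"
    and "\<lbrakk>arr h; src h = [x, x]; tgt h = [x, x]\<rbrakk> \<Longrightarrow> bigon x (f \<uplus> h) g = bigon x f g \<uplus> bigon x h g"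
    and "\<lbrakk>arr h; src h = [flip x, flip x]; tgt h = [flip x, flip x]\<rbrakk> \<Longrightarrow> bigon x f (g \<uplus> h) = bigon x f g \<uplus> bigon x f h"
  using assms by (simp_all add: bigon_def linear)

text \<open>The four cases are a circle between two strands, a loop of \<open>S\<close> on the left
  strand closed on its right, a loop on the right strand closed on its left, and the square
  relation.\<close>

lemma bigon_values:
  "bigon x (Id C [x, x]) (Id C [flip x, flip x]) = b\<^sub>0 \<diamondop> Id C [x, flip x]"
  "bigon x (S x) (Id C [flip x, flip x]) = b\<^sub>1 \<diamondop> Id C [x, flip x]"
  "bigon x (Id C [x, x]) (S (flip x)) = b\<^sub>1 \<diamondop> Id C [x, flip x]"
  "bigon x (S x) (S (flip x)) = (Coev C [x] \<bullet> Ev C [x]) \<uplus> b\<^sub>2 \<diamondop> Id C [x, flip x]"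
proof -
  show "bigon x (Id C [x, x]) (Id C [flip x, flip x]) = b\<^sub>0 \<diamondop> Id C [x, flip x]"
    using circle_whisker[of "[x]" x "[flip x]"] by (simp add: bigon_def)
  have "K.ptr_right [x] (S x) \<parallel> Id C [flip x] = b\<^sub>1 \<diamondop> Id C [x, flip x]"
    unfolding ptr_right_S by (simp add: linear)
  then show "bigon x (S x) (Id C [flip x, flip x]) = b\<^sub>1 \<diamondop> Id C [x, flip x]"
    by (simp add: bigon_def K.ptr_right_def)
  have "Id C [x] \<parallel> K.ptr_left [flip x] (S (flip x)) = b\<^sub>1 \<diamondop> Id C [x, flip x]"
    unfolding ptr_left_S by (simp add: linear)
  then show "bigon x (Id C [x, x]) (S (flip x)) = b\<^sub>1 \<diamondop> Id C [x, flip x]"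
    by (simp add: bigon_def K.ptr_left_def)
  show "bigon x (S x) (S (flip x)) = (Coev C [x] \<bullet> Ev C [x]) \<uplus> b\<^sub>2 \<diamondop> Id C [x, flip x]"
    unfolding bigon_def by (rule relations)
qed

lemma bigon_sigma: "bigon x (sigma x e) (sigma (flip x) (\<not> e)) = Coev C [x] \<bullet> Ev C [x]"
proof -
  define E where "E = Coev C [x] \<bullet> Ev C [x]"
  have [simp]: "arr E" "src E = [x, flip x]" "tgt E = [x, flip x]" by (simp_all add: E_def)
  \<comment> \<open>The total coefficient of the two vertical strands; \<open>weight_sum\<close>
    turns it into the bracket recursion.\<close>
  have z: "b\<^sub>0 \<oplus>\<^bsub>R\<^esub> (weight (\<not> e) \<otimes>\<^bsub>R\<^esub> b\<^sub>1 \<oplus>\<^bsub>R\<^esub> (weight e \<otimes>\<^bsub>R\<^esub> b\<^sub>1 \<oplus>\<^bsub>R\<^esub> b\<^sub>2)) = \<zero>\<^bsub>R\<^esub>"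
    using bracket_recursion weight_sum[of e] by (simp add: a_assoc[symmetric] l_distr[symmetric])
  have "bigon x (tau x e) (tau (flip x) (\<not> e)) =
    E \<uplus> ((weight (\<not> e) \<otimes>\<^bsub>R\<^esub> weight e) \<otimes>\<^bsub>R\<^esub> b\<^sub>0 \<oplus>\<^bsub>R\<^esub>
      (weight (\<not> e) \<otimes>\<^bsub>R\<^esub> b\<^sub>1 \<oplus>\<^bsub>R\<^esub> (weight e \<otimes>\<^bsub>R\<^esub> b\<^sub>1 \<oplus>\<^bsub>R\<^esub> b\<^sub>2))) \<diamondop> Id C [x, flip x]"
    unfolding E_def[symmetric]
    by (simp add: tau_def bigon_linear bigon_values E_def[symmetric] scale_plus scale_scale plus_ac plus_scale plus_scale_left
        m_ac a_ac r_distr l_distr del: weight_not)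
  then show ?thesis
    using z by (simp add: sigma_def bigon_linear scale_scale scale_one plus_scale_zero E_def[symmetric])
qed

text \<open>After expansion both sides share the part \<open>W\<close>; what remains is
  \<open>X Y X - X\<close> on the left and \<open>Y X Y - Y\<close> on the right, and these agree by
  the hexagon relation.\<close>

lemma sigma_braid:
  "(sigma x True \<parallel> Id C [x]) \<bullet> ((Id C [x] \<parallel> sigma x True) \<bullet> (sigma x True \<parallel> Id C [x]))
   = (Id C [x] \<parallel> sigma x True) \<bullet> ((sigma x True \<parallel> Id C [x]) \<bullet> (Id C [x] \<parallel> sigma x True))"
proof -
  define X where "X = S x \<parallel> Id C [x]"
  define Y where "Y = Id C [x] \<parallel> S x"
  define I where "I = Id C [x, x, x]"
  define a where "a = weight True"
  define d where "d = \<zeta> \<oplus>\<^bsub>R\<^esub> inv\<^bsub>R\<^esub> \<zeta>"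
  have [simp]: "arr X" "src X = [x, x, x]" "tgt X = [x, x, x]" "arr Y" "src Y = [x, x, x]" "tgt Y = [x, x, x]"
    "arr I" "src I = [x, x, x]" "tgt I = [x, x, x]" "a \<in> carrier R" "d \<in> carrier R"
    using scalars by (simp_all add: X_def Y_def I_def a_def d_def Units_closed)
  have I: "I \<bullet> f = f" "f \<bullet> I = f" if "arr f" "src f = [x, x, x]" "tgt f = [x, x, x]" for f
    using that by (simp_all add: I_def)
  define F where "F = a \<diamondop> I \<uplus> X"
  define G where "G = a \<diamondop> I \<uplus> Y"
  have [simp]: "arr F" "src F = [x, x, x]" "tgt F = [x, x, x]" "arr G" "src G = [x, x, x]" "tgt G = [x, x, x]"
    by (simp_all add: F_def G_def)
  have sigma: "sigma x True \<parallel> Id C [x] = coef True \<diamondop> F" "Id C [x] \<parallel> sigma x True = coef True \<diamondop> G"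
    by (simp_all add: F_def G_def sigma_def tau_def linear X_def Y_def I_def a_def)
  have XX: "X \<bullet> X = (\<ominus>\<^bsub>R\<^esub> d) \<diamondop> X" "Y \<bullet> Y = (\<ominus>\<^bsub>R\<^esub> d) \<diamondop> Y"
    using arg_cong[OF relations(2)[of x], of "\<lambda>f. f \<parallel> Id C [x]"]
      arg_cong[OF relations(2)[of x], of "\<lambda>f. Id C [x] \<parallel> f"]
    by (simp_all add: X_def Y_def linear d_def scalars Units_closed del: minus_add)
  define P where "P = X \<bullet> (Y \<bullet> X)"
  define Q where "Q = Y \<bullet> (X \<bullet> Y)"
  define U where "U = X \<bullet> Y"
  define V where "V = Y \<bullet> X"
  have [simp]: "arr P" "src P = [x, x, x]" "tgt P = [x, x, x]" "arr Q" "src Q = [x, x, x]" "tgt Q = [x, x, x]"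
    "arr U" "src U = [x, x, x]" "tgt U = [x, x, x]" "arr V" "src V = [x, x, x]" "tgt V = [x, x, x]"
    by (simp_all add: P_def Q_def U_def V_def)
  have PQ: "P \<uplus> Y = Q \<uplus> X"
    using relations(5)[of x] unfolding X_def[symmetric] Y_def[symmetric] P_def[symmetric] Q_def[symmetric] .
  have U: "X \<bullet> Y = U" "X \<bullet> V = P" "Y \<bullet> U = Q" "Y \<bullet> X = V"
    by (simp_all add: U_def V_def P_def Q_def)
  \<comment> \<open>Since \<open>a\<close> is \<open>inv \<zeta>\<close>, one has
    \<open>a * d = 1 + a * a\<close>. This fixes the coefficient -1 of \<open>X\<close> outside
    \<open>W\<close>, with \<open>-d\<close> coming from \<open>X\<close> composed with
    itself.\<close>
  have ad: "a \<otimes>\<^bsub>R\<^esub> a \<oplus>\<^bsub>R\<^esub> a \<otimes>\<^bsub>R\<^esub> (\<ominus>\<^bsub>R\<^esub> d) = \<ominus>\<^bsub>R\<^esub> \<one>\<^bsub>R\<^esub>"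
  proof -
    have "a \<otimes>\<^bsub>R\<^esub> d = \<one>\<^bsub>R\<^esub> \<oplus>\<^bsub>R\<^esub> a \<otimes>\<^bsub>R\<^esub> a"
      using scalars by (simp add: a_def weight_def d_def r_distr Units_closed)
    then show ?thesis by (simp add: r_minus minus_add a_lcomm[of "a \<otimes>\<^bsub>R\<^esub> a"] r_neg)
  qed
  \<comment> \<open>\<open>F G F\<close> contains \<open>a * a\<close> times \<open>X\<close> twice
    but \<open>a * a\<close> times \<open>Y\<close> once. Taking one of each makes \<open>W\<close>
    symmetric in \<open>X\<close> and \<open>Y\<close>, so it also fits
    \<open>G F G\<close>.\<close>
  define W where "W = (a \<otimes>\<^bsub>R\<^esub> (a \<otimes>\<^bsub>R\<^esub> a)) \<diamondop> I \<uplus> ((a \<otimes>\<^bsub>R\<^esub> a) \<diamondop> X \<uplus> ((a \<otimes>\<^bsub>R\<^esub> a) \<diamondop> Y \<uplus> (a \<diamondop> U \<uplus> a \<diamondop> V)))"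
  have [simp]: "arr W" "src W = [x, x, x]" "tgt W = [x, x, x]" by (simp_all add: W_def)
  have "F \<bullet> (G \<bullet> F) = W \<uplus> ((a \<otimes>\<^bsub>R\<^esub> a) \<diamondop> X \<uplus> ((a \<otimes>\<^bsub>R\<^esub> (\<ominus>\<^bsub>R\<^esub> d)) \<diamondop> X \<uplus> P))"
    by (simp add: F_def G_def W_def linear I XX U scale_plus scale_scale plus_ac m_assoc del: K.comp_assoc)
  also have "\<dots> = W \<uplus> ((\<ominus>\<^bsub>R\<^esub> \<one>\<^bsub>R\<^esub>) \<diamondop> X \<uplus> P)"
    by (simp add: plus_scale_left ad)
  also have "\<dots> = W \<uplus> ((\<ominus>\<^bsub>R\<^esub> \<one>\<^bsub>R\<^esub>) \<diamondop> Y \<uplus> Q)"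
  proof -
    have cancel: "(\<ominus>\<^bsub>R\<^esub> \<one>\<^bsub>R\<^esub>) \<diamondop> f \<uplus> (f \<uplus> g) = g"
      if "arr f" "src f = [x, x, x]" "tgt f = [x, x, x]" "arr g" "src g = [x, x, x]" "tgt g = [x, x, x]" for f g
      using that plus_scale_left[of "\<ominus>\<^bsub>R\<^esub> \<one>\<^bsub>R\<^esub>" "\<one>\<^bsub>R\<^esub>" f g] plus_scale_zero[of g f]
      by (simp add: scale_one l_neg plus_comm)
    have "(\<ominus>\<^bsub>R\<^esub> \<one>\<^bsub>R\<^esub>) \<diamondop> X \<uplus> P = (\<ominus>\<^bsub>R\<^esub> \<one>\<^bsub>R\<^esub>) \<diamondop> Y \<uplus> (Y \<uplus> ((\<ominus>\<^bsub>R\<^esub> \<one>\<^bsub>R\<^esub>) \<diamondop> X \<uplus> P))"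
      by (rule cancel[symmetric]) simp_all
    also have "\<dots> = (\<ominus>\<^bsub>R\<^esub> \<one>\<^bsub>R\<^esub>) \<diamondop> Y \<uplus> ((\<ominus>\<^bsub>R\<^esub> \<one>\<^bsub>R\<^esub>) \<diamondop> X \<uplus> (P \<uplus> Y))"
      by (simp add: plus_ac)
    also have "\<dots> = (\<ominus>\<^bsub>R\<^esub> \<one>\<^bsub>R\<^esub>) \<diamondop> Y \<uplus> ((\<ominus>\<^bsub>R\<^esub> \<one>\<^bsub>R\<^esub>) \<diamondop> X \<uplus> (X \<uplus> Q))"
      unfolding PQ by (simp add: plus_comm[of Q X])
    also have "\<dots> = (\<ominus>\<^bsub>R\<^esub> \<one>\<^bsub>R\<^esub>) \<diamondop> Y \<uplus> Q"
      by (simp add: cancel)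
    finally show ?thesis by simp
  qed
  also have "\<dots> = W \<uplus> ((a \<otimes>\<^bsub>R\<^esub> a) \<diamondop> Y \<uplus> ((a \<otimes>\<^bsub>R\<^esub> (\<ominus>\<^bsub>R\<^esub> d)) \<diamondop> Y \<uplus> Q))"
    by (simp add: plus_scale_left ad)
  also have "\<dots> = G \<bullet> (F \<bullet> G)"
    by (simp add: F_def G_def W_def linear I XX U scale_plus scale_scale plus_ac m_assoc del: K.comp_assoc)
  finally show ?thesis
    by (simp add: sigma comp_scale)
qed


text \<open>Both antiparallel crossings are written as counterclockwise quarter turns of a crossing
  whose strands both have orientation \<open>y\<close>. Thus only equal and opposite orientations
  have to be distinguished.\<close>

definition cross :: "bool \<Rightarrow> orient \<Rightarrow> orient \<Rightarrow> 'm" where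
  "cross e x y = (if x = y then sigma x e else K.rho [y] [y] [y] [y] (sigma y (\<not> e)))"

lemma flip_neq [simp]: "flip x \<noteq> x" "x \<noteq> flip x"
  by (cases x; simp)+

lemma neq_flip: "x \<noteq> y \<Longrightarrow> x = flip y"
  by (cases x; cases y) simp_all

lemma arr_cross [simp]: "arr (cross e x y)" "src (cross e x y) = [x, y]" "tgt (cross e x y) = [y, x]"
  by (auto simp: cross_def dest!: neq_flip)

text \<open>For \<open>Up\<close>, \<open>Down\<close> the definition bends clockwise,
  \<open>cross\<close> counterclockwise. Two clockwise quarter turns form a half turn, which by
  pivotality is also the counterclockwise one; so one clockwise turn is a counterclockwise turn of
  the half-turned crossing.\<close>

lemma crossing_eq: "crossing C [Up] (sigma Up) e x y = cross e x y"
proof (cases x; cases y)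
  assume "x = Up" "y = Down"
  have "K.lam [Up] [Up] [Up] [Up] f = K.rho [Down] [Down] [Down] [Down] (K.rho [] [Up, Up] [Up, Up] [] f)"
    if [simp]: "arr f" "src f = [Up, Up]" "tgt f = [Up, Up]" for f
    using K.rho_lam[of "K.lam [Up] [Up] [Up] [Up] f" "[Up]" "[Down]" "[Down]" "[Up]"]
      K.lam_lam[of f "[Up]" "[Up]" "[Up]" "[Up]"] by (simp add: rho_eq_lam)
  from this[of "sigma Up (\<not> e)"] show ?thesis
    using \<open>x = Up\<close> \<open>y = Down\<close> by (simp add: cross_def K.lam_def rho_sigma Dual_words)
qed (simp_all add: cross_def K.rho_def Dual_words left_transpose_eq_rho rho_sigma[unfolded K.rho_def, of Up, simplified])

text \<open>For opposite orientations \<open>rho_horizontal\<close> presents the composite as a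
  quarter turn of the bigon, which (R2b) replaces by a cap below a cup.\<close>

lemma cross_inverse: "cross (\<not> e) y x \<bullet> cross e x y = Id C [x, y]"
proof (cases "x = y")
  case True
  then show ?thesis by (simp add: cross_def sigma_inverse)
next
  case False
  then have x: "x = flip y" by (rule neq_flip)
  show ?thesis
    using K.rho_horizontal[of "sigma y (\<not> e)" "[y]" "[y]" "[y]" "[y]" "sigma (flip y) e" "[flip y]" "[flip y]"]
      K.rho_coev_ev[of "[y]"] bigon_sigma[of y "\<not> e"]
    by (simp add: x cross_def bigon_def)
qed

text \<open>For equal orientations of \<open>w\<close> and \<open>z\<close> this is the definition.
  Otherwise two quarter turns form a half turn: the two negations cancel, and
  \<open>rho_sigma\<close> applies.\<close>

lemma cross_rotate: "cross e (flip z) w = K.rho [w] [z] [z] [w] (cross (\<not> e) w z)"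
proof (cases "w = z")
  case False
  then have w: "w = flip z" by (rule neq_flip)
  show ?thesis
    using K.rho_rho[of "sigma z e" "[z]" "[z]" "[z]" "[z]"] by (simp add: w cross_def rho_sigma)
qed (simp add: cross_def)

section \<open>The third move for all orientations and over/under patterns\<close>

definition yang_baxter :: "orient \<Rightarrow> orient \<Rightarrow> orient \<Rightarrow> bool \<Rightarrow> bool \<Rightarrow> bool \<Rightarrow> bool" where
  "yang_baxter x y z p q r \<longleftrightarrow>
    (cross r y z \<parallel> Id C [x]) \<bullet> ((Id C [y] \<parallel> cross q x z) \<bullet> (cross p x y \<parallel> Id C [z]))
    = (Id C [z] \<parallel> cross p x y) \<bullet> ((cross q x z \<parallel> Id C [y]) \<bullet> (Id C [x] \<parallel> cross r y z))"

lemma yang_baxter_swap12: "yang_baxter x y z p q r \<Longrightarrow> yang_baxter y x z (\<not> p) r q"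
  unfolding yang_baxter_def
  by (rule K.yang_baxter_swap12[of "cross p x y" "[x]" "[y]"])
    (use cross_inverse[of p y x] cross_inverse[of "\<not> p" x y] in simp_all)

lemma yang_baxter_swap23: "yang_baxter x y z p q r \<Longrightarrow> yang_baxter x z y q p (\<not> r)"
  unfolding yang_baxter_def
  by (rule K.yang_baxter_swap23[of "cross p x y" "[x]" "[y]" "cross q x z" "[z]" "cross r y z"])
    (use cross_inverse[of r z y] cross_inverse[of "\<not> r" y z] in simp_all)

text \<open>Only the strand \<open>z\<close> is bent, so exactly its two crossings \<open>q\<close>
  and \<open>r\<close> receive a quarter turn and change sign.\<close>

lemma yang_baxter_rotate: "yang_baxter x y z p q r \<Longrightarrow> yang_baxter (flip z) x y (\<not> q) (\<not> r) p"
  using K.yang_baxter_rho[of "cross p x y" "[x]" "[y]" "cross q x z" "[z]" "cross r y z"]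
  by (simp add: yang_baxter_def cross_rotate)

text \<open>The six admissible patterns correspond to the height orders of three strands. Each swap
  inverts one crossing and exchanges the other two; starting from all signs \<open>True\<close> the
  swaps reach all six.\<close>

lemma yang_baxter_Up:
  assumes "\<not> (p = r \<and> q \<noteq> p)"
  shows "yang_baxter Up Up Up p q r"
proof -
  have "yang_baxter Up Up Up True True True"
    using sigma_braid[of Up] by (simp add: yang_baxter_def cross_def)
  moreover from this have "yang_baxter Up Up Up False True True" "yang_baxter Up Up Up True True False"
    using yang_baxter_swap12[of Up Up Up True True True] yang_baxter_swap23[of Up Up Up True True True] by simp_all
  moreover from this have "yang_baxter Up Up Up True False False" "yang_baxter Up Up Up False False True"
    using yang_baxter_swap23[of Up Up Up False True True] yang_baxter_swap12[of Up Up Up True True False] by simp_all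
  moreover from this have "yang_baxter Up Up Up False False False"
    using yang_baxter_swap12[of Up Up Up True False False] by simp
  ultimately show ?thesis using assms by (cases p; cases q; cases r) simp_all
qed

definition all_yang_baxter :: "orient \<Rightarrow> orient \<Rightarrow> orient \<Rightarrow> bool" where
  "all_yang_baxter x y z \<longleftrightarrow> (\<forall>p q r. \<not> (p = r \<and> q \<noteq> p) \<longrightarrow> yang_baxter x y z p q r)"

text \<open>The moves permute the positions of the strands but keep their order of height, so
  noncyclic patterns correspond to noncyclic ones. A given target pattern is traced back to its
  source pattern.\<close>

lemma all_yang_baxter_moves:
  assumes "all_yang_baxter x y z"
  shows "all_yang_baxter y x z" "all_yang_baxter x z y" "all_yang_baxter (flip z) x y"
proof -
  have yb: "yang_baxter x y z p q r" if "\<not> (p = r \<and> q \<noteq> p)" for p q r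
    using assms[unfolded all_yang_baxter_def] that by (elim allE impE)
  have "yang_baxter y x z p q r \<and> yang_baxter x z y p q r \<and> yang_baxter (flip z) x y p q r"
    if c: "\<not> (p = r \<and> q \<noteq> p)" for p q r
  proof -
    have "\<not> ((\<not> p) = q \<and> r \<noteq> (\<not> p))" "\<not> (q = (\<not> r) \<and> p \<noteq> q)" "\<not> (r = (\<not> q) \<and> (\<not> p) \<noteq> r)"
      using c by (cases p; cases q; cases r; simp)+
    from this[THEN yb] show ?thesis
      using yang_baxter_swap12[of x y z "\<not> p" r q] yang_baxter_swap23[of x y z q p "\<not> r"]
        yang_baxter_rotate[of x y z r "\<not> p" "\<not> q"] by simp
  qed
  then show "all_yang_baxter y x z" "all_yang_baxter x z y" "all_yang_baxter (flip z) x y"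
    by (simp_all add: all_yang_baxter_def)
qed

text \<open>Each rotation turns one more upward strand downward; the swaps supply the remaining
  arrangements with the same number of downward strands.\<close>

lemma all_yang_baxter: "all_yang_baxter x y z"
proof -
  have UUU: "all_yang_baxter Up Up Up" using yang_baxter_Up by (simp add: all_yang_baxter_def)
  have DUU: "all_yang_baxter Down Up Up" using all_yang_baxter_moves(3)[OF UUU] by simp
  have UDU: "all_yang_baxter Up Down Up" by (rule all_yang_baxter_moves(1)[OF DUU])
  have UUD: "all_yang_baxter Up Up Down" by (rule all_yang_baxter_moves(2)[OF UDU])
  have DDU: "all_yang_baxter Down Down Up" using all_yang_baxter_moves(3)[OF DUU] by simp
  have DUD: "all_yang_baxter Down Up Down" by (rule all_yang_baxter_moves(2)[OF DDU])
  have UDD: "all_yang_baxter Up Down Down" by (rule all_yang_baxter_moves(1)[OF DUD])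
  have DDD: "all_yang_baxter Down Down Down" using all_yang_baxter_moves(3)[OF DDU] by simp
  show ?thesis
    using UUU DUU UDU UUD DDU DUD UDD DDD by (cases x; cases y; cases z) simp_all
qed

lemma monoidal_span_words: "a \<in> monoidal_span C {[Up], [Down]}"
proof (induction a)
  case Nil
  show ?case using monoidal_span.unit[of C] by simp
next
  case (Cons x a)
  have "[x] \<in> monoidal_span C {[Up], [Down]}" by (cases x) (auto intro: monoidal_span.base)
  from monoidal_span.tens[OF this Cons] show ?case by simp
qed

theorem rigid_braided_untwisted: "rigid_braided_untwisted R C [Up] (sigma Up True) (sigma Up False)"
proof -
  have sig: "(\<lambda>e. if e then sigma Up True else sigma Up False) = sigma Up" by auto
  have strand: "strand C [Up] x = [x]" for x by (cases x) (simp_all add: Dual_words)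
  have diag: "cross e x x = sigma x e" for e x by (simp add: cross_def)
  show ?thesis
    unfolding rigid_braided_untwisted_def rigid_braided_untwisted_axioms_def sig strand crossing_eq
  proof (intro conjI allI impI)
    show "balanced_rigid_category R C" by (rule balanced_rigid_category_axioms)
    show "Obj C = monoidal_span C {[Up], Dual C [Up]}"
      using monoidal_span_words by (auto simp: Dual_words)
    show "sigma Up True \<in> carrier (Hom C ([Up] \<cdot> [Up]) ([Up] \<cdot> [Up]))"
      "sigma Up False \<in> carrier (Hom C ([Up] \<cdot> [Up]) ([Up] \<cdot> [Up]))"
      by (simp_all add: hom_iff)
  next
    fix x e
    show "Ev C [flip x] \<parallel> Id C [x] \<bullet> Id C [flip x] \<parallel> cross e x x \<bullet> Coev C [flip x] \<parallel> Id C [x] = Id C [x]"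
      "Id C [x] \<parallel> Ev C [x] \<bullet> cross e x x \<parallel> Id C [flip x] \<bullet> Id C [x] \<parallel> Coev C [x] = Id C [x]"
      using ptr_sigma[of x e] by (simp_all add: diag K.ptr_left_def K.ptr_right_def)
    show "Id C [x] \<parallel> Ev C [x] \<parallel> Id C [flip x] \<bullet> cross e x x \<parallel> cross (\<not> e) (flip x) (flip x)
      \<bullet> Id C [x] \<parallel> Coev C [x] \<parallel> Id C [flip x] = Coev C [x] \<bullet> Ev C [x]"
      using bigon_sigma[of x e] by (simp add: diag bigon_def)
  next
    fix e x y
    show "cross (\<not> e) y x \<bullet> cross e x y = Id C ([x] \<cdot> [y])" by (simp add: cross_inverse)
  next
    fix p q r :: bool and x y z
    assume "\<not> (p = r \<and> q \<noteq> p)"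
    then have "yang_baxter x y z p q r"
      using all_yang_baxter[of x y z, unfolded all_yang_baxter_def] by (elim allE impE)
    then show "cross r y z \<parallel> Id C [x] \<bullet> Id C [y] \<parallel> cross q x z \<bullet> cross p x y \<parallel> Id C [z]
      = Id C [z] \<parallel> cross p x y \<bullet> cross q x z \<parallel> Id C [y] \<bullet> Id C [x] \<parallel> cross r y z"
      by (simp add: yang_baxter_def)
  qed
qed

end

section \<open>The category MOY\<close>

context cring
begin

lemma S_mor_transpose: "left_transpose (TrPD R) [x, x] [x, x] (S_mor R x) = S_mor R (flip x)"
  using turn_S_graph[of x]
  by (simp add: left_transpose_def S_mor_def graph_mor_eq ident_graph_eq ev_graph_eq coev_graph_eq
      pg.rho_def stack_assoc)

text \<open>To be read with \<open>a\<close> as \<alpha>, \<open>t\<close> as \<zeta>,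
  \<open>a'\<close> and \<open>t'\<close> as their inverses and \<open>k\<close> as the inverse of
  \<zeta> - \<zeta>^{-1}. Inverses enter only through their products, so that plain ring arithmetic
  suffices.\<close>

lemma curl_identity:
  assumes [simp]: "a \<in> carrier R" "a' \<in> carrier R" "t \<in> carrier R" "t' \<in> carrier R" "k \<in> carrier R"
    and inverses: "a \<otimes> a' = \<one>" "t \<otimes> t' = \<one>" "(t \<ominus> t') \<otimes> k = \<one>"
    and b: "b0 = (a' \<ominus> a) \<otimes> k" "b1 = (a \<otimes> t \<ominus> a' \<otimes> t') \<otimes> k" "b2 = (a' \<otimes> (t' \<otimes> t') \<ominus> a \<otimes> (t \<otimes> t)) \<otimes> k"
  shows "a' \<otimes> (t' \<otimes> b0 \<oplus> b1) = \<one>" "a \<otimes> (t \<otimes> b0 \<oplus> b1) = \<one>" "b0 \<oplus> ((t \<oplus> t') \<otimes> b1 \<oplus> b2) = \<zero>"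
proof -
  \<comment> \<open>The monomials of the brackets, together with \<open>u\<close> and
    \<open>v\<close>: \<open>b0 = p - q\<close>, \<open>b1 = u - v\<close>,
    \<open>b2 = s - r\<close>. In this form the sums telescope.\<close>
  define p q r s where "p = a' \<otimes> k" and "q = a \<otimes> k" and "r = a \<otimes> (t \<otimes> t) \<otimes> k" and "s = a' \<otimes> (t' \<otimes> t') \<otimes> k"
  define u v where "u = a \<otimes> t \<otimes> k" and "v = a' \<otimes> t' \<otimes> k"
  have [simp]: "p \<in> carrier R" "q \<in> carrier R" "r \<in> carrier R" "s \<in> carrier R" "u \<in> carrier R" "v \<in> carrier R"
    by (simp_all add: p_def q_def r_def s_def u_def v_def)
  have telescope: "(x \<ominus> y) \<oplus> (w \<ominus> x) = w \<ominus> y" if "x \<in> carrier R" "y \<in> carrier R" "w \<in> carrier R" for x y w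
  proof -
    have "(x \<ominus> y) \<oplus> (w \<ominus> x) = (x \<oplus> \<ominus> x) \<oplus> (w \<ominus> y)"
      using that by (simp only: a_minus_def a_ac a_closed a_inv_closed)
    then show ?thesis using that by (simp add: r_neg)
  qed
  note expand = a_minus_def l_distr r_distr l_minus r_minus
  have t: "t' \<otimes> (x \<otimes> t) = x" "t \<otimes> (x \<otimes> t') = x" if "x \<in> carrier R" for x
  proof -
    have "t' \<otimes> (x \<otimes> t) = x \<otimes> (t \<otimes> t')" "t \<otimes> (x \<otimes> t') = x \<otimes> (t \<otimes> t')"
      using that by (simp_all add: m_ac)
    then show "t' \<otimes> (x \<otimes> t) = x" "t \<otimes> (x \<otimes> t') = x"
      using that inverses by simp_all
  qed
  have b0: "b0 = p \<ominus> q" and b1: "b1 = u \<ominus> v" and b2: "b2 = s \<ominus> r"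
    by (simp_all add: b p_def q_def r_def s_def u_def v_def expand)
  have one: "u \<ominus> t' \<otimes> q = a" "t \<otimes> p \<ominus> v = a'"
  proof -
    have "u \<ominus> t' \<otimes> q = a \<otimes> ((t \<ominus> t') \<otimes> k)" "t \<otimes> p \<ominus> v = a' \<otimes> ((t \<ominus> t') \<otimes> k)"
      by (simp_all add: u_def v_def p_def q_def expand m_ac)
    then show "u \<ominus> t' \<otimes> q = a" "t \<otimes> p \<ominus> v = a'" using inverses by simp_all
  qed
  have "t' \<otimes> b0 \<oplus> b1 = (v \<ominus> t' \<otimes> q) \<oplus> (u \<ominus> v)" "t \<otimes> b0 \<oplus> b1 = (u \<ominus> v) \<oplus> (t \<otimes> p \<ominus> u)"
    by (simp_all add: b0 b1 u_def v_def p_def q_def expand m_ac a_ac)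
  then have "t' \<otimes> b0 \<oplus> b1 = a" "t \<otimes> b0 \<oplus> b1 = a'"
    using one by (simp_all add: telescope)
  then show "a' \<otimes> (t' \<otimes> b0 \<oplus> b1) = \<one>" "a \<otimes> (t \<otimes> b0 \<oplus> b1) = \<one>"
    using inverses by (simp_all add: m_comm[of a' a])
  have "t \<otimes> u = r" "t \<otimes> v = p" "t' \<otimes> u = q" "t' \<otimes> v = s"
    using t[of "a \<otimes> k"] t[of "a' \<otimes> k"]
    by (simp_all add: p_def q_def r_def s_def u_def v_def m_ac)
  then have "(t \<oplus> t') \<otimes> b1 = (r \<ominus> p) \<oplus> (q \<ominus> s)"
    by (simp add: b1 expand minus_add a_ac)
  then have "b0 \<oplus> ((t \<oplus> t') \<otimes> b1 \<oplus> b2) = ((p \<ominus> q) \<oplus> (r \<ominus> p)) \<oplus> ((q \<ominus> s) \<oplus> (s \<ominus> r))"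
    by (simp add: b0 b2 a_assoc)
  also have "\<dots> = (r \<ominus> q) \<oplus> (q \<ominus> r)"
    using telescope[of s r q] by (simp add: telescope a_comm[of "q \<ominus> s"])
  also have "\<dots> = \<zero>"
    by (simp add: telescope) (simp add: a_minus_def r_neg)
  finally show "b0 \<oplus> ((t \<oplus> t') \<otimes> b1 \<oplus> b2) = \<zero>" .
qed

lemma units_uminus:
  assumes "x \<in> Units R"
  shows "\<ominus> x \<in> Units R" "inv (\<ominus> x) = \<ominus> (inv x)"
proof -
  have [simp]: "x \<in> carrier R" "inv x \<in> carrier R" using assms by auto
  have *: "(\<ominus> x) \<otimes> (\<ominus> (inv x)) = \<one>" "(\<ominus> (inv x)) \<otimes> (\<ominus> x) = \<one>"
    using assms by (simp_all add: l_minus r_minus)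
  then show "\<ominus> x \<in> Units R" unfolding Units_def by auto
  show "inv (\<ominus> x) = \<ominus> (inv x)" by (rule inv_unique'[symmetric]) (use * in auto)
qed

text \<open>The exponents depend on \<open>n - k\<close> alone, which is 0, 1, 2 here; the sign of
  \<open>- \<zeta>\<close> survives only in the odd case and explains the reversed order of terms
  there.\<close>

lemma qbracket_values:
  assumes "\<alpha> \<in> Units R" "\<zeta> \<in> Units R"
  shows "qbracket R \<alpha> \<zeta> n (int n) = (inv \<alpha> \<ominus> \<alpha>) \<otimes> inv (\<zeta> \<ominus> inv \<zeta>)"
    and "qbracket R \<alpha> \<zeta> n (int n - 1) = (\<alpha> \<otimes> \<zeta> \<ominus> inv \<alpha> \<otimes> inv \<zeta>) \<otimes> inv (\<zeta> \<ominus> inv \<zeta>)"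
    and "qbracket R \<alpha> \<zeta> n (int n - 2) =
      (inv \<alpha> \<otimes> (inv \<zeta> \<otimes> inv \<zeta>) \<ominus> \<alpha> \<otimes> (\<zeta> \<otimes> \<zeta>)) \<otimes> inv (\<zeta> \<ominus> inv \<zeta>)"
proof -
  have [simp]: "\<alpha> \<in> carrier R" "inv \<alpha> \<in> carrier R" "\<zeta> \<in> carrier R" "inv \<zeta> \<in> carrier R"
    using assms by auto
  have zz: "\<zeta> \<otimes> \<zeta> \<in> Units R" "inv (\<zeta> \<otimes> \<zeta>) = inv \<zeta> \<otimes> inv \<zeta>"
  proof -
    show "\<zeta> \<otimes> \<zeta> \<in> Units R" using assms by simp
    have "(\<zeta> \<otimes> \<zeta>) \<otimes> (inv \<zeta> \<otimes> inv \<zeta>) = (\<zeta> \<otimes> inv \<zeta>) \<otimes> (\<zeta> \<otimes> inv \<zeta>)" by (simp add: m_ac)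
    then show "inv (\<zeta> \<otimes> \<zeta>) = inv \<zeta> \<otimes> inv \<zeta>"
      using assms by (intro comm_inv_char) simp_all
  qed
  have p: "(\<ominus> \<zeta>) [^] (0 :: int) = \<one>" "(\<ominus> \<zeta>) [^] (1 :: int) = \<ominus> \<zeta>" "(\<ominus> \<zeta>) [^] (- 1 :: int) = \<ominus> (inv \<zeta>)"
    "(\<ominus> \<zeta>) [^] (2 :: int) = \<zeta> \<otimes> \<zeta>" "(\<ominus> \<zeta>) [^] (- 2 :: int) = inv \<zeta> \<otimes> inv \<zeta>"
    using zz by (simp_all add: int_pow_def2 units_uminus(2)[OF assms(2)] numeral_2_eq_2 l_minus r_minus)
  show "qbracket R \<alpha> \<zeta> n (int n) = (inv \<alpha> \<ominus> \<alpha>) \<otimes> inv (\<zeta> \<ominus> inv \<zeta>)"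
    "qbracket R \<alpha> \<zeta> n (int n - 1) = (\<alpha> \<otimes> \<zeta> \<ominus> inv \<alpha> \<otimes> inv \<zeta>) \<otimes> inv (\<zeta> \<ominus> inv \<zeta>)"
    "qbracket R \<alpha> \<zeta> n (int n - 2) =
      (inv \<alpha> \<otimes> (inv \<zeta> \<otimes> inv \<zeta>) \<ominus> \<alpha> \<otimes> (\<zeta> \<otimes> \<zeta>)) \<otimes> inv (\<zeta> \<ominus> inv \<zeta>)"
    by (simp_all add: qbracket_def p a_minus_def r_minus a_comm)
qed

end

theorem proposition3p3p1:
  fixes R :: "('r, 's) ring_scheme" (structure)
    and \<alpha> z \<zeta> :: 'r and n :: nat
  assumes "cring R"
    and "\<alpha> \<in> Units R" and "z \<in> Units R" and "\<zeta> \<in> Units R"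
    and "inv \<zeta> \<ominus> \<zeta> = z"
    and "n \<ge> 2"
  shows "rigid_braided_untwisted R (MOY R \<alpha> \<zeta> n) [Up] (sigma_plus R \<alpha> \<zeta> n) (sigma_minus R \<alpha> \<zeta> n)"
proof -
  interpret cring R by fact
  \<comment> \<open>Keeps the morphisms of \<open>TrPD\<close> from unfolding to triples, so that
    the abstract laws apply to them.\<close>
  note [simp del] = TrPD_simps(4-) and [simp] = TrPD_simps(4,5)
  define T where "T = TrPD R"
  define I where "I = moy_ideal R \<alpha> \<zeta> n"
  define b0 b1 b2 where "b0 = qbracket R \<alpha> \<zeta> n (int n)" and "b1 = qbracket R \<alpha> \<zeta> n (int n - 1)"
    and "b2 = qbracket R \<alpha> \<zeta> n (int n - 2)"
  note b_defs = b0_def b1_def b2_def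
  have \<alpha>\<zeta> [simp]: "\<alpha> \<in> carrier R" "inv \<alpha> \<in> carrier R" "\<zeta> \<in> carrier R" "inv \<zeta> \<in> carrier R" using assms by auto
  \<comment> \<open>The denominator of the brackets is invertible because \<open>z\<close>
    is.\<close>
  have "\<zeta> \<ominus> inv \<zeta> = \<ominus> z" unfolding assms(5)[symmetric] by (simp add: a_minus_def minus_add a_comm)
  then have d: "\<zeta> \<ominus> inv \<zeta> \<in> Units R" using units_uminus(1)[OF assms(3)] by simp
  have brackets [simp]: "b0 \<in> carrier R" "b1 \<in> carrier R" "b2 \<in> carrier R"
    using d by (simp_all add: b_defs qbracket_values assms Units_closed)
  interpret T: balanced_rigid_category R T unfolding T_def by (rule TrPD_balanced_rigid)
  have T_words [simp]: "Obj T = UNIV" "TensObj T = (@)" "Unit T = []" "Dual T = (\<lambda>a. rev (map flip a))"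
    by (simp_all add: T_def)
  have arr_S [simp]: "T.arr (S_mor R x)" "T.src (S_mor R x) = [x, x]" "T.tgt (S_mor R x) = [x, x]" for x
  proof -
    have "S_mor R x \<in> carrier (Hom T [x, x] [x, x])"
      by (simp add: S_mor_def graph_mor_eq trpd_graph.S T_def)
    then show "T.arr (S_mor R x)" "T.src (S_mor R x) = [x, x]" "T.tgt (S_mor R x) = [x, x]"
      by (simp_all add: T.hom_iff)
  qed
  have arr_ev [simp]: "T.arr (Ev T a)" "T.src (Ev T a) = a @ rev (map flip a)" "T.tgt (Ev T a) = []"
    "T.arr (Coev T a)" "T.src (Coev T a) = []" "T.tgt (Coev T a) = a @ rev (map flip a)" for a
    using T.ev_closed[of a] T.coev_closed[of a] by (simp_all add: T.hom_iff)
  \<comment> \<open>The relations as pairs of parallel morphisms with their source and target. The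
    generators of the ideal are the differences, so the two members of a pair have the same class in
    the quotient.\<close>
  define rels where "rels x = {
    ([], [], Ev T [x] \<bullet>\<^bsub>T\<^esub> Coev T [x], b0 \<odot>\<^bsub>Hom T [] []\<^esub> Id T []),
    ([x, x], [x, x], S_mor R x \<bullet>\<^bsub>T\<^esub> S_mor R x, (\<ominus> (\<zeta> \<oplus> inv \<zeta>)) \<odot>\<^bsub>Hom T [x, x] [x, x]\<^esub> S_mor R x),
    ([x], [x], (Ev T [flip x] \<parallel>\<^bsub>T\<^esub> Id T [x]) \<bullet>\<^bsub>T\<^esub> (Id T [flip x] \<parallel>\<^bsub>T\<^esub> S_mor R x) \<bullet>\<^bsub>T\<^esub> (Coev T [flip x] \<parallel>\<^bsub>T\<^esub> Id T [x]),
      b1 \<odot>\<^bsub>Hom T [x] [x]\<^esub> Id T [x]),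
    ([x, flip x], [x, flip x],
      (Id T [x] \<parallel>\<^bsub>T\<^esub> Ev T [x] \<parallel>\<^bsub>T\<^esub> Id T [flip x]) \<bullet>\<^bsub>T\<^esub> (S_mor R x \<parallel>\<^bsub>T\<^esub> S_mor R (flip x))
        \<bullet>\<^bsub>T\<^esub> (Id T [x] \<parallel>\<^bsub>T\<^esub> Coev T [x] \<parallel>\<^bsub>T\<^esub> Id T [flip x]),
      (Coev T [x] \<bullet>\<^bsub>T\<^esub> Ev T [x]) \<oplus>\<^bsub>Hom T [x, flip x] [x, flip x]\<^esub>
        (b2 \<odot>\<^bsub>Hom T [x, flip x] [x, flip x]\<^esub> (Id T [x] \<parallel>\<^bsub>T\<^esub> Id T [flip x]))),
    ([x, x, x], [x, x, x],
      ((S_mor R x \<parallel>\<^bsub>T\<^esub> Id T [x]) \<bullet>\<^bsub>T\<^esub> (Id T [x] \<parallel>\<^bsub>T\<^esub> S_mor R x) \<bullet>\<^bsub>T\<^esub> (S_mor R x \<parallel>\<^bsub>T\<^esub> Id T [x]))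
        \<oplus>\<^bsub>Hom T [x, x, x] [x, x, x]\<^esub> (Id T [x] \<parallel>\<^bsub>T\<^esub> S_mor R x),
      ((Id T [x] \<parallel>\<^bsub>T\<^esub> S_mor R x) \<bullet>\<^bsub>T\<^esub> (S_mor R x \<parallel>\<^bsub>T\<^esub> Id T [x]) \<bullet>\<^bsub>T\<^esub> (Id T [x] \<parallel>\<^bsub>T\<^esub> S_mor R x))
        \<oplus>\<^bsub>Hom T [x, x, x] [x, x, x]\<^esub> (S_mor R x \<parallel>\<^bsub>T\<^esub> Id T [x]))}" for x
  have rels: "moy_relations R \<alpha> \<zeta> n = (\<Union>x. (\<lambda>(a, b, f, g). f \<ominus>\<^bsub>Hom T a b\<^esub> g) ` rels x)"
    unfolding moy_relations_def rels_def Let_def T_def[symmetric] b_defs by simp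
  have parallel: "f \<in> carrier (Hom T a b) \<and> g \<in> carrier (Hom T a b)" if "(a, b, f, g) \<in> rels x" for a b f g x
    using that by (auto simp: rels_def T.hom_iff)
  have "moy_relations R \<alpha> \<zeta> n \<subseteq> (\<Union>a \<in> Obj T. \<Union>b \<in> Obj T. carrier (Hom T a b))"
  proof
    fix E assume "E \<in> moy_relations R \<alpha> \<zeta> n"
    then obtain a b f g x where E: "(a, b, f, g) \<in> rels x" "E = f \<ominus>\<^bsub>Hom T a b\<^esub> g"
      unfolding rels by auto
    interpret M: module R "Hom T a b" by (rule T.hom_module) simp_all
    show "E \<in> (\<Union>a \<in> Obj T. \<Union>b \<in> Obj T. carrier (Hom T a b))"
      using parallel[OF E(1)] E(2) by auto
  qed
  note ideal = T.generated_tensor_ideal[OF this, folded T_def, folded moy_ideal_def[of R \<alpha> \<zeta> n, folded T_def], folded I_def]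
  interpret Q: rigid_ideal_quotient R T I
    by (intro rigid_ideal_quotient.intro ideal_quotient.intro ideal(1)) unfold_locales
  have M: "MOY R \<alpha> \<zeta> n = Q.Q" by (simp add: MOY_def T_def I_def)
  have cl_rel: "Q.cl f = Q.cl g" if "(a, b, f, g) \<in> rels x" for a b f g x
  proof (rule Q.cl_eqI[of f a b g])
    have "f \<ominus>\<^bsub>Hom T a b\<^esub> g \<in> moy_relations R \<alpha> \<zeta> n" unfolding rels using that by force
    then show "f \<ominus>\<^bsub>Hom T a b\<^esub> g \<in> I" using ideal(2) by blast
  qed (use parallel[OF that] in simp_all)
  interpret Q': balanced_rigid_category R Q.Q by (rule Q.quotient_balanced_rigid)
  interpret moy: moy_category R Q.Q "\<lambda>x. Q.cl (S_mor R x)" \<alpha> \<zeta> b0 b1 b2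
  proof
    show "inv \<alpha> \<otimes> (inv \<zeta> \<otimes> b0 \<oplus> b1) = \<one>" "\<alpha> \<otimes> (\<zeta> \<otimes> b0 \<oplus> b1) = \<one>"
      "b0 \<oplus> ((\<zeta> \<oplus> inv \<zeta>) \<otimes> b1 \<oplus> b2) = \<zero>"
      using curl_identity[of \<alpha> "inv \<alpha>" \<zeta> "inv \<zeta>" "inv (\<zeta> \<ominus> inv \<zeta>)" b0 b1 b2] d assms(2,4)
      by (simp_all add: b_defs qbracket_values)
  next
    fix x
    show "Q.cl (S_mor R x) \<in> carrier (Hom Q.Q [x, x] [x, x])"
      by (auto simp: Q.Q_hom_iff T.hom_iff)
    show "left_transpose Q.Q [x, x] [x, x] (Q.cl (S_mor R x)) = Q.cl (S_mor R (flip x))"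
      by (simp add: Q.Q_transpose S_mor_transpose[folded T_def])
    note Q_simps = Q.Q_Comp Q.Q_Tens Q.Q_Add Q.Q_Smult
    show "Ev Q.Q [x] \<bullet>\<^bsub>Q.Q\<^esub> Coev Q.Q [x] = b0 \<odot>\<^bsub>Hom Q.Q [] []\<^esub> Id Q.Q []"
      using cl_rel[of "[]" "[]" _ _ x] by (simp add: Q_simps rels_def)
    show "Q.cl (S_mor R x) \<bullet>\<^bsub>Q.Q\<^esub> Q.cl (S_mor R x)
      = (\<ominus> (\<zeta> \<oplus> inv \<zeta>)) \<odot>\<^bsub>Hom Q.Q [x, x] [x, x]\<^esub> Q.cl (S_mor R x)"
      using cl_rel[of "[x, x]" "[x, x]" _ _ x] by (simp add: Q_simps rels_def del: minus_add)
    show "(Ev Q.Q [flip x] \<parallel>\<^bsub>Q.Q\<^esub> Id Q.Q [x]) \<bullet>\<^bsub>Q.Q\<^esub> (Id Q.Q [flip x] \<parallel>\<^bsub>Q.Q\<^esub> Q.cl (S_mor R x))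
      \<bullet>\<^bsub>Q.Q\<^esub> (Coev Q.Q [flip x] \<parallel>\<^bsub>Q.Q\<^esub> Id Q.Q [x]) = b1 \<odot>\<^bsub>Hom Q.Q [x] [x]\<^esub> Id Q.Q [x]"
      using cl_rel[of "[x]" "[x]" _ _ x] by (simp add: Q_simps rels_def)
    show "(Id Q.Q [x] \<parallel>\<^bsub>Q.Q\<^esub> Ev Q.Q [x] \<parallel>\<^bsub>Q.Q\<^esub> Id Q.Q [flip x])
        \<bullet>\<^bsub>Q.Q\<^esub> (Q.cl (S_mor R x) \<parallel>\<^bsub>Q.Q\<^esub> Q.cl (S_mor R (flip x)))
        \<bullet>\<^bsub>Q.Q\<^esub> (Id Q.Q [x] \<parallel>\<^bsub>Q.Q\<^esub> Coev Q.Q [x] \<parallel>\<^bsub>Q.Q\<^esub> Id Q.Q [flip x])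
      = (Coev Q.Q [x] \<bullet>\<^bsub>Q.Q\<^esub> Ev Q.Q [x]) \<oplus>\<^bsub>Hom Q.Q [x, flip x] [x, flip x]\<^esub>
        (b2 \<odot>\<^bsub>Hom Q.Q [x, flip x] [x, flip x]\<^esub> (Id Q.Q [x] \<parallel>\<^bsub>Q.Q\<^esub> Id Q.Q [flip x]))"
      using cl_rel[of "[x, flip x]" "[x, flip x]" _ _ x] by (simp add: Q_simps rels_def)
    show "((Q.cl (S_mor R x) \<parallel>\<^bsub>Q.Q\<^esub> Id Q.Q [x]) \<bullet>\<^bsub>Q.Q\<^esub> (Id Q.Q [x] \<parallel>\<^bsub>Q.Q\<^esub> Q.cl (S_mor R x))
          \<bullet>\<^bsub>Q.Q\<^esub> (Q.cl (S_mor R x) \<parallel>\<^bsub>Q.Q\<^esub> Id Q.Q [x]))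
        \<oplus>\<^bsub>Hom Q.Q [x, x, x] [x, x, x]\<^esub> (Id Q.Q [x] \<parallel>\<^bsub>Q.Q\<^esub> Q.cl (S_mor R x))
      = ((Id Q.Q [x] \<parallel>\<^bsub>Q.Q\<^esub> Q.cl (S_mor R x)) \<bullet>\<^bsub>Q.Q\<^esub> (Q.cl (S_mor R x) \<parallel>\<^bsub>Q.Q\<^esub> Id Q.Q [x])
          \<bullet>\<^bsub>Q.Q\<^esub> (Id Q.Q [x] \<parallel>\<^bsub>Q.Q\<^esub> Q.cl (S_mor R x)))
        \<oplus>\<^bsub>Hom Q.Q [x, x, x] [x, x, x]\<^esub> (Q.cl (S_mor R x) \<parallel>\<^bsub>Q.Q\<^esub> Id Q.Q [x])"
      using cl_rel[of "[x, x, x]" "[x, x, x]" _ _ x] by (simp add: Q_simps rels_def)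
  qed (use assms in simp_all)
  have "sigma_plus R \<alpha> \<zeta> n = moy.sigma Up True" "sigma_minus R \<alpha> \<zeta> n = moy.sigma Up False"
    using moy.arr_S[of Up]
    by (simp_all add: sigma_plus_def sigma_minus_def Let_def M S_MOY_def I_def[symmetric] T_def[symmetric]
        moy.sigma_def moy.tau_def moy.coef_def moy.weight_def Q'.plus_def Q'.scale_def del: Q.Q_simps)
  then show ?thesis using moy.rigid_braided_untwisted by (simp add: M)
qed

end
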